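(* Let $\mathcal{C}$ be a dg category over a commutative ring $\Bbbk$, let $z$ be a closed degree $2$ element of the center of $\mathcal{C}$, and let $X,Y\in\mathcal{C}$. Let $\tilde f(\epsilon),\tilde g(\epsilon),\tilde h(\epsilon),\tilde k(\epsilon)$ be the data of a strong homotopy equivalence $X\simeq Y$ in $\mathcal{C}$. Assume that $\mathcal{C}$ is complete with respect to a two-sided ideal $\mathfrak{n}$ containing $z$. Replacing $\epsilon\mapsto z+\epsilon$ yields well-defined morphisms in $\mathcal{C}[[\epsilon]]$ \[ f(\epsilon):=\tilde f(z+\epsilon),\quad g(\epsilon):=\tilde g(z+\epsilon),\quad h(\epsilon):=\tilde h(z+\epsilon),\quad k(\epsilon):=\tilde k(z+\epsilon), \] where, e.g., $\tilde f(z+\epsilon)=\sum_{l\ge 0}(z+\epsilon)^l\tilde f_l$. Let $(X,\alpha,z)$ be a curved twisted complex with curvature $z$ (i.e. $\alpha\in\operatorname{End}^1_{\mathcal{C}}(X)$ and $d_{\mathcal{C}}(\alpha)+\alpha^2=z_X$) such that $\alpha\in\operatorname{End}_{\mathcal{C}}(X)\cap\mathfrak{n}$. Define morphisms in $\mathcal{C}[[\epsilon]]$ by \[ F(\epsilon):=f(\epsilon)\circ(\operatorname{id}_X+\alpha\circ h(\epsilon))^{-1},\qquad G(\epsilon):=(\operatorname{id}_X+h(\epsilon)\circ\alpha)^{-1}\circ g(\epsilon), \] \[ H(\epsilon):=h(\epsilon)\circ(\operatorname{id}_X+\alpha\circ h(\epsilon))^{-1}, \] \[ \beta+\epsilon K(\epsilon):=(z+\epsilon)k(\epsilon)+f(\epsilon)\circ\alpha\circ(\operatorname{id}_X+h(\epsilon)\circ\alpha)^{-1}\circ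 g(\epsilon), \] where the last equation defines $\beta\in\operatorname{End}^1_{\mathcal{C}}(Y)$ as the coefficient of $\epsilon^0$ of the right-hand side and $\epsilon K(\epsilon)$ as the sum of all terms of positive degree in $\epsilon$. Then $(Y,\beta,z)$ is a curved twisted complex (i.e. $d_{\mathcal{C}}(\beta)+\beta^2=z_Y$), and $F(\epsilon),G(\epsilon),H(\epsilon),K(\epsilon)$ define a strong homotopy equivalence, in the dg category $\operatorname{cTw}(\mathcal{C})$ of curved twisted complexes, relating $(X,\alpha,z)$ and $(Y,\beta,z)$.
   Context: Dg categories are $\Bbbk$-linear, with $\mathbb{Z}$-graded hom complexes, differential $d$ of degree $+1$, and Leibniz rule $d(f\circ g)=d(f)\circ g+(-1)^{|f|}f\circ d(g)$. Center: a closed degree $2$ element $z$ of the center of $\mathcal{C}$ is a closed degree $2$ natural transformation of the identity functor, i.e. a family $z_X\in\operatorname{End}^2_{\mathcal{C}}(X)$ with $d(z_X)=0$ and $z_Y\circ f=f\circ z_X$ for all $f\in\operatorname{Hom}_{\mathcal{C}}(X,Y)$. One writes $zf$ for $z_Y\circ f$. Ideals and completeness: a two-sided ideal $\mathfrak{n}$ is a family of graded submodules $\mathfrak{n}(X,Y)\subset\operatorname{Hom}_{\mathcal{C}}(X,Y)$ stable under left and right composition with arbitrary morphisms; it contains $z$ if all $z_X\in\mathfrak{n}(X,X)$. $\mathfrak{n}^k$ is the ideal of finite sums of $k$-fold compositions of morphisms in $\mathfrak{n}$. $\mathcal{C}$ is complete with respect to $\mathfrak{n}$ if in each degree the map $\operatorname{Hom}_{\mathcal{C}}(X,Y)\to\varprojlim_k\operatorname{Hom}_{\mathcal{C}}(X,Y)/\mathfrak{n}^k(X,Y)$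 is an isomorphism, so that infinite sums with terms lying in higher and higher powers of $\mathfrak{n}$ converge. $\mathcal{C}[[\epsilon]]$: here $\epsilon$ is a formal variable of degree $2$. $\mathcal{C}[[\epsilon]]$ has the same objects as $\mathcal{C}$; a degree $l$ morphism $X\to Y$ is a formal series $\sum_{i\ge0}f_i\epsilon^i$ with $f_i\in\operatorname{Hom}^{l-2i}_{\mathcal{C}}(X,Y)$; composition and differential are $\epsilon$-linear. Strong homotopy equivalence: for any dg category $\mathcal{D}$, a strong homotopy equivalence $X\simeq Y$ in $\mathcal{D}$ consists of morphisms in $\mathcal{D}[[\epsilon]]$: $f:X\to Y$, $g:Y\to X$ of degree $0$, and $h:X\to X$, $k:Y\to Y$ of degree $-1$, such that \[ d(f)=\epsilon(fh-kf),\quad d(g)=\epsilon(gk-hg),\quad d(h)=\operatorname{id}_X-gf-\epsilon h^2,\quad d(k)=\operatorname{id}_Y-fg-\epsilon k^2 . \] Curved twisted complexes: $\operatorname{cTw}(\mathcal{C})$ is the dg category with objects the triples $(X,\alpha,z_X)$, where $X\in\mathcal{C}$, $z_X\in\operatorname{End}^2_{\mathcal{C}}(X)$, $\alpha\in\operatorname{End}^1_{\mathcal{C}}(X)$ and $d_{\mathcal{C}}(\alpha)+\alpha^2=z_X$. Morphisms $(X,\alpha,z_X)\to(Y,\beta,z_Y)$ are the morphisms $f\in\operatorname{Hom}_{\mathcal{C}}(X,Y)$ with $z_Y\circ f=f\circ z_X$, with differential $d_{\operatorname{cTw}(\mathcal{C})}(f)=d_{\mathcal{C}}(f)+\beta\circ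 f-(-1)^{|f|}f\circ\alpha$. For $z$ in the center, $(X,\alpha,z)$ means $(X,\alpha,z_X)$. *)

theory Defs
  imports "HOL-Library.Function_Algebras"
begin

section \<open>Dg categories\<close>

text \<open>
  The degree \<open>n\<close> part of the hom complex from \<open>X\<close> to \<open>Y\<close> is a subset \<open>Hom C X Y n\<close> of one abelian
  group \<open>'m\<close>. Up to isomorphism this is no restriction: for \<open>'m\<close> one can take the direct sum of all
  the modules of morphisms, on which composition is one (partially meaningful) binary operation.
  No axiom constrains how distinct hom sets intersect. The differential carries its source, target
  and degree, because in the category of curved twisted complexes the same element of \<open>'m\<close> has
  different differentials between different objects. Nothing is required outside the hom sets.
\<close>

record ('o, 'm, 'k) dgcat =
  Obj :: "'o set"
  Hom :: "'o \<Rightarrow> 'o \<Rightarrow> int \<Rightarrow> 'm set"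
  smul :: "'k \<Rightarrow> 'm \<Rightarrow> 'm"
  ident :: "'o \<Rightarrow> 'm"
  cmp :: "'m \<Rightarrow> 'm \<Rightarrow> 'm"  (infixr \<open>\<cdot>\<index>\<close> 75)
  dif :: "'o \<Rightarrow> 'o \<Rightarrow> int \<Rightarrow> 'm \<Rightarrow> 'm"

definition ksign :: "int \<Rightarrow> 'm \<Rightarrow> 'm::ab_group_add" where
  "ksign n x = (if even n then x else - x)"

definition submodule :: "('k \<Rightarrow> 'm \<Rightarrow> 'm) \<Rightarrow> 'm::ab_group_add set \<Rightarrow> bool" where
  "submodule s S \<longleftrightarrow> 0 \<in> S \<and> (\<forall>x\<in>S. \<forall>y\<in>S. x + y \<in> S) \<and> (\<forall>a. \<forall>x\<in>S. s a x \<in> S)"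

text \<open>
  The sort of \<open>'k\<close> describes commutative rings with unit, the zero ring included
  (which the class \<open>comm_ring_1\<close> excludes).
\<close>

locale dg_category =
  fixes C :: "('o, 'm::ab_group_add, 'k::{comm_ring, comm_monoid_mult}) dgcat" (structure)
  assumes hom_submodule:
      "\<lbrakk>X \<in> Obj C; Y \<in> Obj C\<rbrakk> \<Longrightarrow> submodule (smul C) (Hom C X Y n)"
    and smul_add_right:
      "\<lbrakk>X \<in> Obj C; Y \<in> Obj C; f \<in> Hom C X Y n; g \<in> Hom C X Y n\<rbrakk>
        \<Longrightarrow> smul C a (f + g) = smul C a f + smul C a g"
    and smul_add_left:
      "\<lbrakk>X \<in> Obj C; Y \<in> Obj C; f \<in> Hom C X Y n\<rbrakk> \<Longrightarrow> smul C (a + b) f = smul C a f + smul C b f"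
    and smul_mult:
      "\<lbrakk>X \<in> Obj C; Y \<in> Obj C; f \<in> Hom C X Y n\<rbrakk> \<Longrightarrow> smul C (a * b) f = smul C a (smul C b f)"
    and smul_one:
      "\<lbrakk>X \<in> Obj C; Y \<in> Obj C; f \<in> Hom C X Y n\<rbrakk> \<Longrightarrow> smul C 1 f = f"
    and ident_in:
      "X \<in> Obj C \<Longrightarrow> ident C X \<in> Hom C X X 0"
    and cmp_in:
      "\<lbrakk>X \<in> Obj C; Y \<in> Obj C; Z \<in> Obj C; g \<in> Hom C Y Z m; f \<in> Hom C X Y n\<rbrakk>
        \<Longrightarrow> g \<cdot> f \<in> Hom C X Z (m + n)"
    and ident_left:
      "\<lbrakk>X \<in> Obj C; Y \<in> Obj C; f \<in> Hom C X Y n\<rbrakk> \<Longrightarrow> ident C Y \<cdot> f = f"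
    and ident_right:
      "\<lbrakk>X \<in> Obj C; Y \<in> Obj C; f \<in> Hom C X Y n\<rbrakk> \<Longrightarrow> f \<cdot> ident C X = f"
    and cmp_assoc:
      "\<lbrakk>W \<in> Obj C; X \<in> Obj C; Y \<in> Obj C; Z \<in> Obj C;
        h \<in> Hom C Y Z l; g \<in> Hom C X Y m; f \<in> Hom C W X n\<rbrakk>
        \<Longrightarrow> (h \<cdot> g) \<cdot> f = h \<cdot> (g \<cdot> f)"
    and cmp_add_left:
      "\<lbrakk>X \<in> Obj C; Y \<in> Obj C; Z \<in> Obj C;
        g \<in> Hom C Y Z m; g' \<in> Hom C Y Z m; f \<in> Hom C X Y n\<rbrakk>
        \<Longrightarrow> (g + g') \<cdot> f = g \<cdot> f + g' \<cdot> f"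
    and cmp_add_right:
      "\<lbrakk>X \<in> Obj C; Y \<in> Obj C; Z \<in> Obj C;
        g \<in> Hom C Y Z m; f \<in> Hom C X Y n; f' \<in> Hom C X Y n\<rbrakk>
        \<Longrightarrow> g \<cdot> (f + f') = g \<cdot> f + g \<cdot> f'"
    and cmp_smul_left:
      "\<lbrakk>X \<in> Obj C; Y \<in> Obj C; Z \<in> Obj C; g \<in> Hom C Y Z m; f \<in> Hom C X Y n\<rbrakk>
        \<Longrightarrow> smul C a g \<cdot> f = smul C a (g \<cdot> f)"
    and cmp_smul_right:
      "\<lbrakk>X \<in> Obj C; Y \<in> Obj C; Z \<in> Obj C; g \<in> Hom C Y Z m; f \<in> Hom C X Y n\<rbrakk>
        \<Longrightarrow> g \<cdot> smul C a f = smul C a (g \<cdot> f)"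
    and dif_in:
      "\<lbrakk>X \<in> Obj C; Y \<in> Obj C; f \<in> Hom C X Y n\<rbrakk> \<Longrightarrow> dif C X Y n f \<in> Hom C X Y (n + 1)"
    and dif_add:
      "\<lbrakk>X \<in> Obj C; Y \<in> Obj C; f \<in> Hom C X Y n; g \<in> Hom C X Y n\<rbrakk>
        \<Longrightarrow> dif C X Y n (f + g) = dif C X Y n f + dif C X Y n g"
    and dif_smul:
      "\<lbrakk>X \<in> Obj C; Y \<in> Obj C; f \<in> Hom C X Y n\<rbrakk>
        \<Longrightarrow> dif C X Y n (smul C a f) = smul C a (dif C X Y n f)"
    and dif_dif:
      "\<lbrakk>X \<in> Obj C; Y \<in> Obj C; f \<in> Hom C X Y n\<rbrakk> \<Longrightarrow> dif C X Y (n + 1) (dif C X Y n f) = 0"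
    and leibniz:
      "\<lbrakk>X \<in> Obj C; Y \<in> Obj C; Z \<in> Obj C; f \<in> Hom C Y Z m; g \<in> Hom C X Y n\<rbrakk>
        \<Longrightarrow> dif C X Z (m + n) (f \<cdot> g) = dif C Y Z m f \<cdot> g + ksign m (f \<cdot> dif C X Y n g)"

definition closed_central2 :: "('o, 'm::ab_group_add, 'k) dgcat \<Rightarrow> ('o \<Rightarrow> 'm) \<Rightarrow> bool" where
  "closed_central2 C z \<longleftrightarrow>
     (\<forall>X\<in>Obj C. z X \<in> Hom C X X 2 \<and> dif C X X 2 (z X) = 0) \<and>
     (\<forall>X\<in>Obj C. \<forall>Y\<in>Obj C. \<forall>n. \<forall>f\<in>Hom C X Y n. z Y \<cdot>\<^bsub>C\<^esub> f = f \<cdot>\<^bsub>C\<^esub> z X)"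

fun mor_pow :: "('o, 'm, 'k) dgcat \<Rightarrow> 'o \<Rightarrow> 'm \<Rightarrow> nat \<Rightarrow> 'm" where
  "mor_pow C X a 0 = ident C X"
| "mor_pow C X a (Suc l) = a \<cdot>\<^bsub>C\<^esub> mor_pow C X a l"

definition is_inverse :: "('o, 'm, 'k) dgcat \<Rightarrow> 'o \<Rightarrow> 'm \<Rightarrow> 'm \<Rightarrow> bool" where
  "is_inverse C X a b \<longleftrightarrow>
     b \<in> Hom C X X 0 \<and> a \<cdot>\<^bsub>C\<^esub> b = ident C X \<and> b \<cdot>\<^bsub>C\<^esub> a = ident C X"

definition mor_inv :: "('o, 'm, 'k) dgcat \<Rightarrow> 'o \<Rightarrow> 'm \<Rightarrow> 'm" where
  "mor_inv C X a = (THE b. is_inverse C X a b)"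


section \<open>Ideals and completeness\<close>

definition two_sided_ideal ::
    "('o, 'm::ab_group_add, 'k) dgcat \<Rightarrow> ('o \<Rightarrow> 'o \<Rightarrow> int \<Rightarrow> 'm set) \<Rightarrow> bool" where
  "two_sided_ideal C \<nn> \<longleftrightarrow>
     (\<forall>X\<in>Obj C. \<forall>Y\<in>Obj C. \<forall>n. \<nn> X Y n \<subseteq> Hom C X Y n \<and> submodule (smul C) (\<nn> X Y n)) \<and>
     (\<forall>X\<in>Obj C. \<forall>Y\<in>Obj C. \<forall>Z\<in>Obj C. \<forall>m n. \<forall>g\<in>Hom C Y Z m. \<forall>f\<in>\<nn> X Y n.
        g \<cdot>\<^bsub>C\<^esub> f \<in> \<nn> X Z (m + n)) \<and>
     (\<forall>X\<in>Obj C. \<forall>Y\<in>Obj C. \<forall>Z\<in>Obj C. \<forall>m n. \<forall>g\<in>\<nn> Y Z m. \<forall>f\<in>Hom C X Y n.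
        g \<cdot>\<^bsub>C\<^esub> f \<in> \<nn> X Z (m + n))"

text \<open>The \<open>k\<close>-fold compositions of homogeneous morphisms of the ideal. For \<open>k = 0\<close> all morphisms are
  taken, so that the zeroth power is the unit ideal.\<close>

fun fold_comps ::
    "('o, 'm, 'k) dgcat \<Rightarrow> ('o \<Rightarrow> 'o \<Rightarrow> int \<Rightarrow> 'm set) \<Rightarrow> nat \<Rightarrow> 'o \<Rightarrow> 'o \<Rightarrow> int \<Rightarrow> 'm set" where
  "fold_comps C \<nn> 0 X Y n = Hom C X Y n"
| "fold_comps C \<nn> (Suc 0) X Y n = \<nn> X Y n"
| "fold_comps C \<nn> (Suc (Suc k)) X Y n =
     {g \<cdot>\<^bsub>C\<^esub> f | g f Z m. Z \<in> Obj C \<and> g \<in> \<nn> Z Y m \<and> f \<in> fold_comps C \<nn> (Suc k) X Z (n - m)}"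

definition ideal_pow ::
    "('o, 'm::ab_group_add, 'k) dgcat \<Rightarrow> ('o \<Rightarrow> 'o \<Rightarrow> int \<Rightarrow> 'm set) \<Rightarrow> nat
      \<Rightarrow> 'o \<Rightarrow> 'o \<Rightarrow> int \<Rightarrow> 'm set" where
  "ideal_pow C \<nn> k X Y n = {sum_list xs | xs. set xs \<subseteq> fold_comps C \<nn> k X Y n}"

text \<open>The inverse limit consists of the sequences of cosets \<open>c k \<in> Hom / \<nn>^k\<close> that are compatible
  with the projections; as \<open>\<nn>^(k+1) \<subseteq> \<nn>^k\<close>, the projection of a coset \<open>c (k+1)\<close> is the
  unique coset of \<open>\<nn>^k\<close> that contains it.\<close>

definition inv_limit ::
    "('o, 'm::ab_group_add, 'k) dgcat \<Rightarrow> ('o \<Rightarrow> 'o \<Rightarrow> int \<Rightarrow> 'm set)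
      \<Rightarrow> 'o \<Rightarrow> 'o \<Rightarrow> int \<Rightarrow> (nat \<Rightarrow> 'm set) set" where
  "inv_limit C \<nn> X Y n =
     {c. (\<forall>k. \<exists>f\<in>Hom C X Y n. c k = (+) f ` ideal_pow C \<nn> k X Y n) \<and> (\<forall>k. c (Suc k) \<subseteq> c k)}"

text \<open>The canonical map to the inverse limit is linear, so it is an isomorphism iff it is bijective.\<close>

definition complete_wrt ::
    "('o, 'm::ab_group_add, 'k) dgcat \<Rightarrow> ('o \<Rightarrow> 'o \<Rightarrow> int \<Rightarrow> 'm set) \<Rightarrow> bool" where
  "complete_wrt C \<nn> \<longleftrightarrow>
     (\<forall>X\<in>Obj C. \<forall>Y\<in>Obj C. \<forall>n.
        bij_betw (\<lambda>f k. (+) f ` ideal_pow C \<nn> k X Y n) (Hom C X Y n) (inv_limit C \<nn> X Y n))"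

definition adic_sums ::
    "('o, 'm::ab_group_add, 'k) dgcat \<Rightarrow> ('o \<Rightarrow> 'o \<Rightarrow> int \<Rightarrow> 'm set)
      \<Rightarrow> 'o \<Rightarrow> 'o \<Rightarrow> int \<Rightarrow> (nat \<Rightarrow> 'm) \<Rightarrow> 'm \<Rightarrow> bool" where
  "adic_sums C \<nn> X Y n a s \<longleftrightarrow>
     s \<in> Hom C X Y n \<and> (\<forall>k. \<exists>N. \<forall>M\<ge>N. s - (\<Sum>l<M. a l) \<in> ideal_pow C \<nn> k X Y n)"


section \<open>Formal power series in a variable of degree 2\<close>

text \<open>A series is the sequence of its coefficients. No signs occur, as \<open>\<epsilon>\<close> has even degree.\<close>

definition ps_cat :: "('o, 'm::ab_group_add, 'k) dgcat \<Rightarrow> ('o, nat \<Rightarrow> 'm, 'k) dgcat" where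
  "ps_cat C =
     \<lparr>Obj = Obj C,
      Hom = (\<lambda>X Y l. {f. \<forall>i. f i \<in> Hom C X Y (l - 2 * int i)}),
      smul = (\<lambda>a f i. smul C a (f i)),
      ident = (\<lambda>X i. if i = 0 then ident C X else 0),
      cmp = (\<lambda>g f i. \<Sum>j\<le>i. g j \<cdot>\<^bsub>C\<^esub> f (i - j)),
      dif = (\<lambda>X Y l f i. dif C X Y (l - 2 * int i) (f i))\<rparr>"

definition ps_const :: "'m::zero \<Rightarrow> nat \<Rightarrow> 'm" where
  "ps_const a = (\<lambda>i. if i = 0 then a else 0)"

definition eps_mult :: "(nat \<Rightarrow> 'm::zero) \<Rightarrow> nat \<Rightarrow> 'm" where
  "eps_mult f = (\<lambda>i. case i of 0 \<Rightarrow> 0 | Suc j \<Rightarrow> f j)"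

definition z_plus_eps ::
    "('o, 'm::ab_group_add, 'k) dgcat \<Rightarrow> ('o \<Rightarrow> 'm) \<Rightarrow> 'o \<Rightarrow> nat \<Rightarrow> 'm" where
  "z_plus_eps C z X = ps_const (z X) + eps_mult (ident (ps_cat C) X)"

text \<open>\<open>is_subst C \<nn> z X Y n a s\<close>: the series \<open>\<Sum>l. (z + \<epsilon>)^l a\<^sub>l\<close> of morphisms of degree \<open>n\<close>
  converges to \<open>s\<close>, that is, each of its \<open>\<epsilon>\<close>-coefficients converges \<open>\<nn>\<close>-adically.\<close>

definition is_subst ::
    "('o, 'm::ab_group_add, 'k) dgcat \<Rightarrow> ('o \<Rightarrow> 'o \<Rightarrow> int \<Rightarrow> 'm set) \<Rightarrow> ('o \<Rightarrow> 'm)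
      \<Rightarrow> 'o \<Rightarrow> 'o \<Rightarrow> int \<Rightarrow> (nat \<Rightarrow> 'm) \<Rightarrow> (nat \<Rightarrow> 'm) \<Rightarrow> bool" where
  "is_subst C \<nn> z X Y n a s \<longleftrightarrow>
     (\<forall>i. adic_sums C \<nn> X Y (n - 2 * int i)
        (\<lambda>l. (mor_pow (ps_cat C) Y (z_plus_eps C z Y) l \<cdot>\<^bsub>ps_cat C\<^esub> ps_const (a l)) i) (s i))"

definition subst_eps ::
    "('o, 'm::ab_group_add, 'k) dgcat \<Rightarrow> ('o \<Rightarrow> 'o \<Rightarrow> int \<Rightarrow> 'm set) \<Rightarrow> ('o \<Rightarrow> 'm)
      \<Rightarrow> 'o \<Rightarrow> 'o \<Rightarrow> int \<Rightarrow> (nat \<Rightarrow> 'm) \<Rightarrow> (nat \<Rightarrow> 'm)" where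
  "subst_eps C \<nn> z X Y n a = (THE s. is_subst C \<nn> z X Y n a s)"

definition strong_homotopy_equiv ::
    "('o, 'm::ab_group_add, 'k) dgcat \<Rightarrow> 'o \<Rightarrow> 'o
      \<Rightarrow> (nat \<Rightarrow> 'm) \<Rightarrow> (nat \<Rightarrow> 'm) \<Rightarrow> (nat \<Rightarrow> 'm) \<Rightarrow> (nat \<Rightarrow> 'm) \<Rightarrow> bool" where
  "strong_homotopy_equiv D X Y f g h k \<longleftrightarrow>
     (let E = ps_cat D in
       X \<in> Obj D \<and> Y \<in> Obj D \<and>
       f \<in> Hom E X Y 0 \<and> g \<in> Hom E Y X 0 \<and> h \<in> Hom E X X (-1) \<and> k \<in> Hom E Y Y (-1) \<and>
       dif E X Y 0 f = eps_mult (f \<cdot>\<^bsub>E\<^esub> h - k \<cdot>\<^bsub>E\<^esub> f) \<and>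
       dif E Y X 0 g = eps_mult (g \<cdot>\<^bsub>E\<^esub> k - h \<cdot>\<^bsub>E\<^esub> g) \<and>
       dif E X X (-1) h = ident E X - g \<cdot>\<^bsub>E\<^esub> f - eps_mult (h \<cdot>\<^bsub>E\<^esub> h) \<and>
       dif E Y Y (-1) k = ident E Y - f \<cdot>\<^bsub>E\<^esub> g - eps_mult (k \<cdot>\<^bsub>E\<^esub> k))"


section \<open>Curved twisted complexes\<close>

definition cTw :: "('o, 'm::ab_group_add, 'k) dgcat \<Rightarrow> ('o \<times> 'm \<times> 'm, 'm, 'k) dgcat" where
  "cTw C =
     \<lparr>Obj = {(X, \<alpha>, w). X \<in> Obj C \<and> w \<in> Hom C X X 2 \<and> \<alpha> \<in> Hom C X X 1 \<and>
                dif C X X 1 \<alpha> + \<alpha> \<cdot>\<^bsub>C\<^esub> \<alpha> = w},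
      Hom = (\<lambda>(X, \<alpha>, w) (Y, \<beta>, v) n. {f \<in> Hom C X Y n. v \<cdot>\<^bsub>C\<^esub> f = f \<cdot>\<^bsub>C\<^esub> w}),
      smul = smul C,
      ident = (\<lambda>(X, \<alpha>, w). ident C X),
      cmp = cmp C,
      dif = (\<lambda>(X, \<alpha>, w) (Y, \<beta>, v) n f.
               dif C X Y n f + \<beta> \<cdot>\<^bsub>C\<^esub> f - ksign n (f \<cdot>\<^bsub>C\<^esub> \<alpha>))\<rparr>"

end

(* The powers of the ideal generated by the ideal and by epsilon filter C[[epsilon]] completely, so
   that z + epsilon can be substituted for epsilon and id + alpha h has a geometric series inverse.
   The substitution is multiplicative and commutes with d; hence f, g, h, k satisfy the equations of a
   strong homotopy equivalence with epsilon replaced by the central element t = z + epsilon. Put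
   u = id + alpha h and R = beta + epsilon K. From d(alpha) + alpha^2 = t - epsilon one gets
   d(u) = t u h - alpha u - epsilon h + alpha g f, hence a formula for d(u^-1), and then
     d(F) + R F - F alpha = epsilon F H,     d(G) + alpha G - G R = - epsilon H G,
     d(H) + alpha H + H alpha = id - G F - epsilon H^2,     d(R) + R^2 = t - epsilon F G.
   Splitting R into its constant term and the rest gives the theorem. *)

theory Submission
  imports Defs "HOL-Computational_Algebra.Formal_Power_Series"
begin

section \<open>Sums and signs in dg categories\<close>

text \<open>For alpha = 0 and t = epsilon the perturbed identities are the original equations, with
  R = t k. In general alpha carries the difference: its curvature is z = t - epsilon, and perturbing
  by it trades t for epsilon in the equations. This is why the variable has to be shifted by exactly
  z beforehand. Two obstacles shape the proof. The ideal is not assumed stable under d, so d costs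
  one step of the filtration, and a limit is differentiated by looking one term further ahead. And
  the perturbed identities are long noncommutative computations in which composition is partial and
  signs depend on degrees. They are moved to a ring of operators, where d becomes an element D, the
  Leibniz rule becomes a commutator, and each identity is checked by rewriting both sides to a
  normal form. Degrees and signs are met only in the translation into this ring and back.\<close>

lemma ksign_sum: "ksign n (sum f A) = (\<Sum>i\<in>A. ksign n (f i))"
  by (simp add: ksign_def sum_negf)

lemma ksign_cong: "even m = even n \<Longrightarrow> ksign m x = ksign n x"
  by (simp add: ksign_def)

lemma ksign_apply: "ksign n f i = ksign n (f i)"
  by (simp add: ksign_def)

lemma sum_fun_apply: "(\<Sum>i\<in>A. f i) x = (\<Sum>i\<in>A. f i x)"
  by (induction A rule: infinite_finite_induct) auto

context dg_category
begin

lemma hom_zero: "\<lbrakk>X \<in> Obj C; Y \<in> Obj C\<rbrakk> \<Longrightarrow> 0 \<in> Hom C X Y n"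
  using hom_submodule by (auto simp: submodule_def)

lemma hom_add:
  "\<lbrakk>X \<in> Obj C; Y \<in> Obj C; f \<in> Hom C X Y n; g \<in> Hom C X Y n\<rbrakk> \<Longrightarrow> f + g \<in> Hom C X Y n"
  using hom_submodule[of X Y n] by (auto simp: submodule_def)

text \<open>Submodules are closed under sums and scalars only, so negation inside a hom set or an
  ideal has to come from the scalar -1.\<close>

lemma smul_minus_one:
  assumes "X \<in> Obj C" "Y \<in> Obj C" "f \<in> Hom C X Y n"
  shows "smul C (- 1) f = - f"
proof -
  have "smul C 0 f + smul C 0 f = smul C 0 f"
    using smul_add_left[OF assms, of 0 0] by simp
  moreover have "smul C (- 1) f + f = smul C 0 f"
    using smul_add_left[OF assms, of "- 1" 1] smul_one[OF assms] by simp
  ultimately show ?thesis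
    by (simp add: eq_neg_iff_add_eq_0)
qed

lemma hom_uminus:
  assumes "X \<in> Obj C" "Y \<in> Obj C" "f \<in> Hom C X Y n"
  shows "- f \<in> Hom C X Y n"
proof -
  have "smul C (- 1) f \<in> Hom C X Y n"
    using hom_submodule[of X Y n] assms unfolding submodule_def by blast
  then show ?thesis
    by (simp add: smul_minus_one[OF assms])
qed

lemma hom_diff:
  "\<lbrakk>X \<in> Obj C; Y \<in> Obj C; f \<in> Hom C X Y n; g \<in> Hom C X Y n\<rbrakk> \<Longrightarrow> f - g \<in> Hom C X Y n"
  using hom_add[of X Y f n "- g"] hom_uminus[of X Y g n] by simp

lemma hom_sum:
  "\<lbrakk>X \<in> Obj C; Y \<in> Obj C; \<And>i. i \<in> A \<Longrightarrow> f i \<in> Hom C X Y n\<rbrakk> \<Longrightarrow> sum f A \<in> Hom C X Y n"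
  by (induction A rule: infinite_finite_induct) (auto simp: hom_zero hom_add)

lemma cmp_zero_left:
  assumes "X \<in> Obj C" "Y \<in> Obj C" "Z \<in> Obj C" "f \<in> Hom C X Y n"
  shows "0 \<cdot> f = 0"
  using cmp_add_left[OF assms(1-3) hom_zero hom_zero assms(4)] assms by simp

lemma cmp_zero_right:
  assumes "X \<in> Obj C" "Y \<in> Obj C" "Z \<in> Obj C" "g \<in> Hom C Y Z n"
  shows "g \<cdot> 0 = 0"
  using cmp_add_right[OF assms hom_zero hom_zero] assms by simp

lemma cmp_uminus_left:
  assumes "X \<in> Obj C" "Y \<in> Obj C" "Z \<in> Obj C" "g \<in> Hom C Y Z m" "f \<in> Hom C X Y n"
  shows "(- g) \<cdot> f = - (g \<cdot> f)"
  using cmp_add_left[OF assms(1-4) hom_uminus[OF assms(2-4)] assms(5)] cmp_zero_left[OF assms(1-3,5)]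
  by (simp add: eq_neg_iff_add_eq_0 add.commute)

lemma cmp_uminus_right:
  assumes "X \<in> Obj C" "Y \<in> Obj C" "Z \<in> Obj C" "g \<in> Hom C Y Z m" "f \<in> Hom C X Y n"
  shows "g \<cdot> (- f) = - (g \<cdot> f)"
  using cmp_add_right[OF assms hom_uminus[OF assms(1,2,5)]] cmp_zero_right[OF assms(1-4)]
  by (simp add: eq_neg_iff_add_eq_0 add.commute)

lemma cmp_diff_left:
  assumes "X \<in> Obj C" "Y \<in> Obj C" "Z \<in> Obj C"
    "g \<in> Hom C Y Z m" "g' \<in> Hom C Y Z m" "f \<in> Hom C X Y n"
  shows "(g - g') \<cdot> f = g \<cdot> f - g' \<cdot> f"
  using cmp_add_left[OF assms(1-4) hom_uminus assms(6)] cmp_uminus_left[OF assms(1-3,5,6)] assms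
  by simp

lemma cmp_diff_right:
  assumes "X \<in> Obj C" "Y \<in> Obj C" "Z \<in> Obj C"
    "g \<in> Hom C Y Z m" "f \<in> Hom C X Y n" "f' \<in> Hom C X Y n"
  shows "g \<cdot> (f - f') = g \<cdot> f - g \<cdot> f'"
  using cmp_add_right[OF assms(1-5) hom_uminus] cmp_uminus_right[OF assms(1-4,6)] assms
  by simp

lemma cmp_sum_left:
  assumes "X \<in> Obj C" "Y \<in> Obj C" "Z \<in> Obj C"
    "\<And>i. i \<in> A \<Longrightarrow> g i \<in> Hom C Y Z m" "f \<in> Hom C X Y n"
  shows "sum g A \<cdot> f = (\<Sum>i\<in>A. g i \<cdot> f)"
  using assms(4)
proof (induction A rule: infinite_finite_induct)
  case (insert i A)
  then show ?case
    using cmp_add_left[OF assms(1-3) _ hom_sum assms(5), of "g i" m A g] assms by simp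
qed (use cmp_zero_left assms in auto)

lemma cmp_sum_right:
  assumes "X \<in> Obj C" "Y \<in> Obj C" "Z \<in> Obj C"
    "g \<in> Hom C Y Z m" "\<And>i. i \<in> A \<Longrightarrow> f i \<in> Hom C X Y n"
  shows "g \<cdot> sum f A = (\<Sum>i\<in>A. g \<cdot> f i)"
  using assms(5)
proof (induction A rule: infinite_finite_induct)
  case (insert i A)
  then show ?case
    using cmp_add_right[OF assms(1-4) _ hom_sum, of "f i" n A f] assms by simp
qed (use cmp_zero_right assms in auto)

lemma dif_zero: "\<lbrakk>X \<in> Obj C; Y \<in> Obj C\<rbrakk> \<Longrightarrow> dif C X Y n 0 = 0"
  using dif_add[of X Y 0 n 0] hom_zero[of X Y n] by simp

lemma dif_uminus:
  "\<lbrakk>X \<in> Obj C; Y \<in> Obj C; f \<in> Hom C X Y n\<rbrakk> \<Longrightarrow> dif C X Y n (- f) = - dif C X Y n f"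
  using dif_add[of X Y f n "- f"] hom_uminus[of X Y f n] dif_zero[of X Y n]
  by (simp add: eq_neg_iff_add_eq_0 add.commute)

lemma dif_diff:
  "\<lbrakk>X \<in> Obj C; Y \<in> Obj C; f \<in> Hom C X Y n; g \<in> Hom C X Y n\<rbrakk>
    \<Longrightarrow> dif C X Y n (f - g) = dif C X Y n f - dif C X Y n g"
  using dif_add[of X Y f n "- g"] hom_uminus[of X Y g n] dif_uminus[of X Y g n] by simp

lemma dif_sum:
  assumes "X \<in> Obj C" "Y \<in> Obj C" "\<And>i. i \<in> A \<Longrightarrow> f i \<in> Hom C X Y n"
  shows "dif C X Y n (sum f A) = (\<Sum>i\<in>A. dif C X Y n (f i))"
  using assms(3)
proof (induction A rule: infinite_finite_induct)
  case (insert i A)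
  then show ?case
    using dif_add[OF assms(1,2) _ hom_sum, of "f i" n A f] assms by simp
qed (use dif_zero assms in auto)

lemma dif_ident: "X \<in> Obj C \<Longrightarrow> dif C X X 0 (ident C X) = 0"
proof -
  assume X: "X \<in> Obj C"
  have i: "ident C X \<in> Hom C X X 0" using ident_in X .
  have d: "dif C X X 0 (ident C X) \<in> Hom C X X 1" using dif_in[OF X X i] by simp
  show ?thesis
    using leibniz[OF X X X i i] ident_left[OF X X i] ident_left[OF X X d] ident_right[OF X X d]
    by (simp add: ksign_def)
qed

section \<open>Powers of an endomorphism\<close>

lemma mor_pow_in:
  assumes "X \<in> Obj C" "a \<in> Hom C X X n"
  shows "mor_pow C X a l \<in> Hom C X X (int l * n)"
proof (induction l)
  case (Suc l)
  then show ?case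
    using cmp_in[OF assms(1,1,1,2) Suc] by (simp add: algebra_simps)
qed (use assms ident_in in simp)

lemma mor_pow_add:
  assumes "X \<in> Obj C" "a \<in> Hom C X X n"
  shows "mor_pow C X a (k + l) = mor_pow C X a k \<cdot> mor_pow C X a l"
proof (induction k)
  case 0
  show ?case using ident_left[OF assms(1,1) mor_pow_in[OF assms]] by simp
next
  case (Suc k)
  then show ?case
    using cmp_assoc[OF assms(1,1,1,1,2) mor_pow_in[OF assms] mor_pow_in[OF assms]] by simp
qed

lemma mor_pow_commute:
  assumes "X \<in> Obj C" "Y \<in> Obj C" "a \<in> Hom C X X m" "b \<in> Hom C Y Y m" "f \<in> Hom C X Y n"
    and "b \<cdot> f = f \<cdot> a"
  shows "mor_pow C Y b l \<cdot> f = f \<cdot> mor_pow C X a l"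
proof (induction l)
  case 0
  show ?case using assms ident_left ident_right by simp
next
  case (Suc l)
  have "mor_pow C Y b (Suc l) \<cdot> f = b \<cdot> (f \<cdot> mor_pow C X a l)"
    using cmp_assoc[OF assms(1,2,2,2,4) mor_pow_in[OF assms(2,4)] assms(5)] Suc by simp
  also have "\<dots> = (f \<cdot> a) \<cdot> mor_pow C X a l"
    using cmp_assoc[OF assms(1,1,2,2,4,5) mor_pow_in[OF assms(1,3)]] assms(6) by simp
  also have "\<dots> = f \<cdot> mor_pow C X a (Suc l)"
    using cmp_assoc[OF assms(1,1,1,2,5,3) mor_pow_in[OF assms(1,3)]] by simp
  finally show ?case .
qed

end


section \<open>Power series over a dg category\<close>

lemma ps_cat_simps [simp]:
  "Obj (ps_cat C) = Obj C"
  "f \<in> Hom (ps_cat C) X Y l \<longleftrightarrow> (\<forall>i. f i \<in> Hom C X Y (l - 2 * int i))"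
  "smul (ps_cat C) a f = (\<lambda>i. smul C a (f i))"
  "ident (ps_cat C) X = ps_const (ident C X)"
  "(g \<cdot>\<^bsub>ps_cat C\<^esub> f) i = (\<Sum>j\<le>i. g j \<cdot>\<^bsub>C\<^esub> f (i - j))"
  "dif (ps_cat C) X Y l f i = dif C X Y (l - 2 * int i) (f i)"
  by (simp_all add: ps_cat_def ps_const_def)

context dg_category
begin

lemma ps_const_in:
  "\<lbrakk>X \<in> Obj C; Y \<in> Obj C; a \<in> Hom C X Y n\<rbrakk> \<Longrightarrow> ps_const a \<in> Hom (ps_cat C) X Y n"
  by (simp add: ps_const_def hom_zero)

lemma eps_mult_in:
  assumes "X \<in> Obj C" "Y \<in> Obj C" "f \<in> Hom (ps_cat C) X Y n"
  shows "eps_mult f \<in> Hom (ps_cat C) X Y (n + 2)"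
proof -
  have "f j \<in> Hom C X Y (n + 2 - 2 * int (Suc j))" for j
    using assms(3) by (simp add: algebra_simps)
  then show ?thesis
    using assms by (simp add: eps_mult_def hom_zero split: nat.split)
qed

lemma ps_const_cmp:
  assumes "X \<in> Obj C" "Y \<in> Obj C" "Z \<in> Obj C" "b \<in> Hom C Y Z m" "f \<in> Hom (ps_cat C) X Y n"
  shows "(ps_const b \<cdot>\<^bsub>ps_cat C\<^esub> f) i = b \<cdot> f i"
proof -
  have f: "f j \<in> Hom C X Y (n - 2 * int j)" for j
    using assms(5) by simp
  have "(\<Sum>j\<le>i. ps_const b j \<cdot> f (i - j)) = (\<Sum>j\<in>{0}. ps_const b j \<cdot> f (i - j))"
    using cmp_zero_left[OF assms(1-3) f] by (intro sum.mono_neutral_right) (auto simp: ps_const_def)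
  then show ?thesis by (simp add: ps_const_def)
qed

lemma cmp_ps_const:
  assumes "X \<in> Obj C" "Y \<in> Obj C" "Z \<in> Obj C" "g \<in> Hom (ps_cat C) Y Z m" "a \<in> Hom C X Y n"
  shows "(g \<cdot>\<^bsub>ps_cat C\<^esub> ps_const a) i = g i \<cdot> a"
proof -
  have g: "g j \<in> Hom C Y Z (m - 2 * int j)" for j
    using assms(4) by simp
  have "(\<Sum>j\<le>i. g j \<cdot> ps_const a (i - j)) = (\<Sum>j\<in>{i}. g j \<cdot> ps_const a (i - j))"
    using cmp_zero_right[OF assms(1-3) g] by (intro sum.mono_neutral_right) (auto simp: ps_const_def)
  then show ?thesis by (simp add: ps_const_def)
qed

text \<open>Since \<epsilon> is central, closed and of even degree, each axiom reduces to the same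
  axiom of \<open>C\<close> on coefficients; only the convolution sums need care. All general facts
  on dg categories thereby apply to series.\<close>

lemma dg_category_ps_cat: "dg_category (ps_cat C)"
proof
  fix X Y :: 'o and n
  assume "X \<in> Obj (ps_cat C)" "Y \<in> Obj (ps_cat C)"
  then have XY: "X \<in> Obj C" "Y \<in> Obj C" by auto
  show "submodule (smul (ps_cat C)) (Hom (ps_cat C) X Y n)"
    using hom_submodule[OF XY] unfolding submodule_def by auto
  fix f g a b
  assume "f \<in> Hom (ps_cat C) X Y n"
  then have f: "f i \<in> Hom C X Y (n - 2 * int i)" for i by auto
  show "smul (ps_cat C) (a + b) f = smul (ps_cat C) a f + smul (ps_cat C) b f"
    by (rule ext) (simp add: smul_add_left[OF XY f])
  show "smul (ps_cat C) (a * b) f = smul (ps_cat C) a (smul (ps_cat C) b f)"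
    by (rule ext) (simp add: smul_mult[OF XY f])
  show "smul (ps_cat C) 1 f = f"
    by (rule ext) (simp add: smul_one[OF XY f])
  show "ident (ps_cat C) Y \<cdot>\<^bsub>ps_cat C\<^esub> f = f"
    by (rule ext, unfold ps_cat_simps(4), subst ps_const_cmp[OF XY XY(2) ident_in])
      (use XY f ident_left[OF XY f] in auto)
  show "f \<cdot>\<^bsub>ps_cat C\<^esub> ident (ps_cat C) X = f"
    by (rule ext, unfold ps_cat_simps(4), subst cmp_ps_const[OF XY(1,1,2) _ ident_in])
      (use XY f ident_right[OF XY f] in auto)
  show "dif (ps_cat C) X Y n f \<in> Hom (ps_cat C) X Y (n + 1)"
    using dif_in[OF XY f] by (auto simp: algebra_simps)
  show "dif (ps_cat C) X Y n (smul (ps_cat C) a f) = smul (ps_cat C) a (dif (ps_cat C) X Y n f)"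
    by (rule ext) (simp add: dif_smul[OF XY f])
  show "dif (ps_cat C) X Y (n + 1) (dif (ps_cat C) X Y n f) = 0"
    using dif_dif[OF XY f] by (intro ext) (simp add: algebra_simps)
  assume "g \<in> Hom (ps_cat C) X Y n"
  then have g: "g i \<in> Hom C X Y (n - 2 * int i)" for i by auto
  show "smul (ps_cat C) a (f + g) = smul (ps_cat C) a f + smul (ps_cat C) a g"
    by (rule ext) (simp add: smul_add_right[OF XY f g])
  show "dif (ps_cat C) X Y n (f + g) = dif (ps_cat C) X Y n f + dif (ps_cat C) X Y n g"
    by (rule ext) (simp add: dif_add[OF XY f g])
next
  fix X
  assume "X \<in> Obj (ps_cat C)"
  then show "ident (ps_cat C) X \<in> Hom (ps_cat C) X X 0"
    using ps_const_in[OF _ _ ident_in, of X] by auto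
next
  fix X Y Z :: 'o and g m f n
  assume "X \<in> Obj (ps_cat C)" "Y \<in> Obj (ps_cat C)" "Z \<in> Obj (ps_cat C)"
    and g_in: "g \<in> Hom (ps_cat C) Y Z m" and f_in: "f \<in> Hom (ps_cat C) X Y n"
  then have XYZ: "X \<in> Obj C" "Y \<in> Obj C" "Z \<in> Obj C"
    and g: "g i \<in> Hom C Y Z (m - 2 * int i)" and f: "f i \<in> Hom C X Y (n - 2 * int i)" for i
    by auto
  have deg: "m - 2 * int j + (n - 2 * int (i - j)) = m + n - 2 * int i" if "j \<le> i" for i j
    using that by (simp add: of_nat_diff)
  have gf: "g j \<cdot> f (i - j) \<in> Hom C X Z (m + n - 2 * int i)" if "j \<le> i" for i j
    using cmp_in[OF XYZ g[of j] f[of "i - j"]] unfolding deg[OF that] .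
  show "g \<cdot>\<^bsub>ps_cat C\<^esub> f \<in> Hom (ps_cat C) X Z (m + n)"
    using gf XYZ by (auto intro!: hom_sum)
  fix a
  show "smul (ps_cat C) a g \<cdot>\<^bsub>ps_cat C\<^esub> f = smul (ps_cat C) a (g \<cdot>\<^bsub>ps_cat C\<^esub> f)"
  proof
    fix i
    \<comment> \<open>Scalars distribute over binary sums inside one hom set; this extends the law
      to the convolution sum.\<close>
    have "smul C a (sum F A) = (\<Sum>j\<in>A. smul C a (F j))"
      if "finite A" "\<And>j. j \<in> A \<Longrightarrow> F j \<in> Hom C X Z (m + n - 2 * int i)" for A :: "nat set" and F
      using that
    proof (induction A)
      case empty
      then show ?case
        using smul_add_right[OF XYZ(1,3) hom_zero[OF XYZ(1,3)] hom_zero[OF XYZ(1,3)]] by simp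
    next
      case (insert j A)
      then show ?case
        using smul_add_right[OF XYZ(1,3), of "F j" "m + n - 2 * int i" "sum F A"]
            hom_sum[OF XYZ(1,3), of A F] by simp
    qed
    from this[of "{..i}" "\<lambda>j. g j \<cdot> f (i - j)"] gf
    show "(smul (ps_cat C) a g \<cdot>\<^bsub>ps_cat C\<^esub> f) i = smul (ps_cat C) a (g \<cdot>\<^bsub>ps_cat C\<^esub> f) i"
      by (simp add: cmp_smul_left[OF XYZ g f])
  qed
  then have "(\<Sum>j\<le>i. smul C a (g j) \<cdot> f (i - j)) = smul C a (\<Sum>j\<le>i. g j \<cdot> f (i - j))" for i
    by (auto dest!: fun_cong[where x = i])
  then show "g \<cdot>\<^bsub>ps_cat C\<^esub> smul (ps_cat C) a f = smul (ps_cat C) a (g \<cdot>\<^bsub>ps_cat C\<^esub> f)"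
    by (intro ext) (simp add: cmp_smul_left[OF XYZ g f] cmp_smul_right[OF XYZ g f])
  show "dif (ps_cat C) X Z (m + n) (g \<cdot>\<^bsub>ps_cat C\<^esub> f) =
      dif (ps_cat C) Y Z m g \<cdot>\<^bsub>ps_cat C\<^esub> f + ksign m (g \<cdot>\<^bsub>ps_cat C\<^esub> dif (ps_cat C) X Y n f)"
  proof
    fix i
    \<comment> \<open>The coefficient \<open>g j\<close> has degree m - 2j, of the same parity as m,
      so one sign serves all summands.\<close>
    have "dif C X Z (m + n - 2 * int i) (g j \<cdot> f (i - j)) =
        dif C Y Z (m - 2 * int j) (g j) \<cdot> f (i - j)
        + ksign m (g j \<cdot> dif C X Y (n - 2 * int (i - j)) (f (i - j)))" if "j \<le> i" for j
      using leibniz[OF XYZ g f, of j "i - j"] ksign_cong[of "m - 2 * int j" m]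
      unfolding deg[OF that] by simp
    then show "dif (ps_cat C) X Z (m + n) (g \<cdot>\<^bsub>ps_cat C\<^esub> f) i =
        (dif (ps_cat C) Y Z m g \<cdot>\<^bsub>ps_cat C\<^esub> f
          + ksign m (g \<cdot>\<^bsub>ps_cat C\<^esub> dif (ps_cat C) X Y n f)) i"
      using dif_sum[OF XYZ(1,3), of "{..i}" "\<lambda>j. g j \<cdot> f (i - j)"] gf
      by (simp add: ksign_apply ksign_sum sum.distrib)
  qed
next
  fix X Y Z :: 'o and g g' m f n
  assume "X \<in> Obj (ps_cat C)" "Y \<in> Obj (ps_cat C)" "Z \<in> Obj (ps_cat C)"
    "g \<in> Hom (ps_cat C) Y Z m" "g' \<in> Hom (ps_cat C) Y Z m" "f \<in> Hom (ps_cat C) X Y n"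
  then have XYZ: "X \<in> Obj C" "Y \<in> Obj C" "Z \<in> Obj C" and g: "g i \<in> Hom C Y Z (m - 2 * int i)"
    and g': "g' i \<in> Hom C Y Z (m - 2 * int i)" and f: "f i \<in> Hom C X Y (n - 2 * int i)" for i
    by auto
  show "(g + g') \<cdot>\<^bsub>ps_cat C\<^esub> f = g \<cdot>\<^bsub>ps_cat C\<^esub> f + g' \<cdot>\<^bsub>ps_cat C\<^esub> f"
    by (rule ext) (simp add: cmp_add_left[OF XYZ g g' f] sum.distrib)
next
  fix X Y Z :: 'o and g m f f' n
  assume "X \<in> Obj (ps_cat C)" "Y \<in> Obj (ps_cat C)" "Z \<in> Obj (ps_cat C)"
    "g \<in> Hom (ps_cat C) Y Z m" "f \<in> Hom (ps_cat C) X Y n" "f' \<in> Hom (ps_cat C) X Y n"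
  then have XYZ: "X \<in> Obj C" "Y \<in> Obj C" "Z \<in> Obj C" and g: "g i \<in> Hom C Y Z (m - 2 * int i)"
    and f: "f i \<in> Hom C X Y (n - 2 * int i)" and f': "f' i \<in> Hom C X Y (n - 2 * int i)" for i
    by auto
  show "g \<cdot>\<^bsub>ps_cat C\<^esub> (f + f') = g \<cdot>\<^bsub>ps_cat C\<^esub> f + g \<cdot>\<^bsub>ps_cat C\<^esub> f'"
    by (rule ext) (simp add: cmp_add_right[OF XYZ g f f'] sum.distrib)
next
  fix W X Y Z :: 'o and h l g m f n
  assume "W \<in> Obj (ps_cat C)" "X \<in> Obj (ps_cat C)" "Y \<in> Obj (ps_cat C)" "Z \<in> Obj (ps_cat C)"
    "h \<in> Hom (ps_cat C) Y Z l" "g \<in> Hom (ps_cat C) X Y m" "f \<in> Hom (ps_cat C) W X n"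
  then have WXYZ: "W \<in> Obj C" "X \<in> Obj C" "Y \<in> Obj C" "Z \<in> Obj C"
    and h: "h i \<in> Hom C Y Z (l - 2 * int i)" and g: "g i \<in> Hom C X Y (m - 2 * int i)"
    and f: "f i \<in> Hom C W X (n - 2 * int i)" for i
    by auto
  have hg: "h j \<cdot> g (k - j) \<in> Hom C X Z (l + m - 2 * int k)" if "j \<le> k" for j k
    using cmp_in[OF WXYZ(2-4) h[of j] g[of "k - j"]] that by (simp add: of_nat_diff algebra_simps)
  have gf: "g j \<cdot> f (k - j) \<in> Hom C W Y (m + n - 2 * int k)" if "j \<le> k" for j k
    using cmp_in[OF WXYZ(1-3) g[of j] f[of "k - j"]] that by (simp add: of_nat_diff algebra_simps)
  show "(h \<cdot>\<^bsub>ps_cat C\<^esub> g) \<cdot>\<^bsub>ps_cat C\<^esub> f = h \<cdot>\<^bsub>ps_cat C\<^esub> (g \<cdot>\<^bsub>ps_cat C\<^esub> f)"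
  proof
    fix i
    have "((h \<cdot>\<^bsub>ps_cat C\<^esub> g) \<cdot>\<^bsub>ps_cat C\<^esub> f) i = (\<Sum>k\<le>i. \<Sum>j\<le>k. h j \<cdot> g (k - j) \<cdot> f (i - k))"
    proof -
      have "(\<Sum>j\<le>k. h j \<cdot> g (k - j)) \<cdot> f (i - k) = (\<Sum>j\<le>k. (h j \<cdot> g (k - j)) \<cdot> f (i - k))" for k
        by (rule cmp_sum_left[OF WXYZ(1,2,4) hg f]) simp
      then show ?thesis by (simp add: cmp_assoc[OF WXYZ h g f])
    qed
    \<comment> \<open>This reindexing of triple products is the one behind associativity of formal
      power series; it holds for any function of three indices with values in a commutative
      monoid.\<close>
    also have "\<dots> = (\<Sum>j\<le>i. \<Sum>k\<le>i - j. h j \<cdot> g k \<cdot> f (i - j - k))"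
      using fps_mult_assoc_lemma[where k = i and f = "\<lambda>j k l. h j \<cdot> g k \<cdot> f l"]
      by (simp add: atLeast0AtMost)
    also have "\<dots> = (h \<cdot>\<^bsub>ps_cat C\<^esub> (g \<cdot>\<^bsub>ps_cat C\<^esub> f)) i"
    proof -
      have "h j \<cdot> (\<Sum>k\<le>i - j. g k \<cdot> f (i - j - k)) = (\<Sum>k\<le>i - j. h j \<cdot> g k \<cdot> f (i - j - k))" for j
        by (rule cmp_sum_right[OF WXYZ(1,3,4) h gf]) simp
      then show ?thesis by simp
    qed
    finally show "((h \<cdot>\<^bsub>ps_cat C\<^esub> g) \<cdot>\<^bsub>ps_cat C\<^esub> f) i = (h \<cdot>\<^bsub>ps_cat C\<^esub> (g \<cdot>\<^bsub>ps_cat C\<^esub> f)) i" .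
  qed
qed

end


section \<open>Complete filtrations\<close>

lemma sum_lessThan_add:
  fixes p :: "nat \<Rightarrow> 'a::comm_monoid_add"
  shows "(\<Sum>l<i + d. p l) = (\<Sum>l<i. p l) + (\<Sum>l<d. p (l + i))"
  by (induction d) (simp_all add: add_ac)

text \<open>The differential may lower the filtration by one step, because an ideal of a dg category need
  not be stable under the differential.\<close>

locale filtered_dg_category = dg_category C
  for C :: "('o, 'm::ab_group_add, 'k::{comm_ring, comm_monoid_mult}) dgcat" (structure) +
  fixes N :: "nat \<Rightarrow> 'o \<Rightarrow> 'o \<Rightarrow> int \<Rightarrow> 'm set"
  assumes filt_0: "\<lbrakk>X \<in> Obj C; Y \<in> Obj C\<rbrakk> \<Longrightarrow> N 0 X Y n = Hom C X Y n"
    and filt_zero: "\<lbrakk>X \<in> Obj C; Y \<in> Obj C\<rbrakk> \<Longrightarrow> 0 \<in> N k X Y n"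
    and filt_add: "\<lbrakk>X \<in> Obj C; Y \<in> Obj C; f \<in> N k X Y n; g \<in> N k X Y n\<rbrakk> \<Longrightarrow> f + g \<in> N k X Y n"
    and filt_uminus: "\<lbrakk>X \<in> Obj C; Y \<in> Obj C; f \<in> N k X Y n\<rbrakk> \<Longrightarrow> - f \<in> N k X Y n"
    and filt_Suc: "\<lbrakk>X \<in> Obj C; Y \<in> Obj C; f \<in> N (Suc k) X Y n\<rbrakk> \<Longrightarrow> f \<in> N k X Y n"
    and filt_cmp:
      "\<lbrakk>X \<in> Obj C; Y \<in> Obj C; Z \<in> Obj C; g \<in> N k Y Z m; f \<in> N l X Y n\<rbrakk>
        \<Longrightarrow> g \<cdot> f \<in> N (k + l) X Z (m + n)"
    and filt_dif:
      "\<lbrakk>X \<in> Obj C; Y \<in> Obj C; f \<in> N (Suc k) X Y n\<rbrakk> \<Longrightarrow> dif C X Y n f \<in> N k X Y (n + 1)"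
    and filt_separated: "\<lbrakk>X \<in> Obj C; Y \<in> Obj C; \<And>k. f \<in> N k X Y n\<rbrakk> \<Longrightarrow> f = 0"
    and filt_complete:
      "\<lbrakk>X \<in> Obj C; Y \<in> Obj C; \<And>l. p l \<in> N l X Y n\<rbrakk>
        \<Longrightarrow> \<exists>s\<in>Hom C X Y n. \<forall>k. s - (\<Sum>l<k. p l) \<in> N k X Y n"
begin

section \<open>Limits in a filtered dg category\<close>

lemma filt_mono:
  assumes "X \<in> Obj C" "Y \<in> Obj C" "k \<le> l" "f \<in> N l X Y n"
  shows "f \<in> N k X Y n"
  using assms(3,4) by (induction l rule: dec_induct) (auto dest: filt_Suc[OF assms(1,2)])

lemma filt_hom: "\<lbrakk>X \<in> Obj C; Y \<in> Obj C; f \<in> N k X Y n\<rbrakk> \<Longrightarrow> f \<in> Hom C X Y n"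
  using filt_mono[of X Y 0 k f n] filt_0 by simp

lemma filt_diff:
  "\<lbrakk>X \<in> Obj C; Y \<in> Obj C; f \<in> N k X Y n; g \<in> N k X Y n\<rbrakk> \<Longrightarrow> f - g \<in> N k X Y n"
  using filt_add[of X Y f k n "- g"] filt_uminus[of X Y g k n] by simp

lemma filt_sum:
  "\<lbrakk>X \<in> Obj C; Y \<in> Obj C; \<And>i. i \<in> A \<Longrightarrow> f i \<in> N k X Y n\<rbrakk> \<Longrightarrow> sum f A \<in> N k X Y n"
  by (induction A rule: infinite_finite_induct) (auto simp: filt_zero filt_add)

lemma filt_eqI: "\<lbrakk>X \<in> Obj C; Y \<in> Obj C; \<And>k. f - g \<in> N k X Y n\<rbrakk> \<Longrightarrow> f = g"
  using filt_separated[of X Y "f - g" n] by simp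

lemma filt_trans:
  "\<lbrakk>X \<in> Obj C; Y \<in> Obj C; f - g \<in> N k X Y n; g - h \<in> N k X Y n\<rbrakk> \<Longrightarrow> f - h \<in> N k X Y n"
  using filt_add[of X Y "f - g" k n "g - h"] by simp

lemma filt_cmp_hom_left:
  "\<lbrakk>X \<in> Obj C; Y \<in> Obj C; Z \<in> Obj C; g \<in> Hom C Y Z m; f \<in> N l X Y n\<rbrakk>
    \<Longrightarrow> g \<cdot> f \<in> N l X Z (m + n)"
  using filt_cmp[of X Y Z g 0 m f l n] filt_0 by simp

lemma filt_cmp_hom_right:
  "\<lbrakk>X \<in> Obj C; Y \<in> Obj C; Z \<in> Obj C; g \<in> N l Y Z m; f \<in> Hom C X Y n\<rbrakk>
    \<Longrightarrow> g \<cdot> f \<in> N l X Z (m + n)"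
  using filt_cmp[of X Y Z g l m f 0 n] filt_0 by simp

text \<open>Continuity of composition, from g f - g' f' = (g - g') f + g' (f - f'). It allows limits
  to be composed.\<close>

lemma filt_cmp_cong:
  assumes "X \<in> Obj C" "Y \<in> Obj C" "Z \<in> Obj C"
    and "g \<in> Hom C Y Z m" "g' \<in> Hom C Y Z m" "f \<in> Hom C X Y n" "f' \<in> Hom C X Y n"
    and "g - g' \<in> N k Y Z m" "f - f' \<in> N k X Y n"
  shows "g \<cdot> f - g' \<cdot> f' \<in> N k X Z (m + n)"
proof (rule filt_trans[OF assms(1,3)])
  show "g \<cdot> f - g' \<cdot> f \<in> N k X Z (m + n)"
    using filt_cmp_hom_right[OF assms(1-3,8,6)] cmp_diff_left[OF assms(1-6)] by simp
  show "g' \<cdot> f - g' \<cdot> f' \<in> N k X Z (m + n)"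
    using filt_cmp_hom_left[OF assms(1-3,5,9)] cmp_diff_right[OF assms(1-3,5-7)] by simp
qed

lemma filt_mor_pow:
  assumes "X \<in> Obj C" "a \<in> N 1 X X n"
  shows "mor_pow C X a l \<in> N l X X (int l * n)"
proof (induction l)
  case (Suc l)
  then show ?case
    using filt_cmp[OF assms(1,1,1,2) Suc] by (simp add: algebra_simps)
qed (use assms filt_0 ident_in in simp)

text \<open>The inverse of \<open>id + x\<close> is the geometric series of \<open>- x\<close>.\<close>

lemma ex1_inverse:
  assumes X: "X \<in> Obj C" and x: "x \<in> N 1 X X 0"
  shows "\<exists>!u. is_inverse C X (ident C X + x) u"
proof -
  define y where "y = - x"
  define u where "u = ident C X + x"
  define p where "p = mor_pow C X y"
  note i = ident_in[OF X] and XX = X X and XXX = X X X and XXXX = X X X X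
  have y: "y \<in> N 1 X X 0" "y \<in> Hom C X X 0"
    using filt_uminus[OF XX x] filt_hom[OF XX] by (auto simp: y_def)
  have u: "u \<in> Hom C X X 0"
    using hom_add[OF XX i filt_hom[OF XX x]] by (simp add: u_def)
  have p: "p l \<in> N l X X 0" "p l \<in> Hom C X X 0" for l
    using filt_mor_pow[OF X y(1)] filt_hom[OF XX] by (auto simp: p_def)
  have u_eq: "u = ident C X - y"
    by (simp add: u_def y_def)
  have yp: "y \<cdot> p l = p (Suc l)" "p l \<cdot> y = p (Suc l)" for l
    using mor_pow_commute[OF XX y(2,2,2) refl, of l] by (simp_all add: p_def)
  have up: "u \<cdot> p l = p l - p (Suc l)" "p l \<cdot> u = p l - p (Suc l)" for l
    using cmp_diff_left[OF XXX i y(2) p(2)[of l]] cmp_diff_right[OF XXX p(2)[of l] i y(2)]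
      ident_left[OF XX p(2)] ident_right[OF XX p(2)] yp by (simp_all add: u_eq)
  obtain s where s: "s \<in> Hom C X X 0" "\<And>k. s - (\<Sum>l<k. p l) \<in> N k X X 0"
    using filt_complete[OF XX p(1)] by blast
  have sum_p: "(\<Sum>l<k. p l) \<in> Hom C X X 0" for k
    using hom_sum[OF XX p(2)] .
  have tele: "(\<Sum>l<k. p l - p (Suc l)) = ident C X - p k" for k
    by (induction k) (simp_all add: p_def)
  have us: "u \<cdot> s - ident C X \<in> N k X X 0" and su: "s \<cdot> u - ident C X \<in> N k X X 0" for k
  proof -
    have z: "u - u \<in> N k X X 0" using filt_zero[OF XX] by simp
    \<comment> \<open>The telescoped product is id - y^k, and y^k is itself small of order
      k.\<close>
    have pk: "ident C X - p k - ident C X \<in> N k X X 0"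
      using filt_uminus[OF XX p(1)[of k]] by simp
    have "u \<cdot> s - u \<cdot> (\<Sum>l<k. p l) \<in> N k X X 0"
      using filt_cmp_cong[OF XXX u u s(1) sum_p z s(2)] by simp
    then have "u \<cdot> s - (ident C X - p k) \<in> N k X X 0"
      using cmp_sum_right[OF XXX u, of "{..<k}" p 0] p(2) by (simp add: up tele)
    then show "u \<cdot> s - ident C X \<in> N k X X 0"
      using filt_trans[OF XX _ pk] by blast
    have "s \<cdot> u - (\<Sum>l<k. p l) \<cdot> u \<in> N k X X 0"
      using filt_cmp_cong[OF XXX s(1) sum_p u u s(2) z] by simp
    then have "s \<cdot> u - (ident C X - p k) \<in> N k X X 0"
      using cmp_sum_left[OF XXX _ u, of "{..<k}" p 0] p(2) by (simp add: up tele)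
    then show "s \<cdot> u - ident C X \<in> N k X X 0"
      using filt_trans[OF XX _ pk] by blast
  qed
  have inv: "is_inverse C X u s"
    using filt_eqI[OF XX us] filt_eqI[OF XX su] s(1) by (simp add: is_inverse_def)
  moreover have "v = s" if v: "is_inverse C X u v" for v
  proof -
    have v': "v \<in> Hom C X X 0" "v \<cdot> u = ident C X" using v by (auto simp: is_inverse_def)
    then have "v = v \<cdot> u \<cdot> s"
      using inv ident_right[OF XX v'(1)] by (simp add: is_inverse_def)
    also have "\<dots> = s"
      using cmp_assoc[OF XXXX v'(1) u s(1)] v'(2) ident_left[OF XX s(1)] by simp
    finally show ?thesis .
  qed
  ultimately show ?thesis unfolding u_def by blast
qed

lemma mor_inv_props:
  assumes X: "X \<in> Obj C" and x: "x \<in> N 1 X X 0"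
  shows "mor_inv C X (ident C X + x) \<in> Hom C X X 0"
    "(ident C X + x) \<cdot> mor_inv C X (ident C X + x) = ident C X"
    "mor_inv C X (ident C X + x) \<cdot> (ident C X + x) = ident C X"
proof -
  have "is_inverse C X (ident C X + x) (mor_inv C X (ident C X + x))"
    unfolding mor_inv_def by (rule theI'[OF ex1_inverse[OF assms]])
  then show "mor_inv C X (ident C X + x) \<in> Hom C X X 0"
    "(ident C X + x) \<cdot> mor_inv C X (ident C X + x) = ident C X"
    "mor_inv C X (ident C X + x) \<cdot> (ident C X + x) = ident C X"
    by (auto simp: is_inverse_def)
qed

end


section \<open>The powers of an ideal\<close>

locale dg_ideal = dg_category C
  for C :: "('o, 'm::ab_group_add, 'k::{comm_ring, comm_monoid_mult}) dgcat" (structure) +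
  fixes \<nn> :: "'o \<Rightarrow> 'o \<Rightarrow> int \<Rightarrow> 'm set"
  assumes ideal: "two_sided_ideal C \<nn>"
begin

lemma ideal_hom: "\<lbrakk>X \<in> Obj C; Y \<in> Obj C; f \<in> \<nn> X Y n\<rbrakk> \<Longrightarrow> f \<in> Hom C X Y n"
  using ideal[unfolded two_sided_ideal_def, THEN conjunct1] by blast

lemma ideal_cmp_left:
  "\<lbrakk>X \<in> Obj C; Y \<in> Obj C; Z \<in> Obj C; g \<in> Hom C Y Z m; f \<in> \<nn> X Y n\<rbrakk> \<Longrightarrow> g \<cdot> f \<in> \<nn> X Z (m + n)"
  using ideal unfolding two_sided_ideal_def by blast

lemma ideal_cmp_right:
  "\<lbrakk>X \<in> Obj C; Y \<in> Obj C; Z \<in> Obj C; g \<in> \<nn> Y Z m; f \<in> Hom C X Y n\<rbrakk> \<Longrightarrow> g \<cdot> f \<in> \<nn> X Z (m + n)"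
  using ideal unfolding two_sided_ideal_def by blast

lemma ideal_uminus:
  assumes "X \<in> Obj C" "Y \<in> Obj C" "f \<in> \<nn> X Y n"
  shows "- f \<in> \<nn> X Y n"
proof -
  have "submodule (smul C) (\<nn> X Y n)"
    using ideal assms unfolding two_sided_ideal_def by blast
  then have "smul C (- 1) f \<in> \<nn> X Y n"
    using assms unfolding submodule_def by blast
  then show ?thesis
    using smul_minus_one[OF assms(1,2) ideal_hom[OF assms]] by simp
qed

lemma fold_comps_hom:
  "\<lbrakk>X \<in> Obj C; Y \<in> Obj C; f \<in> fold_comps C \<nn> k X Y n\<rbrakk> \<Longrightarrow> f \<in> Hom C X Y n"
proof (induction k arbitrary: Y f n)
  case (Suc k)
  show ?case
  proof (cases k)
    case 0
    then show ?thesis using Suc.prems ideal_hom by simp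
  next
    case (Suc k')
    then obtain g f' Z m where "f = g \<cdot> f'" "Z \<in> Obj C" "g \<in> \<nn> Z Y m"
      "f' \<in> fold_comps C \<nn> k X Z (n - m)"
      using Suc.prems by auto
    moreover from this have "g \<in> Hom C Z Y m" "f' \<in> Hom C X Z (n - m)"
      using Suc.IH[of Z f' "n - m"] Suc.prems ideal_hom[of Z Y g m] by simp_all
    ultimately show ?thesis
      using cmp_in[OF Suc.prems(1) _ Suc.prems(2), of Z g m f' "n - m"] by simp
  qed
qed simp

lemma fold_comps_step:
  assumes "X \<in> Obj C" "Y \<in> Obj C" "Z \<in> Obj C" "g \<in> \<nn> Y Z m" "f \<in> fold_comps C \<nn> k X Y n"
  shows "g \<cdot> f \<in> fold_comps C \<nn> (Suc k) X Z (m + n)"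
proof (cases k)
  case 0
  then show ?thesis using assms ideal_cmp_right by simp
next
  case (Suc k')
  then have "f \<in> fold_comps C \<nn> (Suc k') X Y (m + n - m)" using assms by simp
  then show ?thesis using assms unfolding Suc fold_comps.simps by blast
qed

text \<open>The powers are defined with separate cases at exponents 0 and 1. Factoring
  \<open>f\<close> as f o id at exponent 1 hides this, so that later arguments see a single
  recursive shape.\<close>

lemma fold_comps_SucE:
  assumes "X \<in> Obj C" "Y \<in> Obj C" "f \<in> fold_comps C \<nn> (Suc k) X Y n"
  obtains g f' Z m where "f = g \<cdot> f'" "Z \<in> Obj C" "g \<in> \<nn> Z Y m"
    "f' \<in> fold_comps C \<nn> k X Z (n - m)"
proof (cases k)
  case 0
  then have "f \<in> \<nn> X Y n" using assms by simp
  then show ?thesis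
    using that[of f "ident C X" X n] ident_right[OF assms(1,2) ideal_hom[OF assms(1,2)]]
      ident_in assms(1) 0 by simp
next
  case (Suc k')
  then show ?thesis using assms(3) that by auto
qed

lemma fold_comps_cmp_left:
  assumes "X \<in> Obj C" "Y \<in> Obj C" "Z \<in> Obj C" "g \<in> Hom C Y Z m" "f \<in> fold_comps C \<nn> l X Y n"
  shows "g \<cdot> f \<in> fold_comps C \<nn> l X Z (m + n)"
proof (cases l)
  case 0
  then show ?thesis using assms cmp_in by simp
next
  case (Suc l')
  then obtain f1 f2 W p where f: "f = f1 \<cdot> f2" "W \<in> Obj C" "f1 \<in> \<nn> W Y p"
    "f2 \<in> fold_comps C \<nn> l' X W (n - p)"
    using assms(5) by (auto elim: fold_comps_SucE[OF assms(1,2)])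
  have "g \<cdot> f = (g \<cdot> f1) \<cdot> f2"
    using cmp_assoc[OF assms(1) f(2) assms(2,3,4) ideal_hom fold_comps_hom] f assms by simp
  then show ?thesis
    using fold_comps_step[OF assms(1) f(2) assms(3) ideal_cmp_left[OF f(2) assms(2-4) f(3)] f(4)] f Suc
    by (simp add: algebra_simps)
qed

lemma fold_comps_cmp:
  "\<lbrakk>X \<in> Obj C; Y \<in> Obj C; Z \<in> Obj C; g \<in> fold_comps C \<nn> k Y Z m; f \<in> fold_comps C \<nn> l X Y n\<rbrakk>
    \<Longrightarrow> g \<cdot> f \<in> fold_comps C \<nn> (k + l) X Z (m + n)"
proof (induction k arbitrary: Z g m)
  case 0
  then show ?case using fold_comps_cmp_left by simp
next
  case (Suc k)
  obtain g1 g2 W p where g: "g = g1 \<cdot> g2" "W \<in> Obj C" "g1 \<in> \<nn> W Z p"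
    "g2 \<in> fold_comps C \<nn> k Y W (m - p)"
    using Suc.prems by (auto elim: fold_comps_SucE)
  have "g \<cdot> f = g1 \<cdot> g2 \<cdot> f"
    using cmp_assoc[OF Suc.prems(1,2) g(2) Suc.prems(3) ideal_hom fold_comps_hom fold_comps_hom]
      g Suc.prems by simp
  then show ?case
    using fold_comps_step[OF Suc.prems(1) g(2) Suc.prems(3) g(3) Suc.IH[OF Suc.prems(1,2) g(2,4)]] g
      Suc.prems by (simp add: algebra_simps)
qed

lemma fold_comps_Suc_subset:
  assumes "X \<in> Obj C" "Y \<in> Obj C" "f \<in> fold_comps C \<nn> (Suc k) X Y n"
  shows "f \<in> fold_comps C \<nn> k X Y n"
proof -
  obtain g f' Z m where f: "f = g \<cdot> f'" "Z \<in> Obj C" "g \<in> \<nn> Z Y m"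
    "f' \<in> fold_comps C \<nn> k X Z (n - m)"
    using assms by (rule fold_comps_SucE)
  then show ?thesis
    using fold_comps_cmp_left[OF assms(1) f(2) assms(2) ideal_hom[OF f(2) assms(2) f(3)] f(4)] by simp
qed

text \<open>Elements of \<open>ideal_pow\<close> are sums without coefficients, so closure under
  negation is not built in: for positive exponents the sign is absorbed by the first factor.\<close>

lemma fold_comps_uminus:
  assumes "X \<in> Obj C" "Y \<in> Obj C" "f \<in> fold_comps C \<nn> k X Y n"
  shows "- f \<in> fold_comps C \<nn> k X Y n"
proof (cases k)
  case 0
  then show ?thesis using assms hom_uminus by simp
next
  case (Suc k')
  then obtain g f' Z m where f: "f = g \<cdot> f'" "Z \<in> Obj C" "g \<in> \<nn> Z Y m"
    "f' \<in> fold_comps C \<nn> k' X Z (n - m)"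
    using assms by (auto elim: fold_comps_SucE)
  have "- f = (- g) \<cdot> f'"
    using cmp_uminus_left[OF assms(1) f(2) assms(2) ideal_hom fold_comps_hom] f assms by simp
  then show ?thesis
    using fold_comps_step[OF assms(1) f(2) assms(2) ideal_uminus[OF f(2) assms(2) f(3)] f(4)] f Suc
    by simp
qed

section \<open>Finite sums of k-fold compositions\<close>

lemma ideal_pow_zero: "0 \<in> ideal_pow C \<nn> k X Y n"
  unfolding ideal_pow_def by (auto intro!: exI[of _ "[]"])

lemma fold_comps_ideal_pow: "f \<in> fold_comps C \<nn> k X Y n \<Longrightarrow> f \<in> ideal_pow C \<nn> k X Y n"
  unfolding ideal_pow_def by (auto intro!: exI[of _ "[f]"])

lemma ideal_pow_add:
  assumes "f \<in> ideal_pow C \<nn> k X Y n" "g \<in> ideal_pow C \<nn> k X Y n"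
  shows "f + g \<in> ideal_pow C \<nn> k X Y n"
proof -
  obtain xs ys where "f = sum_list xs" "g = sum_list ys"
    "set xs \<subseteq> fold_comps C \<nn> k X Y n" "set ys \<subseteq> fold_comps C \<nn> k X Y n"
    using assms by (auto simp: ideal_pow_def)
  then show ?thesis
    unfolding ideal_pow_def by (auto intro!: exI[of _ "xs @ ys"])
qed

lemma ideal_pow_induct [consumes 1, case_names zero add]:
  assumes "f \<in> ideal_pow C \<nn> k X Y n" and "P 0"
    and "\<And>f g. \<lbrakk>f \<in> fold_comps C \<nn> k X Y n; g \<in> ideal_pow C \<nn> k X Y n; P g\<rbrakk> \<Longrightarrow> P (f + g)"
  shows "P f"
proof -
  obtain xs where "f = sum_list xs" "set xs \<subseteq> fold_comps C \<nn> k X Y n"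
    using assms(1) by (auto simp: ideal_pow_def)
  moreover have "P (sum_list xs)" if "set xs \<subseteq> fold_comps C \<nn> k X Y n" for xs
    using that
  proof (induction xs)
    case (Cons x xs)
    then have "sum_list xs \<in> ideal_pow C \<nn> k X Y n" by (auto simp: ideal_pow_def)
    then show ?case using assms(3)[of x "sum_list xs"] Cons by simp
  qed (use assms(2) in simp)
  ultimately show ?thesis by simp
qed

lemma ideal_pow_hom:
  assumes "X \<in> Obj C" "Y \<in> Obj C" "f \<in> ideal_pow C \<nn> k X Y n"
  shows "f \<in> Hom C X Y n"
  using assms(3)
  by (induction rule: ideal_pow_induct) (use assms in \<open>auto intro: fold_comps_hom hom_zero hom_add\<close>)

lemma ideal_pow_uminus:
  assumes "X \<in> Obj C" "Y \<in> Obj C" "f \<in> ideal_pow C \<nn> k X Y n"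
  shows "- f \<in> ideal_pow C \<nn> k X Y n"
  using assms(3)
proof (induction rule: ideal_pow_induct)
  case (add f g)
  then show ?case
    using ideal_pow_add[OF fold_comps_ideal_pow[OF fold_comps_uminus[OF assms(1,2)]], of f k n "- g"]
    by simp
qed (use ideal_pow_zero in simp)

lemma ideal_pow_cmp:
  assumes "X \<in> Obj C" "Y \<in> Obj C" "Z \<in> Obj C"
    and "g \<in> ideal_pow C \<nn> k Y Z m" "f \<in> ideal_pow C \<nn> l X Y n"
  shows "g \<cdot> f \<in> ideal_pow C \<nn> (k + l) X Z (m + n)"
  using assms(4)
proof (induction rule: ideal_pow_induct)
  case zero
  then show ?case
    using cmp_zero_left[OF assms(1-3) ideal_pow_hom[OF assms(1,2,5)]] ideal_pow_zero by simp
next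
  case (add g g')
  have "g \<cdot> f \<in> ideal_pow C \<nn> (k + l) X Z (m + n)"
    using assms(5)
  proof (induction rule: ideal_pow_induct)
    case zero
    then show ?case
      using cmp_zero_right[OF assms(1-3) fold_comps_hom[OF assms(2,3) add(1)]] ideal_pow_zero by simp
  next
    case (add f f')
    then show ?case
      using cmp_add_right[OF assms(1-3) fold_comps_hom[OF assms(2,3) \<open>g \<in> _\<close>]
          fold_comps_hom[OF assms(1,2) add(1)] ideal_pow_hom[OF assms(1,2) add(2)]]
        ideal_pow_add[OF fold_comps_ideal_pow[OF fold_comps_cmp[OF assms(1-3) \<open>g \<in> _\<close> add(1)]]]
      by simp
  qed
  then show ?case
    using cmp_add_left[OF assms(1-3) fold_comps_hom[OF assms(2,3) add(1)]
        ideal_pow_hom[OF assms(2,3) add(2)] ideal_pow_hom[OF assms(1,2,5)]]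
      ideal_pow_add add by simp
qed

lemma ideal_pow_Suc_subset:
  assumes "X \<in> Obj C" "Y \<in> Obj C" "f \<in> ideal_pow C \<nn> (Suc k) X Y n"
  shows "f \<in> ideal_pow C \<nn> k X Y n"
  using assms(3)
  by (induction rule: ideal_pow_induct)
    (use assms in \<open>auto intro: ideal_pow_zero ideal_pow_add fold_comps_ideal_pow
      fold_comps_Suc_subset\<close>)

lemma ideal_pow_0: "\<lbrakk>X \<in> Obj C; Y \<in> Obj C\<rbrakk> \<Longrightarrow> ideal_pow C \<nn> 0 X Y n = Hom C X Y n"
  by (auto intro: ideal_pow_hom fold_comps_ideal_pow)

lemma ideal_pow_ksign:
  "\<lbrakk>X \<in> Obj C; Y \<in> Obj C; f \<in> ideal_pow C \<nn> k X Y n\<rbrakk> \<Longrightarrow> ksign m f \<in> ideal_pow C \<nn> k X Y n"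
  by (simp add: ksign_def ideal_pow_uminus)

text \<open>The Leibniz rule differentiates one factor at a time. The differentiated factor may
  leave the ideal, but the other \<open>k\<close> factors still lie in it.\<close>

lemma dif_fold_comps:
  "\<lbrakk>X \<in> Obj C; Y \<in> Obj C; f \<in> fold_comps C \<nn> (Suc k) X Y n\<rbrakk>
    \<Longrightarrow> dif C X Y n f \<in> ideal_pow C \<nn> k X Y (n + 1)"
proof (induction k arbitrary: Y f n)
  case 0
  then show ?case using dif_in ideal_hom by (simp add: ideal_pow_0)
next
  case (Suc k)
  obtain g f' Z m where f: "f = g \<cdot> f'" "Z \<in> Obj C" "g \<in> \<nn> Z Y m"
    "f' \<in> fold_comps C \<nn> (Suc k) X Z (n - m)"
    using fold_comps_SucE[OF Suc.prems] by metis
  note XZY = Suc.prems(1) f(2) Suc.prems(2)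
  have g: "g \<in> Hom C Z Y m" using ideal_hom f XZY by simp
  have f': "f' \<in> Hom C X Z (n - m)" using fold_comps_hom f XZY by simp
  \<comment> \<open>The differential of \<open>g\<close> is an arbitrary morphism, absorbed by the
    remaining \<open>Suc k\<close> factors.\<close>
  have "dif C Z Y m g \<cdot> f' \<in> fold_comps C \<nn> (Suc k) X Y (n + 1)"
    using fold_comps_cmp_left[OF XZY dif_in[OF XZY(2,3) g] f(4)] by (simp add: algebra_simps)
  \<comment> \<open>Differentiating \<open>f'\<close> costs it one factor, which \<open>g\<close> in
    the ideal makes up for.\<close>
  moreover have "g \<cdot> dif C X Z (n - m) f' \<in> ideal_pow C \<nn> (Suc k) X Y (n + 1)"
    using ideal_pow_cmp[OF XZY, of g 1 m, OF _ Suc.IH[OF XZY(1,2) f(4)]] f(3)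
      fold_comps_ideal_pow[of g 1 Z Y m] by (simp add: algebra_simps)
  moreover have "dif C X Y n f = dif C Z Y m g \<cdot> f' + ksign m (g \<cdot> dif C X Z (n - m) f')"
    using leibniz[OF XZY g f'] f(1) by simp
  ultimately show ?case
    using ideal_pow_add fold_comps_ideal_pow ideal_pow_ksign XZY by metis
qed

lemma dif_ideal_pow:
  assumes "X \<in> Obj C" "Y \<in> Obj C" "f \<in> ideal_pow C \<nn> (Suc k) X Y n"
  shows "dif C X Y n f \<in> ideal_pow C \<nn> k X Y (n + 1)"
  using assms(3)
proof (induction rule: ideal_pow_induct)
  case (add f g)
  then show ?case
    using dif_add[OF assms(1,2) fold_comps_hom[OF assms(1,2) add(1)]
        ideal_pow_hom[OF assms(1,2) add(2)]] dif_fold_comps[OF assms(1,2) add(1)] ideal_pow_add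
    by simp
qed (use dif_zero ideal_pow_zero assms in simp)

lemma coset_eq_iff:
  assumes "X \<in> Obj C" "Y \<in> Obj C"
  shows "(+) f ` ideal_pow C \<nn> k X Y n = (+) g ` ideal_pow C \<nn> k X Y n
    \<longleftrightarrow> f - g \<in> ideal_pow C \<nn> k X Y n"
proof
  assume eq: "(+) f ` ideal_pow C \<nn> k X Y n = (+) g ` ideal_pow C \<nn> k X Y n"
  have "f \<in> (+) f ` ideal_pow C \<nn> k X Y n"
    using ideal_pow_zero by (auto intro: image_eqI[of _ _ 0])
  then show "f - g \<in> ideal_pow C \<nn> k X Y n"
    unfolding eq by auto
next
  have le: "(+) f ` ideal_pow C \<nn> k X Y n \<subseteq> (+) g ` ideal_pow C \<nn> k X Y n"
    if "f - g \<in> ideal_pow C \<nn> k X Y n" for f g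
  proof
    fix x assume "x \<in> (+) f ` ideal_pow C \<nn> k X Y n"
    then obtain y where y: "x = f + y" "y \<in> ideal_pow C \<nn> k X Y n" by auto
    then have "x = g + ((f - g) + y)" by simp
    then show "x \<in> (+) g ` ideal_pow C \<nn> k X Y n"
      using ideal_pow_add[OF that y(2)] by blast
  qed
  assume "f - g \<in> ideal_pow C \<nn> k X Y n"
  then show "(+) f ` ideal_pow C \<nn> k X Y n = (+) g ` ideal_pow C \<nn> k X Y n"
    using le[of f g] le[of g f] ideal_pow_uminus[OF assms, of "f - g"] by auto
qed

text \<open>The bijection with the inverse limit has two halves: injectivity separates the
  filtration, and surjectivity sums every series whose l-th term lies in the l-th power.\<close>

lemma filtered_ideal_pow:
  assumes "complete_wrt C \<nn>"
  shows "filtered_dg_category C (ideal_pow C \<nn>)"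
proof unfold_locales
  fix X Y assume XY: "X \<in> Obj C" "Y \<in> Obj C"
  fix n
  let ?q = "\<lambda>f k. (+) f ` ideal_pow C \<nn> k X Y n"
  have bij: "bij_betw ?q (Hom C X Y n) (inv_limit C \<nn> X Y n)"
    using assms XY by (simp add: complete_wrt_def)
  show "f = 0" if "\<And>k. f \<in> ideal_pow C \<nn> k X Y n" for f
  proof -
    have "?q f = ?q 0"
    proof
      show "?q f k = ?q 0 k" for k
        unfolding coset_eq_iff[OF XY] using that by simp
    qed
    then show ?thesis
      using inj_onD[OF bij_betw_imp_inj_on[OF bij]] ideal_pow_hom[OF XY that] hom_zero[OF XY]
      by blast
  qed
  show "\<exists>s\<in>Hom C X Y n. \<forall>k. s - (\<Sum>l<k. p l) \<in> ideal_pow C \<nn> k X Y n"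
    if p: "\<And>l. p l \<in> ideal_pow C \<nn> l X Y n" for p
  proof -
    \<comment> \<open>The coset at level \<open>k\<close> of the \<open>k\<close>-th partial sum.
      These cosets are compatible because the next term \<open>p k\<close> already lies in the
      \<open>k\<close>-th power.\<close>
    let ?c = "\<lambda>k. ?q (\<Sum>l<k. p l) k"
    have "?c (Suc k) \<subseteq> ?c k" for k
    proof
      fix x assume "x \<in> ?c (Suc k)"
      then obtain y where y: "y \<in> ideal_pow C \<nn> (Suc k) X Y n" "x = (\<Sum>l<Suc k. p l) + y" by auto
      then have "x = (\<Sum>l<k. p l) + (p k + y)" by (simp add: add_ac)
      then show "x \<in> ?c k"
        using ideal_pow_add[OF p ideal_pow_Suc_subset[OF XY y(1)]] by blast
    qed
    moreover have "(\<Sum>l<k. p l) \<in> Hom C X Y n" for k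
      by (rule hom_sum[OF XY]) (rule ideal_pow_hom[OF XY p])
    ultimately have "?c \<in> inv_limit C \<nn> X Y n"
      by (auto simp: inv_limit_def)
    then obtain s where "s \<in> Hom C X Y n" "?c = ?q s"
      using bij by (auto simp: bij_betw_def)
    moreover from this(2) have "s - (\<Sum>l<k. p l) \<in> ideal_pow C \<nn> k X Y n" for k
      using coset_eq_iff[OF XY, of s k n "\<Sum>l<k. p l"] by metis
    ultimately show ?thesis by blast
  qed
qed (rule ideal_pow_0 ideal_pow_zero ideal_pow_add ideal_pow_uminus ideal_pow_Suc_subset
      ideal_pow_cmp dif_ideal_pow; assumption)+

end


section \<open>The filtration of power series\<close>

text \<open>This is the filtration by the powers of the ideal generated by \<open>\<nn>\<close> and \<open>\<epsilon>\<close>.\<close>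

definition ps_filt ::
    "(nat \<Rightarrow> 'o \<Rightarrow> 'o \<Rightarrow> int \<Rightarrow> 'm set) \<Rightarrow> nat \<Rightarrow> 'o \<Rightarrow> 'o \<Rightarrow> int \<Rightarrow> (nat \<Rightarrow> 'm) set" where
  "ps_filt N k X Y n = {f. \<forall>i. f i \<in> N (k - i) X Y (n - 2 * int i)}"

lemma ps_filt_iff: "f \<in> ps_filt N k X Y n \<longleftrightarrow> (\<forall>i. f i \<in> N (k - i) X Y (n - 2 * int i))"
  by (simp add: ps_filt_def)

context filtered_dg_category
begin

lemma filtered_ps_cat: "filtered_dg_category (ps_cat C) (ps_filt N)"
proof (intro filtered_dg_category.intro filtered_dg_category_axioms.intro dg_category_ps_cat)
  fix X Y assume "X \<in> Obj (ps_cat C)" "Y \<in> Obj (ps_cat C)"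
  then have XY: "X \<in> Obj C" "Y \<in> Obj C" by auto
  fix n
  show "ps_filt N 0 X Y n = Hom (ps_cat C) X Y n"
    using filt_0[OF XY] by (auto simp: ps_filt_iff)
  show "f = 0" if "\<And>k. f \<in> ps_filt N k X Y n" for f
  proof
    fix i
    \<comment> \<open>Coefficient \<open>i\<close> sees the filtration delayed by \<open>i\<close>,
      so membership in step \<open>k + i\<close> has to be used.\<close>
    have "f i \<in> N k X Y (n - 2 * int i)" for k
      using that[of "k + i"] by (simp add: ps_filt_iff) (metis add_diff_cancel_right')
    then show "f i = 0 i" using filt_separated[OF XY] by (metis zero_fun_apply)
  qed
  show "\<exists>s\<in>Hom (ps_cat C) X Y n. \<forall>k. s - (\<Sum>l<k. p l) \<in> ps_filt N k X Y n"
    if p: "\<And>l. p l \<in> ps_filt N l X Y n" for p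
  proof -
    have p'1: "p l i \<in> N (l - i) X Y (n - 2 * int i)" for l i
      using p by (auto simp: ps_filt_iff)
    note p' = p'1 filt_hom[OF XY p'1]
    \<comment> \<open>The difference \<open>l - i\<close> is truncated: terms with l < i have no
      smallness in coefficient \<open>i\<close>. Shifting by \<open>i\<close> leaves a series whose
      l-th term lies in step \<open>l\<close>.\<close>
    have "\<exists>s\<in>Hom C X Y (n - 2 * int i).
        \<forall>k. s - (\<Sum>l<k. p (l + i) i) \<in> N k X Y (n - 2 * int i)" for i
      using p'(1)[of "_ + i" i] by (intro filt_complete[OF XY]) simp
    then obtain s where s: "s i \<in> Hom C X Y (n - 2 * int i)"
      "s i - (\<Sum>l<k. p (l + i) i) \<in> N k X Y (n - 2 * int i)" for i k
      by metis
    \<comment> \<open>The finitely many terms skipped by the shift are added back.\<close>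
    define S where "S i = s i + (\<Sum>l<i. p l i)" for i
    have S: "S i \<in> Hom C X Y (n - 2 * int i)" for i
      using hom_add[OF XY s(1)[of i] hom_sum[OF XY p'(2)]] by (simp add: S_def)
    moreover have "S i - (\<Sum>l<k. p l i) \<in> N (k - i) X Y (n - 2 * int i)" for i k
    proof (cases "i \<le> k")
      case True
      then have "(\<Sum>l<k. p l i) = (\<Sum>l<i. p l i) + (\<Sum>l<k - i. p (l + i) i)"
        using sum_lessThan_add[of "\<lambda>l. p l i" i "k - i"] by simp
      then show ?thesis
        using s(2)[where i = i and k = "k - i"] by (simp add: S_def algebra_simps)
    next
      case False
      \<comment> \<open>For k < i the required step \<open>k - i\<close> is 0, which asks for no
        more than membership in the hom set.\<close>
      then show ?thesis
        using hom_diff[OF XY S[of i] hom_sum[OF XY p'(2)]] by (simp add: filt_0[OF XY])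
    qed
    ultimately show ?thesis
      by (intro bexI[of _ S]) (auto simp: ps_filt_iff sum_fun_apply)
  qed
  fix f k
  show "dif (ps_cat C) X Y n f \<in> ps_filt N k X Y (n + 1)" if f: "f \<in> ps_filt N (Suc k) X Y n"
    unfolding ps_filt_iff
  proof
    fix i
    have fi: "f i \<in> N (Suc k - i) X Y (n - 2 * int i)" using f by (simp add: ps_filt_iff)
    have "dif C X Y (n - 2 * int i) (f i) \<in> N (k - i) X Y (n - 2 * int i + 1)"
    proof (cases "i \<le> k")
      case True
      then show ?thesis using fi filt_dif[OF XY] by (simp add: Suc_diff_le)
    next
      case False
      then show ?thesis using dif_in[OF XY filt_hom[OF XY fi]] by (simp add: filt_0[OF XY])
    qed
    then show "dif (ps_cat C) X Y n f i \<in> N (k - i) X Y (n + 1 - 2 * int i)"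
      by (simp add: algebra_simps)
  qed
  show "f \<in> ps_filt N k X Y n" if f: "f \<in> ps_filt N (Suc k) X Y n"
    unfolding ps_filt_iff
  proof
    show "f i \<in> N (k - i) X Y (n - 2 * int i)" for i
      using f filt_mono[OF XY, of "k - i" "Suc k - i"] by (simp add: ps_filt_iff)
  qed
next
  fix X Y Z g k m f l n
  assume "X \<in> Obj (ps_cat C)" "Y \<in> Obj (ps_cat C)" "Z \<in> Obj (ps_cat C)"
    and g: "g \<in> ps_filt N k Y Z m" and f: "f \<in> ps_filt N l X Y n"
  then have XYZ: "X \<in> Obj C" "Y \<in> Obj C" "Z \<in> Obj C" by auto
  have "g j \<cdot> f (i - j) \<in> N (k + l - i) X Z (m + n - 2 * int i)" if "j \<le> i" for i j
  proof -
    have "g j \<cdot> f (i - j) \<in> N (k - j + (l - (i - j))) X Z (m - 2 * int j + (n - 2 * int (i - j)))"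
      using f g by (intro filt_cmp[OF XYZ]) (simp_all add: ps_filt_iff del: of_nat_diff)
    also have "m - 2 * int j + (n - 2 * int (i - j)) = m + n - 2 * int i"
      using that by (simp add: of_nat_diff)
    \<comment> \<open>Truncated differences satisfy (k - j) + (l - (i - j)) \<ge> k + l - i, so
      monotonicity of the filtration suffices.\<close>
    finally show ?thesis
      by (rule filt_mono[OF XYZ(1,3), rotated]) (use that in simp)
  qed
  then show "g \<cdot>\<^bsub>ps_cat C\<^esub> f \<in> ps_filt N (k + l) X Z (m + n)"
    using XYZ by (auto simp: ps_filt_iff intro!: filt_sum)
qed (auto simp: ps_filt_iff filt_zero filt_add filt_uminus)

end


section \<open>Substituting \<open>z + \<epsilon>\<close> for \<open>\<epsilon>\<close>\<close>

lemma ps_const_0 [simp]: "ps_const 0 = 0"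
  by (auto simp: ps_const_def)

lemma ps_const_add: "ps_const (x + y :: 'a::ab_group_add) = ps_const x + ps_const y"
  by (auto simp: ps_const_def)

lemma ps_const_diff: "ps_const (x - y :: 'a::ab_group_add) = ps_const x - ps_const y"
  by (auto simp: ps_const_def)

lemma ps_const_sum: "ps_const (sum f A) = (\<Sum>i\<in>A. ps_const (f i :: 'a::ab_group_add))"
  by (induction A rule: infinite_finite_induct) (simp_all add: ps_const_add)

lemma eps_mult_simps [simp]: "eps_mult f 0 = 0" "eps_mult f (Suc i) = f i"
  by (simp_all add: eps_mult_def)

lemma eps_mult_0 [simp]: "eps_mult 0 = 0"
  by (rule ext) (simp add: eps_mult_def split: nat.split)

context dg_category
begin

lemma ps_const_cmp_ps_const:
  assumes "X \<in> Obj C" "Y \<in> Obj C" "Z \<in> Obj C" "b \<in> Hom C Y Z m" "a \<in> Hom C X Y n"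
  shows "ps_const b \<cdot>\<^bsub>ps_cat C\<^esub> ps_const a = ps_const (b \<cdot> a)"
proof
  fix i
  show "(ps_const b \<cdot>\<^bsub>ps_cat C\<^esub> ps_const a) i = ps_const (b \<cdot> a) i"
    using ps_const_cmp[OF assms(1-4) ps_const_in[OF assms(1,2,5)]] cmp_zero_right[OF assms(1-4)]
    by (simp add: ps_const_def)
qed

lemma dif_ps_const:
  assumes "X \<in> Obj C" "Y \<in> Obj C"
  shows "dif (ps_cat C) X Y n (ps_const a) = ps_const (dif C X Y n a)"
  using dif_zero[OF assms] by (intro ext) (simp add: ps_const_def)

lemma dif_eps_mult:
  assumes "X \<in> Obj C" "Y \<in> Obj C"
  shows "dif (ps_cat C) X Y (n + 2) (eps_mult f) = eps_mult (dif (ps_cat C) X Y n f)"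
proof
  fix i
  show "dif (ps_cat C) X Y (n + 2) (eps_mult f) i = eps_mult (dif (ps_cat C) X Y n f) i"
    using dif_zero[OF assms] by (cases i) (simp_all add: algebra_simps)
qed

lemma eps_mult_cmp:
  assumes "X \<in> Obj C" "Y \<in> Obj C" "Z \<in> Obj C" "f \<in> Hom (ps_cat C) X Y n"
  shows "eps_mult g \<cdot>\<^bsub>ps_cat C\<^esub> f = eps_mult (g \<cdot>\<^bsub>ps_cat C\<^esub> f)"
proof
  fix i
  have "0 \<cdot> f j = 0" for j
    using cmp_zero_left[OF assms(1-3)] assms(4) by auto
  then show "(eps_mult g \<cdot>\<^bsub>ps_cat C\<^esub> f) i = eps_mult (g \<cdot>\<^bsub>ps_cat C\<^esub> f) i"
    by (cases i) (simp_all add: sum.atMost_Suc_shift del: sum.atMost_Suc)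
qed

lemma cmp_eps_mult:
  assumes "X \<in> Obj C" "Y \<in> Obj C" "Z \<in> Obj C" "g \<in> Hom (ps_cat C) Y Z m"
  shows "g \<cdot>\<^bsub>ps_cat C\<^esub> eps_mult f = eps_mult (g \<cdot>\<^bsub>ps_cat C\<^esub> f)"
proof
  fix i
  have "g j \<cdot> 0 = 0" for j
    using cmp_zero_right[OF assms(1-3)] assms(4) by auto
  then show "(g \<cdot>\<^bsub>ps_cat C\<^esub> eps_mult f) i = eps_mult (g \<cdot>\<^bsub>ps_cat C\<^esub> f) i"
    by (cases i) (simp_all add: Suc_diff_le)
qed

end

text \<open>An abstract filtration stands for the powers of the ideal: substitution only asks for a
  complete filtration with a closed central \<open>z\<close> in its first step.\<close>

locale subst_category = filtered_dg_category C N
  for C :: "('o, 'm::ab_group_add, 'k::{comm_ring, comm_monoid_mult}) dgcat" (structure)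
    and N :: "nat \<Rightarrow> 'o \<Rightarrow> 'o \<Rightarrow> int \<Rightarrow> 'm set" +
  fixes z :: "'o \<Rightarrow> 'm"
  assumes z_central: "closed_central2 C z"
    and z_filt: "X \<in> Obj C \<Longrightarrow> z X \<in> N 1 X X 2"
begin

interpretation E: filtered_dg_category "ps_cat C" "ps_filt N"
  by (rule filtered_ps_cat)

abbreviation eps :: "'o \<Rightarrow> nat \<Rightarrow> 'm" where
  "eps X \<equiv> eps_mult (ident (ps_cat C) X)"

abbreviation zeps :: "'o \<Rightarrow> nat \<Rightarrow> 'm" where
  "zeps X \<equiv> z_plus_eps C z X"

lemma eps_in: "X \<in> Obj C \<Longrightarrow> eps X \<in> Hom (ps_cat C) X X 2"
  using eps_mult_in[of X X "ident (ps_cat C) X" 0] E.ident_in[of X] by simp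

text \<open>Identifies the shift \<open>eps_mult\<close> with composition by a morphism, so that
  \<epsilon> can serve as a closed central element on the same footing as z + \<epsilon>.\<close>

lemma eps_cmp:
  assumes "X \<in> Obj C" "Y \<in> Obj C" "f \<in> Hom (ps_cat C) X Y n"
  shows "eps Y \<cdot>\<^bsub>ps_cat C\<^esub> f = eps_mult f"
  using eps_mult_cmp[OF assms(1,2,2,3), of "ident (ps_cat C) Y"] E.ident_left[of X Y f n] assms
  by (simp del: ps_cat_simps(2,4,5))

lemma cmp_eps:
  assumes "X \<in> Obj C" "Y \<in> Obj C" "f \<in> Hom (ps_cat C) X Y n"
  shows "f \<cdot>\<^bsub>ps_cat C\<^esub> eps X = eps_mult f"
  using cmp_eps_mult[OF assms(1,1,2,3), of "ident (ps_cat C) X"] E.ident_right[of X Y f n] assms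
  by (simp del: ps_cat_simps(2,4,5))

lemma dif_eps: "X \<in> Obj C \<Longrightarrow> dif (ps_cat C) X X 2 (eps X) = 0"
  using dif_eps_mult[of X X 0 "ident (ps_cat C) X"] E.dif_ident[of X]
  by (simp del: ps_cat_simps(2,4,6))

lemma z_in: "X \<in> Obj C \<Longrightarrow> z X \<in> Hom C X X 2"
  using filt_hom z_filt by blast

text \<open>The summand z is small by hypothesis. The variable is small for another reason: its only
  coefficient has index 1, where step 1 of \<open>ps_filt\<close> asks for membership in
  \<open>N 0\<close> alone.\<close>

lemma zeps_filt:
  assumes "X \<in> Obj C"
  shows "zeps X \<in> ps_filt N 1 X X 2"
  unfolding ps_filt_iff
proof
  fix i
  show "zeps X i \<in> N (1 - i) X X (2 - 2 * int i)"
    using z_filt[OF assms] ident_in[OF assms] assms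
    by (auto simp: z_plus_eps_def ps_const_def eps_mult_def filt_0 hom_zero split: nat.split)
qed

lemma zeps_in: "X \<in> Obj C \<Longrightarrow> zeps X \<in> Hom (ps_cat C) X X 2"
  using E.filt_hom[OF _ _ zeps_filt] by simp

lemma zeps_commute:
  assumes "X \<in> Obj C" "Y \<in> Obj C" "f \<in> Hom (ps_cat C) X Y n"
  shows "zeps Y \<cdot>\<^bsub>ps_cat C\<^esub> f = f \<cdot>\<^bsub>ps_cat C\<^esub> zeps X"
proof -
  have "ps_const (z Y) \<cdot>\<^bsub>ps_cat C\<^esub> f = f \<cdot>\<^bsub>ps_cat C\<^esub> ps_const (z X)"
  proof
    fix i
    have "z Y \<cdot> f i = f i \<cdot> z X"
      using z_central assms unfolding closed_central2_def ps_cat_simps by blast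
    then show "(ps_const (z Y) \<cdot>\<^bsub>ps_cat C\<^esub> f) i = (f \<cdot>\<^bsub>ps_cat C\<^esub> ps_const (z X)) i"
      unfolding ps_const_cmp[OF assms(1,2,2) z_in[OF assms(2)] assms(3)]
        cmp_ps_const[OF assms(1,1,2,3) z_in[OF assms(1)]] .
  qed
  moreover have "zeps Y \<cdot>\<^bsub>ps_cat C\<^esub> f = ps_const (z Y) \<cdot>\<^bsub>ps_cat C\<^esub> f + eps Y \<cdot>\<^bsub>ps_cat C\<^esub> f"
    unfolding z_plus_eps_def
    by (rule E.cmp_add_left[OF _ _ _ ps_const_in[OF _ _ z_in] eps_in assms(3)]) (use assms in simp_all)
  moreover have "f \<cdot>\<^bsub>ps_cat C\<^esub> zeps X = f \<cdot>\<^bsub>ps_cat C\<^esub> ps_const (z X) + f \<cdot>\<^bsub>ps_cat C\<^esub> eps X"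
    unfolding z_plus_eps_def
    by (rule E.cmp_add_right[OF _ _ _ assms(3) ps_const_in[OF _ _ z_in] eps_in]) (use assms in simp_all)
  ultimately show ?thesis
    unfolding eps_cmp[OF assms] cmp_eps[OF assms] by simp
qed

lemma dif_zeps:
  assumes "X \<in> Obj C"
  shows "dif (ps_cat C) X X 2 (zeps X) = 0"
proof -
  have "dif C X X 2 (z X) = 0"
    using z_central assms by (simp add: closed_central2_def)
  then have "dif (ps_cat C) X X 2 (ps_const (z X)) = 0"
    using dif_ps_const[OF assms assms] by simp
  moreover have "dif (ps_cat C) X X 2 (zeps X) =
      dif (ps_cat C) X X 2 (ps_const (z X)) + dif (ps_cat C) X X 2 (eps X)"
    unfolding z_plus_eps_def
    by (rule E.dif_add[OF _ _ ps_const_in[OF _ _ z_in] eps_in]) (use assms in simp_all)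
  ultimately show ?thesis using dif_eps[OF assms] by simp
qed

section \<open>Series in powers of z + \<epsilon>\<close>

abbreviation zpow :: "'o \<Rightarrow> nat \<Rightarrow> nat \<Rightarrow> 'm" where
  "zpow X l \<equiv> mor_pow (ps_cat C) X (zeps X) l"

lemma zpow_in: "X \<in> Obj C \<Longrightarrow> zpow X l \<in> Hom (ps_cat C) X X (int l * 2)"
  using E.mor_pow_in[OF _ zeps_in] by simp

lemma dif_zpow:
  assumes "X \<in> Obj C"
  shows "dif (ps_cat C) X X (int l * 2) (zpow X l) = 0"
proof (induction l)
  case 0
  show ?case using E.dif_ident[of X] assms by simp
next
  case (Suc l)
  have X: "X \<in> Obj (ps_cat C)" using assms by simp
  have "int (Suc l) * 2 = 2 + int l * 2" by simp
  moreover have "dif (ps_cat C) X X (2 + int l * 2) (zpow X (Suc l)) = 0 + ksign 2 0"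
    using E.leibniz[OF X X X zeps_in[OF assms] zpow_in[OF assms, of l]]
    by (simp only: Suc dif_zeps[OF assms] mor_pow.simps(2)
        E.cmp_zero_left[OF X X X zpow_in[OF assms]] E.cmp_zero_right[OF X X X zeps_in[OF assms]])
  ultimately show ?case by (simp only: ksign_def) simp
qed

definition subst_term :: "'o \<Rightarrow> (nat \<Rightarrow> 'm) \<Rightarrow> nat \<Rightarrow> nat \<Rightarrow> 'm" where
  "subst_term Y a l = zpow Y l \<cdot>\<^bsub>ps_cat C\<^esub> ps_const (a l)"

text \<open>Convergence of whole series with a fixed rate, instead of coefficientwise convergence
  without a rate as in \<open>is_subst\<close>. Continuity arguments then become one membership for
  each \<open>k\<close>.\<close>

definition substitutes :: "'o \<Rightarrow> 'o \<Rightarrow> int \<Rightarrow> (nat \<Rightarrow> 'm) \<Rightarrow> (nat \<Rightarrow> 'm) \<Rightarrow> bool" where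
  "substitutes X Y n a s \<longleftrightarrow> s \<in> Hom (ps_cat C) X Y n \<and>
     (\<forall>k. s - (\<Sum>l<k. subst_term Y a l) \<in> ps_filt N k X Y n)"

lemma const_coeff_in:
  assumes "X \<in> Obj C" "Y \<in> Obj C" "a \<in> Hom (ps_cat C) X Y n"
  shows "ps_const (a l) \<in> Hom (ps_cat C) X Y (n - 2 * int l)"
  by (rule ps_const_in[OF assms(1,2)]) (use assms(3) in simp)

lemma subst_term_filt:
  assumes "X \<in> Obj C" "Y \<in> Obj C" "a \<in> Hom (ps_cat C) X Y n"
  shows "subst_term Y a l \<in> ps_filt N l X Y n"
proof -
  have O: "X \<in> Obj (ps_cat C)" "Y \<in> Obj (ps_cat C)" using assms by simp_all
  have "zpow Y l \<in> ps_filt N l Y Y (int l * 2)"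
    by (rule E.filt_mor_pow[OF O(2) zeps_filt[OF assms(2)]])
  from E.filt_cmp_hom_right[OF O(1,2,2) this const_coeff_in[OF assms, of l]] show ?thesis
    by (simp add: subst_term_def)
qed

lemma subst_term_in:
  assumes "X \<in> Obj C" "Y \<in> Obj C" "a \<in> Hom (ps_cat C) X Y n"
  shows "subst_term Y a l \<in> Hom (ps_cat C) X Y n"
  using E.filt_hom[OF _ _ subst_term_filt[OF assms]] assms by simp

text \<open>A coefficientwise limit without a rate still has the prescribed one, because in
  coefficient \<open>i\<close> all terms from index \<open>k\<close> on are already small of order
  \<open>k - i\<close>.\<close>

lemma substitutes_iff_coeffs:
  assumes "X \<in> Obj C" "Y \<in> Obj C" "a \<in> Hom (ps_cat C) X Y n"
  shows "substitutes X Y n a s \<longleftrightarrow>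
    (\<forall>i. s i \<in> Hom C X Y (n - 2 * int i) \<and>
      (\<forall>k. \<exists>m. \<forall>M\<ge>m. s i - (\<Sum>l<M. subst_term Y a l i) \<in> N k X Y (n - 2 * int i)))"
    (is "_ \<longleftrightarrow> ?R")
proof
  assume s: "substitutes X Y n a s"
  have *: "s i - (\<Sum>l<k. subst_term Y a l i) \<in> N (k - i) X Y (n - 2 * int i)" for i k
    using s by (auto simp: substitutes_def ps_filt_iff sum_fun_apply)
  \<comment> \<open>Coefficient \<open>i\<close> lags by \<open>i\<close>, so closeness
    \<open>k\<close> is reached from M = k + i on.\<close>
  have "s i - (\<Sum>l<M. subst_term Y a l i) \<in> N k X Y (n - 2 * int i)" if "M \<ge> k + i" for i k M
    by (rule filt_mono[OF assms(1,2) _ *]) (use that in simp)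
  moreover have "s i \<in> Hom C X Y (n - 2 * int i)" for i
    using s by (simp add: substitutes_def)
  ultimately show ?R by blast
next
  assume R: ?R
  have "s i - (\<Sum>l<k. subst_term Y a l i) \<in> N (k - i) X Y (n - 2 * int i)" for i k
  proof -
    obtain m where
      m: "\<And>M. M \<ge> m \<Longrightarrow> s i - (\<Sum>l<M. subst_term Y a l i) \<in> N (k - i) X Y (n - 2 * int i)"
      using R by blast
    have "subst_term Y a l i \<in> N (k - i) X Y (n - 2 * int i)" if "l \<ge> k" for l
    proof (rule filt_mono[OF assms(1,2)])
      show "subst_term Y a l i \<in> N (l - i) X Y (n - 2 * int i)"
        using subst_term_filt[OF assms] by (simp add: ps_filt_iff)
    qed (use that in simp)
    \<comment> \<open>These \<open>m\<close> terms separate the partial sum up to \<open>k\<close>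
      from the one up to \<open>k + m\<close>, where the limit is known to be close.\<close>
    then have "(\<Sum>l<m. subst_term Y a (l + k) i) \<in> N (k - i) X Y (n - 2 * int i)"
      by (intro filt_sum[OF assms(1,2)]) simp
    from filt_add[OF assms(1,2) m[of "k + m"] this] show ?thesis
      using sum_lessThan_add[of "\<lambda>l. subst_term Y a l i" k m] by simp
  qed
  then show "substitutes X Y n a s"
    using R by (simp add: substitutes_def ps_filt_iff sum_fun_apply)
qed

lemma substitutes_unique:
  assumes "X \<in> Obj C" "Y \<in> Obj C" "substitutes X Y n a s" "substitutes X Y n a s'"
  shows "s = s'"
proof (rule E.filt_eqI)
  show "s - s' \<in> ps_filt N k X Y n" for k
    using E.filt_diff[of X Y "s - (\<Sum>l<k. subst_term Y a l)" k n "s' - (\<Sum>l<k. subst_term Y a l)"]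
      assms by (simp add: substitutes_def)
qed (use assms in simp_all)

lemma ex1_substitutes:
  assumes "X \<in> Obj C" "Y \<in> Obj C" "a \<in> Hom (ps_cat C) X Y n"
  shows "\<exists>!s. substitutes X Y n a s"
proof -
  obtain s where "substitutes X Y n a s"
    using E.filt_complete[of X Y "subst_term Y a" n] subst_term_filt[OF assms] assms
    unfolding substitutes_def by (auto simp del: ps_cat_simps(2))
  then show ?thesis
    using substitutes_unique[OF assms(1,2)] by blast
qed

lemma substitutes_in: "substitutes X Y n a s \<Longrightarrow> s \<in> Hom (ps_cat C) X Y n"
  by (simp add: substitutes_def)

lemma substitutes_diff:
  assumes "X \<in> Obj C" "Y \<in> Obj C" "a \<in> Hom (ps_cat C) X Y n" "b \<in> Hom (ps_cat C) X Y n"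
    and "substitutes X Y n a s" "substitutes X Y n b s'"
  shows "substitutes X Y n (a - b) (s - s')"
  unfolding substitutes_def
proof (intro conjI allI)
  have XY: "X \<in> Obj (ps_cat C)" "Y \<in> Obj (ps_cat C)" using assms by simp_all
  show "s - s' \<in> Hom (ps_cat C) X Y n"
    using E.hom_diff[OF XY assms(5,6)[THEN substitutes_in]] .
  fix k
  have "subst_term Y (a - b) l = subst_term Y a l - subst_term Y b l" for l
    using E.cmp_diff_right[OF XY(1,2,2) zpow_in const_coeff_in const_coeff_in, OF assms(2,1,2,3,1,2,4)]
    by (simp add: subst_term_def ps_const_diff)
  then have eq: "s - s' - (\<Sum>l<k. subst_term Y (a - b) l) =
      (s - (\<Sum>l<k. subst_term Y a l)) - (s' - (\<Sum>l<k. subst_term Y b l))"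
    by (simp add: sum_subtractf)
  show "s - s' - (\<Sum>l<k. subst_term Y (a - b) l) \<in> ps_filt N k X Y n"
    unfolding eq by (rule E.filt_diff[OF XY]) (use assms(5,6) in \<open>simp_all add: substitutes_def\<close>)
qed

lemma substitutes_ident:
  assumes "X \<in> Obj C"
  shows "substitutes X X 0 (ident (ps_cat C) X) (ident (ps_cat C) X)"
  unfolding substitutes_def
proof (intro conjI allI)
  have X: "X \<in> Obj (ps_cat C)" using assms by simp
  show i: "ident (ps_cat C) X \<in> Hom (ps_cat C) X X 0"
    by (rule E.ident_in[OF X])
  fix k
  have "subst_term X (ident (ps_cat C) X) l = (if l = 0 then ident (ps_cat C) X else 0)" for l
  proof -
    have "ps_const (ident (ps_cat C) X l) = (if l = 0 then ident (ps_cat C) X else 0)"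
      by (auto simp: ps_const_def)
    then show ?thesis
      using E.ident_left[OF X X i] E.cmp_zero_right[OF X X X zpow_in[OF assms]]
      by (simp add: subst_term_def del: ps_cat_simps(2,4,5))
  qed
  \<comment> \<open>The empty sum at k = 0 is harmless, because step 0 is the whole hom set.\<close>
  then have "(\<Sum>l<k. subst_term X (ident (ps_cat C) X) l) = (if k = 0 then 0 else ident (ps_cat C) X)"
    by (induction k) auto
  then show "ident (ps_cat C) X - (\<Sum>l<k. subst_term X (ident (ps_cat C) X) l) \<in> ps_filt N k X X 0"
    using i E.filt_0[OF X X] E.filt_zero[OF X X] by (simp del: ps_cat_simps(2,4))
qed

text \<open>This is where \<epsilon> becomes z + \<epsilon>: shifting the coefficients of
  \<open>a\<close> by one raises the power in front of each by one.\<close>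

lemma substitutes_eps_mult:
  assumes "X \<in> Obj C" "Y \<in> Obj C" "a \<in> Hom (ps_cat C) X Y n" and s: "substitutes X Y n a s"
  shows "substitutes X Y (n + 2) (eps_mult a) (zeps Y \<cdot>\<^bsub>ps_cat C\<^esub> s)"
  unfolding substitutes_def
proof (intro conjI allI)
  have XY: "X \<in> Obj (ps_cat C)" "Y \<in> Obj (ps_cat C)" using assms by simp_all
  show in': "zeps Y \<cdot>\<^bsub>ps_cat C\<^esub> s \<in> Hom (ps_cat C) X Y (n + 2)"
    using E.cmp_in[OF XY(1,2,2) zeps_in[OF assms(2)] substitutes_in[OF s]] by (simp only: add.commute)
  fix k
  let ?u = "\<lambda>k. zeps Y \<cdot>\<^bsub>ps_cat C\<^esub> s - (\<Sum>l<k. subst_term Y (eps_mult a) l)"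
  \<comment> \<open>The shifted series has no term of index 0, so its remainder after
    \<open>Suc k\<close> terms is z + \<epsilon> times the old remainder after \<open>k\<close>;
    this factor supplies the extra filtration step.\<close>
  have "?u (Suc k) \<in> ps_filt N (Suc k) X Y (n + 2)" for k
  proof -
    have "subst_term Y (eps_mult a) (Suc l) = zeps Y \<cdot>\<^bsub>ps_cat C\<^esub> subst_term Y a l" for l
      using E.cmp_assoc[OF XY(1,2,2,2) zeps_in zpow_in const_coeff_in, OF assms(2,2,1-3)]
      by (simp add: subst_term_def)
    moreover have "subst_term Y (eps_mult a) 0 = 0"
      using E.cmp_zero_right[OF XY(1,2,2) E.ident_in[OF XY(2)]] by (simp add: subst_term_def)
    ultimately have "(\<Sum>l<Suc k. subst_term Y (eps_mult a) l) =
        (\<Sum>l<k. zeps Y \<cdot>\<^bsub>ps_cat C\<^esub> subst_term Y a l)"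
      by (simp add: sum.lessThan_Suc_shift del: sum.lessThan_Suc)
    also have "\<dots> = zeps Y \<cdot>\<^bsub>ps_cat C\<^esub> (\<Sum>l<k. subst_term Y a l)"
      by (rule E.cmp_sum_right[OF XY(1,2,2) zeps_in subst_term_in, OF assms(2,1-3), symmetric])
    finally have "?u (Suc k) = zeps Y \<cdot>\<^bsub>ps_cat C\<^esub> (s - (\<Sum>l<k. subst_term Y a l))"
      using E.cmp_diff_right[OF XY(1,2,2) zeps_in substitutes_in E.hom_sum[OF XY subst_term_in],
          OF assms(2) s assms(1-3), of "\<lambda>l. l" "{..<k}"] by (simp only:)
    then show ?thesis
      using E.filt_cmp[OF XY(1,2,2) zeps_filt[OF assms(2)]] s
      unfolding substitutes_def by (metis add.commute plus_1_eq_Suc)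
  qed
  moreover have "?u 0 \<in> ps_filt N 0 X Y (n + 2)"
    using in' E.filt_0[OF XY] by simp
  ultimately show "?u k \<in> ps_filt N k X Y (n + 2)"
    by (cases k) auto
qed

text \<open>The powers of z + \<epsilon> are closed and of even degree, so d acts on the
  coefficients of \<open>a\<close> without a sign.\<close>

lemma substitutes_dif:
  assumes "X \<in> Obj C" "Y \<in> Obj C" "a \<in> Hom (ps_cat C) X Y n" and s: "substitutes X Y n a s"
  shows "substitutes X Y (n + 1) (dif (ps_cat C) X Y n a) (dif (ps_cat C) X Y n s)"
  unfolding substitutes_def
proof (intro conjI allI)
  have XY: "X \<in> Obj (ps_cat C)" "Y \<in> Obj (ps_cat C)" using assms by simp_all
  show "dif (ps_cat C) X Y n s \<in> Hom (ps_cat C) X Y (n + 1)"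
    by (rule E.dif_in[OF XY substitutes_in[OF s]])
  fix k
  let ?d = "dif (ps_cat C) X Y"
  have eq: "subst_term Y (?d n a) l = ?d n (subst_term Y a l)" for l
  proof -
    have c: "?d (n - 2 * int l) (ps_const (a l)) = ps_const (?d n a l)"
      using dif_ps_const[OF assms(1,2)] by simp
    have "?d (int l * 2 + (n - 2 * int l)) (subst_term Y a l) =
        0 + ksign (int l * 2) (subst_term Y (?d n a) l)"
      using E.leibniz[OF XY(1,2,2) zpow_in const_coeff_in, OF assms(2,1-3), of l l]
        E.cmp_zero_left[OF XY(1,2,2) const_coeff_in, OF assms(1-3), of l]
      unfolding c dif_zpow[OF assms(2)] subst_term_def by (simp only:)
    then show ?thesis by (simp add: ksign_def)
  qed
  have "subst_term Y (?d n a) k \<in> ps_filt N k X Y (n + 1)"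
    by (rule subst_term_filt[OF assms(1,2) E.dif_in[OF XY assms(3)]])
  \<comment> \<open>Differentiation loses one step, so the remainder after \<open>Suc k\<close>
    terms is taken in order to end in step \<open>k\<close>; the surplus term of index
    \<open>k\<close> lies there anyway.\<close>
  moreover have "?d n (s - (\<Sum>l<Suc k. subst_term Y a l)) \<in> ps_filt N k X Y (n + 1)"
    using E.filt_dif[OF XY] s unfolding substitutes_def by blast
  moreover have "?d n s - (\<Sum>l<k. subst_term Y (?d n a) l) =
      ?d n (s - (\<Sum>l<Suc k. subst_term Y a l)) + subst_term Y (?d n a) k"
    unfolding E.dif_diff[OF XY substitutes_in[OF s] E.hom_sum[OF XY subst_term_in[OF assms(1-3)]]]
      E.dif_sum[OF XY subst_term_in[OF assms(1-3)]] eq by (simp add: algebra_simps)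
  ultimately show "?d n s - (\<Sum>l<k. subst_term Y (?d n a) l) \<in> ps_filt N k X Y (n + 1)"
    using E.filt_add[OF XY] by (simp only: add.commute)
qed

text \<open>Centrality carries the power of z + \<epsilon> past \<open>b j\<close>, and the two
  powers merge.\<close>

lemma subst_term_cmp:
  assumes "X \<in> Obj C" "Y \<in> Obj C" "Z \<in> Obj C"
    and "b \<in> Hom (ps_cat C) Y Z m" "a \<in> Hom (ps_cat C) X Y n"
  shows "subst_term Z b j \<cdot>\<^bsub>ps_cat C\<^esub> subst_term Y a i =
    zpow Z (j + i) \<cdot>\<^bsub>ps_cat C\<^esub> ps_const (b j \<cdot> a i)"
proof -
  have O: "X \<in> Obj (ps_cat C)" "Y \<in> Obj (ps_cat C)" "Z \<in> Obj (ps_cat C)" using assms by simp_all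
  note b = const_coeff_in[OF assms(2-4), of j] and a = const_coeff_in[OF assms(1,2,5), of i]
  note Tj = zpow_in[OF assms(3), of j] and Ti = zpow_in[OF assms(3), of i]
  note TY = zpow_in[OF assms(2), of i]
  have ba: "ps_const (b j) \<cdot>\<^bsub>ps_cat C\<^esub> ps_const (a i) = ps_const (b j \<cdot> a i)"
    by (rule ps_const_cmp_ps_const[OF assms(1-3)]) (use assms(4,5) in auto)
  note cba = E.cmp_in[OF O b a]
  note zc = E.mor_pow_commute[OF O(2,3) zeps_in zeps_in b zeps_commute[OF _ _ b], OF assms(2,3,2,3)]
  have "subst_term Z b j \<cdot>\<^bsub>ps_cat C\<^esub> subst_term Y a i =
      zpow Z j \<cdot>\<^bsub>ps_cat C\<^esub> ps_const (b j) \<cdot>\<^bsub>ps_cat C\<^esub> zpow Y i \<cdot>\<^bsub>ps_cat C\<^esub> ps_const (a i)"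
    unfolding subst_term_def by (rule E.cmp_assoc[OF O(1,2,3,3) Tj b E.cmp_in[OF O(1,2,2) TY a]])
  also have "ps_const (b j) \<cdot>\<^bsub>ps_cat C\<^esub> zpow Y i \<cdot>\<^bsub>ps_cat C\<^esub> ps_const (a i) =
      (ps_const (b j) \<cdot>\<^bsub>ps_cat C\<^esub> zpow Y i) \<cdot>\<^bsub>ps_cat C\<^esub> ps_const (a i)"
    by (rule E.cmp_assoc[OF O(1,2,2,3) b TY a, symmetric])
  also have "\<dots> = (zpow Z i \<cdot>\<^bsub>ps_cat C\<^esub> ps_const (b j)) \<cdot>\<^bsub>ps_cat C\<^esub> ps_const (a i)"
    by (simp only: zc)
  also have "\<dots> = zpow Z i \<cdot>\<^bsub>ps_cat C\<^esub> ps_const (b j) \<cdot>\<^bsub>ps_cat C\<^esub> ps_const (a i)"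
    by (rule E.cmp_assoc[OF O(1,2,3,3) Ti b a])
  also have "zpow Z j \<cdot>\<^bsub>ps_cat C\<^esub> zpow Z i \<cdot>\<^bsub>ps_cat C\<^esub> ps_const (b j) \<cdot>\<^bsub>ps_cat C\<^esub> ps_const (a i) =
      (zpow Z j \<cdot>\<^bsub>ps_cat C\<^esub> zpow Z i) \<cdot>\<^bsub>ps_cat C\<^esub> ps_const (b j) \<cdot>\<^bsub>ps_cat C\<^esub> ps_const (a i)"
    by (rule E.cmp_assoc[OF O(1,3,3,3) Tj Ti cba, symmetric])
  also have "\<dots> = zpow Z (j + i) \<cdot>\<^bsub>ps_cat C\<^esub> ps_const (b j \<cdot> a i)"
    unfolding ba E.mor_pow_add[OF O(3) zeps_in[OF assms(3)]] ..
  finally show ?thesis .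
qed

text \<open>The product of two partial sums runs over a square of index pairs, the partial sum of
  the product over the triangle j + i < k inside it. The difference is small, since each remaining
  pair has total filtration step at least \<open>k\<close>.\<close>

lemma substitutes_cmp:
  assumes "X \<in> Obj C" "Y \<in> Obj C" "Z \<in> Obj C"
    and "b \<in> Hom (ps_cat C) Y Z m" "a \<in> Hom (ps_cat C) X Y n"
    and s': "substitutes Y Z m b s'" and s: "substitutes X Y n a s"
  shows "substitutes X Z (m + n) (b \<cdot>\<^bsub>ps_cat C\<^esub> a) (s' \<cdot>\<^bsub>ps_cat C\<^esub> s)"
  unfolding substitutes_def
proof (intro conjI allI)
  have O: "X \<in> Obj (ps_cat C)" "Y \<in> Obj (ps_cat C)" "Z \<in> Obj (ps_cat C)" using assms by simp_all
  note s'_in = substitutes_in[OF s'] and s_in = substitutes_in[OF s]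
  show "s' \<cdot>\<^bsub>ps_cat C\<^esub> s \<in> Hom (ps_cat C) X Z (m + n)"
    by (rule E.cmp_in[OF O s'_in s_in])
  fix k :: nat
  let ?B = "subst_term Z b" and ?A = "subst_term Y a"
  let ?P = "\<lambda>j i. ?B j \<cdot>\<^bsub>ps_cat C\<^esub> ?A i"
  let ?T = "{(j, i). j + i < k}"
  have B: "?B j \<in> Hom (ps_cat C) Y Z m" "?B j \<in> ps_filt N j Y Z m" for j
    using subst_term_in subst_term_filt assms by blast+
  have A: "?A i \<in> Hom (ps_cat C) X Y n" "?A i \<in> ps_filt N i X Y n" for i
    using subst_term_in subst_term_filt assms by blast+
  have "(\<Sum>j<k. ?B j) \<cdot>\<^bsub>ps_cat C\<^esub> (\<Sum>i<k. ?A i) = (\<Sum>j<k. ?B j \<cdot>\<^bsub>ps_cat C\<^esub> (\<Sum>i<k. ?A i))"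
    by (rule E.cmp_sum_left[OF O B(1) E.hom_sum[OF O(1,2) A(1)]])
  also have "\<dots> = (\<Sum>j<k. \<Sum>i<k. ?P j i)"
    by (intro sum.cong refl E.cmp_sum_right[OF O B(1) A(1)])
  also have "\<dots> = (\<Sum>(j, i)\<in>{..<k} \<times> {..<k}. ?P j i)"
    by (rule sum.cartesian_product)
  also have "\<dots> = (\<Sum>(j, i)\<in>{..<k} \<times> {..<k} - ?T. ?P j i) + (\<Sum>(j, i)\<in>?T. ?P j i)"
    by (rule sum.subset_diff) auto
  finally have prod: "(\<Sum>j<k. ?B j) \<cdot>\<^bsub>ps_cat C\<^esub> (\<Sum>i<k. ?A i) - (\<Sum>(j, i)\<in>?T. ?P j i) =
      (\<Sum>(j, i)\<in>{..<k} \<times> {..<k} - ?T. ?P j i)"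
    by simp
  have "(\<Sum>(j, i)\<in>{..<k} \<times> {..<k} - ?T. ?P j i) \<in> ps_filt N k X Z (m + n)"
  proof (rule E.filt_sum[OF O(1,3)])
    fix x assume "x \<in> {..<k} \<times> {..<k} - ?T"
    then obtain j i where x: "x = (j, i)" "k \<le> j + i" by auto
    then show "(case x of (j, i) \<Rightarrow> ?P j i) \<in> ps_filt N k X Z (m + n)"
      using E.filt_mono[OF O(1,3) x(2) E.filt_cmp[OF O B(2) A(2)]] by simp
  qed
  then have "(\<Sum>j<k. ?B j) \<cdot>\<^bsub>ps_cat C\<^esub> (\<Sum>i<k. ?A i) - (\<Sum>(j, i)\<in>?T. ?P j i)
      \<in> ps_filt N k X Z (m + n)"
    by (simp only: prod)
  moreover have "s' \<cdot>\<^bsub>ps_cat C\<^esub> s - (\<Sum>j<k. ?B j) \<cdot>\<^bsub>ps_cat C\<^esub> (\<Sum>i<k. ?A i) \<in> ps_filt N k X Z (m + n)"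
    by (rule E.filt_cmp_cong[OF O s'_in E.hom_sum[OF O(2,3) B(1)] s_in E.hom_sum[OF O(1,2) A(1)]])
      (use s s' in \<open>simp_all add: substitutes_def\<close>)
  ultimately have "s' \<cdot>\<^bsub>ps_cat C\<^esub> s - (\<Sum>(j, i)\<in>?T. ?P j i) \<in> ps_filt N k X Z (m + n)"
    using E.filt_trans[OF O(1,3)] by blast
  \<comment> \<open>On the diagonal j + i = l the power of z + \<epsilon> is constant and factors
    out, leaving coefficient \<open>l\<close> of the composed series.\<close>
  moreover have "(\<Sum>(j, i)\<in>?T. ?P j i) = (\<Sum>l<k. subst_term Z (b \<cdot>\<^bsub>ps_cat C\<^esub> a) l)"
  proof -
    have "(\<Sum>j\<le>l. ?P j (l - j)) = subst_term Z (b \<cdot>\<^bsub>ps_cat C\<^esub> a) l" for l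
    proof -
      have c: "ps_const (b j \<cdot> a (l - j)) \<in> Hom (ps_cat C) X Z (m + n - 2 * int l)" if "j \<le> l" for j
      proof (rule ps_const_in[OF assms(1,3)])
        have "b j \<cdot> a (l - j) \<in> Hom C X Z (m - 2 * int j + (n - 2 * int (l - j)))"
          by (rule cmp_in[OF assms(1-3)]) (use assms(4,5) in \<open>simp_all del: of_nat_diff\<close>)
        also have "m - 2 * int j + (n - 2 * int (l - j)) = m + n - 2 * int l"
          using that by (simp add: of_nat_diff)
        finally show "b j \<cdot> a (l - j) \<in> Hom C X Z (m + n - 2 * int l)" .
      qed
      have "(\<Sum>j\<le>l. ?P j (l - j)) = (\<Sum>j\<le>l. zpow Z l \<cdot>\<^bsub>ps_cat C\<^esub> ps_const (b j \<cdot> a (l - j)))"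
        by (intro sum.cong refl) (simp add: subst_term_cmp[OF assms(1-5)])
      also have "\<dots> = zpow Z l \<cdot>\<^bsub>ps_cat C\<^esub> (\<Sum>j\<le>l. ps_const (b j \<cdot> a (l - j)))"
        by (rule E.cmp_sum_right[OF O(1,3,3) zpow_in[OF assms(3)] c, symmetric]) simp
      finally show ?thesis
        by (simp only: subst_term_def ps_cat_simps(5) ps_const_sum)
    qed
    then show ?thesis
      by (simp only: sum.triangle_reindex)
  qed
  ultimately show "s' \<cdot>\<^bsub>ps_cat C\<^esub> s - (\<Sum>l<k. subst_term Z (b \<cdot>\<^bsub>ps_cat C\<^esub> a) l)
      \<in> ps_filt N k X Z (m + n)"
    by simp
qed

section \<open>The equations after substitution\<close>

lemma closed_central_zeps: "closed_central2 (ps_cat C) (z_plus_eps C z)"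
  unfolding closed_central2_def ps_cat_simps(1)
  using zeps_in dif_zeps zeps_commute by blast

lemma closed_central_eps: "closed_central2 (ps_cat C) eps"
  unfolding closed_central2_def ps_cat_simps(1)
  using eps_in dif_eps eps_cmp cmp_eps by (metis (no_types, lifting))

text \<open>Both sides of each equation are limits for one and the same substituted series, because
  substitution respects composition, differences, identities and d; and limits are unique.\<close>

lemma substitutes_strong_homotopy_equiv:
  assumes she: "strong_homotopy_equiv C X Y f' g' h' k'"
    and f: "substitutes X Y 0 f' f" and g: "substitutes Y X 0 g' g"
    and h: "substitutes X X (- 1) h' h" and k: "substitutes Y Y (- 1) k' k"
  shows "dif (ps_cat C) X Y 0 f = zeps Y \<cdot>\<^bsub>ps_cat C\<^esub> (f \<cdot>\<^bsub>ps_cat C\<^esub> h - k \<cdot>\<^bsub>ps_cat C\<^esub> f)"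
    and "dif (ps_cat C) Y X 0 g = zeps X \<cdot>\<^bsub>ps_cat C\<^esub> (g \<cdot>\<^bsub>ps_cat C\<^esub> k - h \<cdot>\<^bsub>ps_cat C\<^esub> g)"
    and "dif (ps_cat C) X X (- 1) h =
      ident (ps_cat C) X - g \<cdot>\<^bsub>ps_cat C\<^esub> f - zeps X \<cdot>\<^bsub>ps_cat C\<^esub> h \<cdot>\<^bsub>ps_cat C\<^esub> h"
    and "dif (ps_cat C) Y Y (- 1) k =
      ident (ps_cat C) Y - f \<cdot>\<^bsub>ps_cat C\<^esub> g - zeps Y \<cdot>\<^bsub>ps_cat C\<^esub> k \<cdot>\<^bsub>ps_cat C\<^esub> k"
proof -
  note she' = she[unfolded strong_homotopy_equiv_def Let_def]
  have O: "X \<in> Obj C" "Y \<in> Obj C"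
    and f': "f' \<in> Hom (ps_cat C) X Y 0" and g': "g' \<in> Hom (ps_cat C) Y X 0"
    and h': "h' \<in> Hom (ps_cat C) X X (- 1)" and k': "k' \<in> Hom (ps_cat C) Y Y (- 1)"
    and eqs: "dif (ps_cat C) X Y 0 f' = eps_mult (f' \<cdot>\<^bsub>ps_cat C\<^esub> h' - k' \<cdot>\<^bsub>ps_cat C\<^esub> f')"
      "dif (ps_cat C) Y X 0 g' = eps_mult (g' \<cdot>\<^bsub>ps_cat C\<^esub> k' - h' \<cdot>\<^bsub>ps_cat C\<^esub> g')"
      "dif (ps_cat C) X X (- 1) h' =
        ident (ps_cat C) X - g' \<cdot>\<^bsub>ps_cat C\<^esub> f' - eps_mult (h' \<cdot>\<^bsub>ps_cat C\<^esub> h')"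
      "dif (ps_cat C) Y Y (- 1) k' =
        ident (ps_cat C) Y - f' \<cdot>\<^bsub>ps_cat C\<^esub> g' - eps_mult (k' \<cdot>\<^bsub>ps_cat C\<^esub> k')"
    using she' by blast+
  \<comment> \<open>Membership and substitution are proved together, since building a larger
    expression needs both for its parts.\<close>
  have comp: "v' \<cdot>\<^bsub>ps_cat C\<^esub> u' \<in> Hom (ps_cat C) U W n"
      "substitutes U W n (v' \<cdot>\<^bsub>ps_cat C\<^esub> u') (v \<cdot>\<^bsub>ps_cat C\<^esub> u)"
    if "substitutes V W m v' v" "substitutes U V l u' u" "v' \<in> Hom (ps_cat C) V W m"
      "u' \<in> Hom (ps_cat C) U V l" "n = m + l" "U \<in> Obj C" "V \<in> Obj C" "W \<in> Obj C"
    for U V W m l n v' v u' u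
    unfolding that(5)
    using substitutes_cmp[OF that(6-8,3,4,1,2)] E.cmp_in[of U V W v' m u' l] that
    by (simp_all del: ps_cat_simps(2,5))
  have epsm: "eps_mult u' \<in> Hom (ps_cat C) U V n"
      "substitutes U V n (eps_mult u') (zeps V \<cdot>\<^bsub>ps_cat C\<^esub> u)"
    if "substitutes U V m u' u" "u' \<in> Hom (ps_cat C) U V m" "n = m + 2" "U \<in> Obj C" "V \<in> Obj C"
    for U V m n u' u
    unfolding that(3) using substitutes_eps_mult[OF that(4,5,2,1)] eps_mult_in[OF that(4,5,2)] by simp_all
  have diff: "u' - v' \<in> Hom (ps_cat C) U V n" "substitutes U V n (u' - v') (u - v)"
    if "substitutes U V n u' u" "substitutes U V n v' v" "u' \<in> Hom (ps_cat C) U V n"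
      "v' \<in> Hom (ps_cat C) U V n" "U \<in> Obj C" "V \<in> Obj C" for U V n u' u v' v
    using substitutes_diff[OF that(5,6,3,4,1,2)] E.hom_diff[of U V u' n v'] that
    by (simp_all del: ps_cat_simps(2))
  have id': "ident (ps_cat C) U \<in> Hom (ps_cat C) U U 0" if "U \<in> Obj C" for U
    using E.ident_in that by simp
  have fh: "f' \<cdot>\<^bsub>ps_cat C\<^esub> h' \<in> Hom (ps_cat C) X Y (- 1)"
      "substitutes X Y (- 1) (f' \<cdot>\<^bsub>ps_cat C\<^esub> h') (f \<cdot>\<^bsub>ps_cat C\<^esub> h)"
    by (rule comp[OF f h f' h' _ O(1,1,2)]; simp)+
  have kf: "k' \<cdot>\<^bsub>ps_cat C\<^esub> f' \<in> Hom (ps_cat C) X Y (- 1)"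
      "substitutes X Y (- 1) (k' \<cdot>\<^bsub>ps_cat C\<^esub> f') (k \<cdot>\<^bsub>ps_cat C\<^esub> f)"
    by (rule comp[OF k f k' f' _ O(1,2,2)]; simp)+
  have gk: "g' \<cdot>\<^bsub>ps_cat C\<^esub> k' \<in> Hom (ps_cat C) Y X (- 1)"
      "substitutes Y X (- 1) (g' \<cdot>\<^bsub>ps_cat C\<^esub> k') (g \<cdot>\<^bsub>ps_cat C\<^esub> k)"
    by (rule comp[OF g k g' k' _ O(2,2,1)]; simp)+
  have hg: "h' \<cdot>\<^bsub>ps_cat C\<^esub> g' \<in> Hom (ps_cat C) Y X (- 1)"
      "substitutes Y X (- 1) (h' \<cdot>\<^bsub>ps_cat C\<^esub> g') (h \<cdot>\<^bsub>ps_cat C\<^esub> g)"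
    by (rule comp[OF h g h' g' _ O(2,1,1)]; simp)+
  have gf: "g' \<cdot>\<^bsub>ps_cat C\<^esub> f' \<in> Hom (ps_cat C) X X 0"
      "substitutes X X 0 (g' \<cdot>\<^bsub>ps_cat C\<^esub> f') (g \<cdot>\<^bsub>ps_cat C\<^esub> f)"
    by (rule comp[OF g f g' f' _ O(1,2,1)]; simp)+
  have hh: "h' \<cdot>\<^bsub>ps_cat C\<^esub> h' \<in> Hom (ps_cat C) X X (- 2)"
      "substitutes X X (- 2) (h' \<cdot>\<^bsub>ps_cat C\<^esub> h') (h \<cdot>\<^bsub>ps_cat C\<^esub> h)"
    by (rule comp[OF h h h' h' _ O(1,1,1)]; simp)+
  have fg: "f' \<cdot>\<^bsub>ps_cat C\<^esub> g' \<in> Hom (ps_cat C) Y Y 0"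
      "substitutes Y Y 0 (f' \<cdot>\<^bsub>ps_cat C\<^esub> g') (f \<cdot>\<^bsub>ps_cat C\<^esub> g)"
    by (rule comp[OF f g f' g' _ O(2,1,2)]; simp)+
  have kk: "k' \<cdot>\<^bsub>ps_cat C\<^esub> k' \<in> Hom (ps_cat C) Y Y (- 2)"
      "substitutes Y Y (- 2) (k' \<cdot>\<^bsub>ps_cat C\<^esub> k') (k \<cdot>\<^bsub>ps_cat C\<^esub> k)"
    by (rule comp[OF k k k' k' _ O(2,2,2)]; simp)+
  show "dif (ps_cat C) X Y 0 f = zeps Y \<cdot>\<^bsub>ps_cat C\<^esub> (f \<cdot>\<^bsub>ps_cat C\<^esub> h - k \<cdot>\<^bsub>ps_cat C\<^esub> f)"
  proof (rule substitutes_unique[OF O(1,2)])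
    show "substitutes X Y 1 (dif (ps_cat C) X Y 0 f') (dif (ps_cat C) X Y 0 f)"
      using substitutes_dif[OF O(1,2) f' f] by simp
    show "substitutes X Y 1 (dif (ps_cat C) X Y 0 f')
        (zeps Y \<cdot>\<^bsub>ps_cat C\<^esub> (f \<cdot>\<^bsub>ps_cat C\<^esub> h - k \<cdot>\<^bsub>ps_cat C\<^esub> f))"
      unfolding eqs
      by (rule epsm(2)[OF diff(2)[OF fh(2) kf(2) fh(1) kf(1) O] diff(1)[OF fh(2) kf(2) fh(1) kf(1) O] _ O]) simp
  qed
  show "dif (ps_cat C) Y X 0 g = zeps X \<cdot>\<^bsub>ps_cat C\<^esub> (g \<cdot>\<^bsub>ps_cat C\<^esub> k - h \<cdot>\<^bsub>ps_cat C\<^esub> g)"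
  proof (rule substitutes_unique[OF O(2,1)])
    show "substitutes Y X 1 (dif (ps_cat C) Y X 0 g') (dif (ps_cat C) Y X 0 g)"
      using substitutes_dif[OF O(2,1) g' g] by simp
    show "substitutes Y X 1 (dif (ps_cat C) Y X 0 g')
        (zeps X \<cdot>\<^bsub>ps_cat C\<^esub> (g \<cdot>\<^bsub>ps_cat C\<^esub> k - h \<cdot>\<^bsub>ps_cat C\<^esub> g))"
      unfolding eqs
      by (rule epsm(2)[OF diff(2)[OF gk(2) hg(2) gk(1) hg(1) O(2,1)] diff(1)[OF gk(2) hg(2) gk(1) hg(1) O(2,1)] _ O(2,1)]) simp
  qed
  have eh: "eps_mult (h' \<cdot>\<^bsub>ps_cat C\<^esub> h') \<in> Hom (ps_cat C) X X 0"
      "substitutes X X 0 (eps_mult (h' \<cdot>\<^bsub>ps_cat C\<^esub> h')) (zeps X \<cdot>\<^bsub>ps_cat C\<^esub> h \<cdot>\<^bsub>ps_cat C\<^esub> h)"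
    by (rule epsm[OF hh(2,1) _ O(1,1)]; simp)+
  show "dif (ps_cat C) X X (- 1) h = ident (ps_cat C) X - g \<cdot>\<^bsub>ps_cat C\<^esub> f - zeps X \<cdot>\<^bsub>ps_cat C\<^esub> h \<cdot>\<^bsub>ps_cat C\<^esub> h"
  proof (rule substitutes_unique[OF O(1,1)])
    show "substitutes X X 0 (dif (ps_cat C) X X (- 1) h') (dif (ps_cat C) X X (- 1) h)"
      using substitutes_dif[OF O(1,1) h' h] by simp
    show "substitutes X X 0 (dif (ps_cat C) X X (- 1) h')
        (ident (ps_cat C) X - g \<cdot>\<^bsub>ps_cat C\<^esub> f - zeps X \<cdot>\<^bsub>ps_cat C\<^esub> h \<cdot>\<^bsub>ps_cat C\<^esub> h)"
      unfolding eqs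
      by (rule diff(2)[OF diff(2)[OF substitutes_ident[OF O(1)] gf(2) id'[OF O(1)] gf(1) O(1,1)] eh(2) diff(1)[OF substitutes_ident[OF O(1)] gf(2) id'[OF O(1)] gf(1) O(1,1)] eh(1) O(1,1)])
  qed
  have ek: "eps_mult (k' \<cdot>\<^bsub>ps_cat C\<^esub> k') \<in> Hom (ps_cat C) Y Y 0"
      "substitutes Y Y 0 (eps_mult (k' \<cdot>\<^bsub>ps_cat C\<^esub> k')) (zeps Y \<cdot>\<^bsub>ps_cat C\<^esub> k \<cdot>\<^bsub>ps_cat C\<^esub> k)"
    by (rule epsm[OF kk(2,1) _ O(2,2)]; simp)+
  show "dif (ps_cat C) Y Y (- 1) k = ident (ps_cat C) Y - f \<cdot>\<^bsub>ps_cat C\<^esub> g - zeps Y \<cdot>\<^bsub>ps_cat C\<^esub> k \<cdot>\<^bsub>ps_cat C\<^esub> k"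
  proof (rule substitutes_unique[OF O(2,2)])
    show "substitutes Y Y 0 (dif (ps_cat C) Y Y (- 1) k') (dif (ps_cat C) Y Y (- 1) k)"
      using substitutes_dif[OF O(2,2) k' k] by simp
    show "substitutes Y Y 0 (dif (ps_cat C) Y Y (- 1) k')
        (ident (ps_cat C) Y - f \<cdot>\<^bsub>ps_cat C\<^esub> g - zeps Y \<cdot>\<^bsub>ps_cat C\<^esub> k \<cdot>\<^bsub>ps_cat C\<^esub> k)"
      unfolding eqs
      by (rule diff(2)[OF diff(2)[OF substitutes_ident[OF O(2)] fg(2) id'[OF O(2)] fg(1) O(2,2)] ek(2) diff(1)[OF substitutes_ident[OF O(2)] fg(2) id'[OF O(2)] fg(1) O(2,2)] ek(1) O(2,2)])
  qed
qed

end


section \<open>The perturbation identities\<close>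

text \<open>Composition of maps from the left distributes over pointwise addition only for additive maps.\<close>

locale operator_ring =
  fixes R :: "'a::ab_group_add set"
    and mult :: "'a \<Rightarrow> 'a \<Rightarrow> 'a"  (infixr \<open>\<odot>\<close> 75)
  assumes R_zero: "0 \<in> R"
    and R_add: "\<lbrakk>x \<in> R; y \<in> R\<rbrakk> \<Longrightarrow> x + y \<in> R"
    and R_uminus: "x \<in> R \<Longrightarrow> - x \<in> R"
    and R_mult: "\<lbrakk>x \<in> R; y \<in> R\<rbrakk> \<Longrightarrow> x \<odot> y \<in> R"
    and assoc: "(x \<odot> y) \<odot> w = x \<odot> (y \<odot> w)"
    and add_mult: "(x + y) \<odot> w = x \<odot> w + y \<odot> w"
    and mult_add: "\<lbrakk>x \<in> R; y \<in> R; w \<in> R\<rbrakk> \<Longrightarrow> x \<odot> (y + w) = x \<odot> y + x \<odot> w"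
begin

lemma zero_mult: "0 \<odot> x = 0"
  using add_mult[of 0 0 x] by simp

lemma mult_zero: "x \<in> R \<Longrightarrow> x \<odot> 0 = 0"
  using mult_add[of x 0 0] R_zero by simp

lemma uminus_mult: "(- x) \<odot> y = - (x \<odot> y)"
  using add_mult[of x "- x" y] zero_mult by (simp add: eq_neg_iff_add_eq_0 add.commute)

lemma mult_uminus: "\<lbrakk>x \<in> R; y \<in> R\<rbrakk> \<Longrightarrow> x \<odot> (- y) = - (x \<odot> y)"
  using mult_add[of x y "- y"] R_uminus mult_zero
  by (simp add: eq_neg_iff_add_eq_0 add.commute)

lemma R_diff: "\<lbrakk>x \<in> R; y \<in> R\<rbrakk> \<Longrightarrow> x - y \<in> R"
  using R_add[of x "- y"] R_uminus by simp

lemma diff_mult: "(x - y) \<odot> w = x \<odot> w - y \<odot> w"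
  using add_mult[of x "- y" w] by (simp add: uminus_mult)

lemma mult_diff: "\<lbrakk>x \<in> R; y \<in> R; w \<in> R\<rbrakk> \<Longrightarrow> x \<odot> (y - w) = x \<odot> y - x \<odot> w"
  using mult_add[of x y "- w"] R_uminus by (simp add: mult_uminus)

lemmas R_closed = R_zero R_add R_uminus R_mult R_diff

lemmas expand = assoc add_mult diff_mult uminus_mult mult_add mult_diff mult_uminus

text \<open>Products are kept bracketed to the right, where a rule for x y does not match inside x
  (y w). Each rule is therefore accompanied by this continued form.\<close>

lemma assoc_rewrite: "x \<odot> y = u \<Longrightarrow> x \<odot> (y \<odot> w) = u \<odot> w"
  using assoc by metis

text \<open>\<open>P\<close> and \<open>Q\<close> stand for the identities of the two objects, and \<open>D\<close> for the differential, so that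
  the relations for \<open>D\<close> are those for the differentials of \<open>f\<close>, \<open>g\<close>, \<open>h\<close>, \<open>k\<close> and \<open>a\<close>.\<close>

lemma perturbation_identities:
  assumes R: "D \<in> R" "P \<in> R" "Q \<in> R" "t \<in> R" "t' \<in> R" "e \<in> R" "e' \<in> R"
      "f \<in> R" "g \<in> R" "h \<in> R" "k \<in> R" "a \<in> R" "A \<in> R" "B \<in> R"
    and unit: "P \<odot> A = A" "P \<odot> B = B" "P \<odot> t = t" "P \<odot> e = e" "P \<odot> h = h" "P \<odot> a = a"
      "A \<odot> P = A" "h \<odot> P = h" "a \<odot> P = a" "f \<odot> P = f" "P \<odot> g = g" "Q \<odot> f = f"
      "t \<odot> P = t" "e \<odot> P = e" "t' \<odot> Q = t'" "P \<odot> P = P"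
    and tcomm: "f \<odot> t = t' \<odot> f" "g \<odot> t' = t \<odot> g" "h \<odot> t = t \<odot> h" "k \<odot> t' = t' \<odot> k"
      "a \<odot> t = t \<odot> a" "A \<odot> t = t \<odot> A"
    and ecomm: "f \<odot> e = e' \<odot> f" "g \<odot> e' = e \<odot> g" "h \<odot> e = e \<odot> h" "k \<odot> e' = e' \<odot> k"
      "a \<odot> e = e \<odot> a" "A \<odot> e = e \<odot> A"
    and Dcomm: "D \<odot> P = P \<odot> D" "D \<odot> t = t \<odot> D" "D \<odot> t' = t' \<odot> D" "D \<odot> e = e \<odot> D"
      "D \<odot> e' = e' \<odot> D"
    and Df: "D \<odot> f = f \<odot> D + t' \<odot> (f \<odot> h - k \<odot> f)"
    and Dg: "D \<odot> g = g \<odot> D + t \<odot> (g \<odot> k - h \<odot> g)"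
    and Dh: "D \<odot> h = P - g \<odot> f - t \<odot> h \<odot> h - h \<odot> D"
    and Dk: "D \<odot> k = Q - f \<odot> g - t' \<odot> k \<odot> k - k \<odot> D"
    and Da: "D \<odot> a = t - e - a \<odot> a - a \<odot> D"
    and A: "A \<odot> (P + a \<odot> h) = P" "(P + a \<odot> h) \<odot> A = P"
    and B: "(P + h \<odot> a) \<odot> B = P"
    and F_def: "F = f \<odot> A" and G_def: "G = B \<odot> g" and H_def: "H = h \<odot> A"
    and S_def: "S = t' \<odot> k + f \<odot> a \<odot> B \<odot> g"
  shows "D \<odot> F - F \<odot> D + S \<odot> F - F \<odot> a = e' \<odot> F \<odot> H"
    and "D \<odot> G - G \<odot> D + a \<odot> G - G \<odot> S = - (e \<odot> H \<odot> G)"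
    and "D \<odot> H + H \<odot> D + a \<odot> H + H \<odot> a = P - G \<odot> F - e \<odot> H \<odot> H"
    and "D \<odot> S + S \<odot> D + S \<odot> S = t' - e' \<odot> F \<odot> G"
proof -
  note rules = expand unit tcomm ecomm Dcomm Df Dg Dh Dk Da R R_closed
    unit[THEN assoc_rewrite] tcomm[THEN assoc_rewrite] ecomm[THEN assoc_rewrite]
    Dcomm[THEN assoc_rewrite] Df[THEN assoc_rewrite] Dg[THEN assoc_rewrite]
    Dh[THEN assoc_rewrite] Dk[THEN assoc_rewrite] Da[THEN assoc_rewrite]
  \<comment> \<open>The equations for the inverse, oriented so that a h disappears next to A on
    either side.\<close>
  have Aah: "A \<odot> a \<odot> h = P - A"
    using A(1) by (simp add: rules algebra_simps)
  have ahA: "a \<odot> h \<odot> A = P - A"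
    using A(2) by (simp add: rules algebra_simps)
  note Aah' = assoc_rewrite[OF Aah, unfolded assoc] and ahA' = assoc_rewrite[OF ahA, unfolded assoc]
  \<comment> \<open>P - h A a is a left inverse of P + h a, so it equals the right inverse
    \<open>B\<close>. Only one inverse remains in the computation.\<close>
  have "P \<odot> B = (P - h \<odot> A \<odot> a) \<odot> (P + h \<odot> a) \<odot> B"
    by (simp add: rules Aah Aah' algebra_simps)
  also have "\<dots> = P - h \<odot> A \<odot> a"
    by (simp only: B) (simp add: rules)
  finally have B_eq: "B = P - h \<odot> A \<odot> a"
    by (simp only: unit)
  \<comment> \<open>Write u = P + a h, of degree 0. Commuting D past u in A D u A gives d(A) = - A
    d(u) A, where d(u) is the commutator of D and u.\<close>
  have "A \<odot> D \<odot> (P + a \<odot> h) \<odot> A = A \<odot> D"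
    by (simp only: A) (simp add: rules)
  moreover have "A \<odot> D \<odot> (P + a \<odot> h) \<odot> A =
      A \<odot> (P + a \<odot> h) \<odot> D \<odot> A + A \<odot> (D \<odot> (P + a \<odot> h) - (P + a \<odot> h) \<odot> D) \<odot> A"
    by (simp add: expand R R_closed)
  moreover have "A \<odot> (P + a \<odot> h) \<odot> D \<odot> A = D \<odot> A"
    unfolding assoc_rewrite[OF A(1)] using assoc_rewrite[OF Dcomm(1), of A] by (simp add: unit assoc)
  ultimately have DA: "D \<odot> A = A \<odot> D - A \<odot> (D \<odot> (P + a \<odot> h) - (P + a \<odot> h) \<odot> D) \<odot> A"
    by (simp add: algebra_simps)
  \<comment> \<open>In d(u) = d(a) h - a d(h), the terms t h + t a h h and - a - a a h are t u h and
    - a u. Their factor u cancels an adjacent \<open>A\<close>; the other terms keep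
    \<open>A\<close> on both sides.\<close>
  have "A \<odot> (D \<odot> (P + a \<odot> h) - (P + a \<odot> h) \<odot> D) \<odot> A =
      t \<odot> h \<odot> A - A \<odot> a - e \<odot> A \<odot> h \<odot> A + A \<odot> a \<odot> g \<odot> f \<odot> A"
    by (simp add: rules Aah ahA Aah' ahA' algebra_simps)
  with DA have DA: "D \<odot> A = A \<odot> D - t \<odot> h \<odot> A + A \<odot> a + e \<odot> A \<odot> h \<odot> A - A \<odot> a \<odot> g \<odot> f \<odot> A"
    by (simp add: algebra_simps)
  \<comment> \<open>With these orientations D moves right, t and e move left, and a h vanishes next
    to A, so both sides of each identity reach the same normal form.\<close>
  note rules' = rules Aah ahA Aah' ahA' DA DA[THEN assoc_rewrite]
    F_def G_def H_def S_def B_eq algebra_simps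
  show "D \<odot> F - F \<odot> D + S \<odot> F - F \<odot> a = e' \<odot> F \<odot> H"
    by (simp add: rules')
  show "D \<odot> G - G \<odot> D + a \<odot> G - G \<odot> S = - (e \<odot> H \<odot> G)"
    by (simp add: rules')
  show "D \<odot> H + H \<odot> D + a \<odot> H + H \<odot> a = P - G \<odot> F - e \<odot> H \<odot> H"
    by (simp add: rules')
  show "D \<odot> S + S \<odot> D + S \<odot> S = t' - e' \<odot> F \<odot> G"
    by (simp add: rules')
qed

end

text \<open>The morphisms and the differential of \<open>C\<close> act on the families \<open>\<phi>\<close> of morphisms \<open>\<phi> W Y n\<close> of
  degree \<open>n\<close> from \<open>W\<close> to \<open>Y\<close>. This action is faithful and turns identities between morphisms and
  their differentials into identities in one ring, where neither degrees nor signs occur.\<close>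

context dg_category
begin

definition families :: "('o \<Rightarrow> 'o \<Rightarrow> int \<Rightarrow> 'm) set" where
  "families = {\<phi>. \<forall>W\<in>Obj C. \<forall>Y\<in>Obj C. \<forall>n. \<phi> W Y n \<in> Hom C W Y n}"

text \<open>Additivity is required on \<open>families\<close> alone, since composition is additive
  only within hom sets; values are always families, so operators compose freely.\<close>

definition operators :: "(('o \<Rightarrow> 'o \<Rightarrow> int \<Rightarrow> 'm) \<Rightarrow> 'o \<Rightarrow> 'o \<Rightarrow> int \<Rightarrow> 'm) set" where
  "operators = {T. (\<forall>\<phi>. T \<phi> \<in> families) \<and>
     (\<forall>\<phi>\<in>families. \<forall>\<psi>\<in>families. T (\<phi> + \<psi>) = T \<phi> + T \<psi>)}"

text \<open>A morphism of degree \<open>m\<close> raises degrees by \<open>m\<close>, so degree n is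
  read off at n - m. The default 0 makes equal actions on families equal as functions.\<close>

definition mor_op ::
    "'o \<Rightarrow> 'o \<Rightarrow> int \<Rightarrow> 'm \<Rightarrow> ('o \<Rightarrow> 'o \<Rightarrow> int \<Rightarrow> 'm) \<Rightarrow> 'o \<Rightarrow> 'o \<Rightarrow> int \<Rightarrow> 'm" where
  "mor_op X Y m f \<phi> =
     (\<lambda>W Z n. if \<phi> \<in> families \<and> W \<in> Obj C \<and> Z = Y then f \<cdot> \<phi> W X (n - m) else 0)"

definition dif_op :: "('o \<Rightarrow> 'o \<Rightarrow> int \<Rightarrow> 'm) \<Rightarrow> 'o \<Rightarrow> 'o \<Rightarrow> int \<Rightarrow> 'm" where
  "dif_op \<phi> =
     (\<lambda>W Z n. if \<phi> \<in> families \<and> W \<in> Obj C \<and> Z \<in> Obj C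
        then dif C W Z (n - 1) (\<phi> W Z (n - 1)) else 0)"

lemma families_hom: "\<lbrakk>\<phi> \<in> families; W \<in> Obj C; Y \<in> Obj C\<rbrakk> \<Longrightarrow> \<phi> W Y n \<in> Hom C W Y n"
  by (simp add: families_def)

lemma families_add: "\<lbrakk>\<phi> \<in> families; \<psi> \<in> families\<rbrakk> \<Longrightarrow> \<phi> + \<psi> \<in> families"
  by (simp add: families_def hom_add)

lemma operator_ring: "operator_ring operators (\<circ>)"
proof
  show "0 \<in> operators"
    by (auto simp: operators_def families_def hom_zero)
  show "S + T \<in> operators" if "S \<in> operators" "T \<in> operators" for S T
    using that by (auto simp: operators_def families_add add_ac)
  show "- T \<in> operators" if "T \<in> operators" for T
    using that by (auto simp: operators_def families_def hom_uminus)
  show "S \<circ> T \<in> operators" if "S \<in> operators" "T \<in> operators" for S T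
    using that by (auto simp: operators_def)
  show "(S \<circ> T) \<circ> U = S \<circ> (T \<circ> U)" for S T U :: "('o \<Rightarrow> 'o \<Rightarrow> int \<Rightarrow> 'm) \<Rightarrow> 'o \<Rightarrow> 'o \<Rightarrow> int \<Rightarrow> 'm"
    by (rule o_assoc[symmetric])
  show "(S + T) \<circ> U = (S \<circ> U) + (T \<circ> U)" for S T U :: "('o \<Rightarrow> 'o \<Rightarrow> int \<Rightarrow> 'm) \<Rightarrow> 'o \<Rightarrow> 'o \<Rightarrow> int \<Rightarrow> 'm"
    by (rule ext) simp
  show "S \<circ> (T + U) = (S \<circ> T) + (S \<circ> U)" if "S \<in> operators" "T \<in> operators" "U \<in> operators" for S T U
    using that by (intro ext) (simp add: operators_def)
qed

lemma mor_op_families: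
  assumes "X \<in> Obj C" "Y \<in> Obj C" "f \<in> Hom C X Y m"
  shows "mor_op X Y m f \<phi> \<in> families"
proof -
  have "f \<cdot> \<phi> W X (n - m) \<in> Hom C W Y n" if "\<phi> \<in> families" "W \<in> Obj C" for W n
    using cmp_in[OF that(2) assms families_hom[OF that(1,2) assms(1)], of "n - m"] by simp
  then show ?thesis
    by (auto simp: families_def mor_op_def hom_zero)
qed

lemma mor_op_operators:
  assumes "X \<in> Obj C" "Y \<in> Obj C" "f \<in> Hom C X Y m"
  shows "mor_op X Y m f \<in> operators"
proof -
  have "f \<cdot> (\<phi> W X n + \<psi> W X n) = f \<cdot> \<phi> W X n + f \<cdot> \<psi> W X n"
    if "\<phi> \<in> families" "\<psi> \<in> families" "W \<in> Obj C" for W n \<phi> \<psi>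
    using cmp_add_right[OF that(3) assms families_hom[OF that(1,3) assms(1)]
        families_hom[OF that(2,3) assms(1)]] .
  then show ?thesis
    using mor_op_families[OF assms]
    by (auto simp: operators_def mor_op_def families_add fun_eq_iff)
qed

lemma dif_op_operators: "dif_op \<in> operators"
proof -
  have "dif C W Z (n - 1) (\<phi> W Z (n - 1)) \<in> Hom C W Z n"
    if "\<phi> \<in> families" "W \<in> Obj C" "Z \<in> Obj C" for \<phi> W Z n
    using dif_in[OF that(2,3) families_hom[OF that], of "n - 1"] by simp
  then have "dif_op \<phi> \<in> families" for \<phi>
    by (auto simp: dif_op_def families_def hom_zero)
  moreover have "dif_op (\<phi> + \<psi>) = dif_op \<phi> + dif_op \<psi>"
    if "\<phi> \<in> families" "\<psi> \<in> families" for \<phi> \<psi>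
    using that dif_add[OF _ _ families_hom[OF that(1)] families_hom[OF that(2)]]
    by (auto simp: dif_op_def families_add fun_eq_iff)
  ultimately show ?thesis
    by (simp add: operators_def)
qed

text \<open>An operator does not record source, target and degree. Keeping them alongside lets a
  composite expression be translated factor by factor, with the degrees as side conditions.\<close>

definition represents ::
    "'o \<Rightarrow> 'o \<Rightarrow> int \<Rightarrow> 'm \<Rightarrow> (('o \<Rightarrow> 'o \<Rightarrow> int \<Rightarrow> 'm) \<Rightarrow> 'o \<Rightarrow> 'o \<Rightarrow> int \<Rightarrow> 'm) \<Rightarrow> bool" where
  "represents X Y m f T \<longleftrightarrow>
     X \<in> Obj C \<and> Y \<in> Obj C \<and> f \<in> Hom C X Y m \<and> T = mor_op X Y m f"

lemma represents_mor_op: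
  "\<lbrakk>X \<in> Obj C; Y \<in> Obj C; f \<in> Hom C X Y m\<rbrakk> \<Longrightarrow> represents X Y m f (mor_op X Y m f)"
  by (simp add: represents_def)

lemma represents_hom: "represents X Y m f T \<Longrightarrow> f \<in> Hom C X Y m"
  by (simp add: represents_def)

lemma represents_operators: "represents X Y m f T \<Longrightarrow> T \<in> operators"
  using mor_op_operators by (auto simp: represents_def)

lemma represents_add:
  assumes "represents X Y m f S" "represents X Y m g T"
  shows "represents X Y m (f + g) (S + T)"
proof -
  note r = assms[unfolded represents_def]
  have "(f + g) \<cdot> \<phi> W X n = f \<cdot> \<phi> W X n + g \<cdot> \<phi> W X n"
    if "\<phi> \<in> families" "W \<in> Obj C" for W n \<phi>
    using cmp_add_left[OF that(2) _ _ _ _ families_hom] that r by blast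
  then show ?thesis
    using r hom_add by (auto simp: represents_def mor_op_def fun_eq_iff)
qed

lemma represents_uminus:
  assumes "represents X Y m f T"
  shows "represents X Y m (- f) (- T)"
proof -
  note r = assms[unfolded represents_def]
  have "(- f) \<cdot> \<phi> W X n = - (f \<cdot> \<phi> W X n)"
    if "\<phi> \<in> families" "W \<in> Obj C" for W n \<phi>
    using cmp_uminus_left[OF that(2) _ _ _ families_hom] that r by blast
  then show ?thesis
    using r hom_uminus by (auto simp: represents_def mor_op_def fun_eq_iff)
qed

lemma represents_diff:
  "\<lbrakk>represents X Y m f S; represents X Y m g T\<rbrakk> \<Longrightarrow> represents X Y m (f - g) (S - T)"
  using represents_add[OF _ represents_uminus, of X Y m f S g T] by simp

lemma represents_cmp:
  assumes "represents Y Z m g T" "represents X Y n f S" "l = m + n"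
  shows "represents X Z l (g \<cdot> f) (T \<circ> S)"
proof -
  from assms have O: "X \<in> Obj C" "Y \<in> Obj C" "Z \<in> Obj C"
    and g: "g \<in> Hom C Y Z m" and f: "f \<in> Hom C X Y n"
    and TS: "T = mor_op Y Z m g" "S = mor_op X Y n f"
    by (auto simp: represents_def)
  have "g \<cdot> f \<cdot> \<phi> W X (k - m - n) = (g \<cdot> f) \<cdot> \<phi> W X (k - l)"
    if "\<phi> \<in> families" "W \<in> Obj C" for \<phi> W k
    using cmp_assoc[OF that(2) O g f families_hom[OF that O(1)]] assms(3) by (simp add: algebra_simps)
  moreover have "g \<cdot> 0 = 0"
    using cmp_zero_right[OF O g] .
  ultimately have "T \<circ> S = mor_op X Z l (g \<cdot> f)"
    using mor_op_families[OF O(1,2) f] by (auto simp: TS mor_op_def[abs_def] fun_eq_iff)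
  then show ?thesis
    using cmp_in[OF O g f] O assms(3) by (simp add: represents_def)
qed

text \<open>The Leibniz rule solved for d(f), which becomes the graded commutator with the operator
  of the differential.\<close>

lemma represents_dif:
  assumes "represents X Y m f T" "l = m + 1"
  shows "represents X Y l (dif C X Y m f) ((dif_op \<circ> T) - ksign m (T \<circ> dif_op))"
proof -
  from assms have O: "X \<in> Obj C" "Y \<in> Obj C" and f: "f \<in> Hom C X Y m" and T: "T = mor_op X Y m f"
    by (auto simp: represents_def)
  have "(dif_op \<circ> T) \<phi> W Z n = mor_op X Y l (dif C X Y m f) \<phi> W Z n + ksign m ((T \<circ> dif_op) \<phi> W Z n)"
    for \<phi> W Z n
  proof (cases "\<phi> \<in> families \<and> W \<in> Obj C \<and> Z = Y")
    case True
    then have \<phi>: "\<phi> \<in> families" and W: "W \<in> Obj C" and Z: "Z = Y" by auto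
    \<comment> \<open>D reads degree n - 1 and the operator of \<open>f\<close> then n - 1 - m; the
      degree is written as m + (n - 1 - m) to fit the Leibniz rule.\<close>
    have "(dif_op \<circ> T) \<phi> W Z n = dif C W Y (m + (n - 1 - m)) (f \<cdot> \<phi> W X (n - 1 - m))"
      using \<phi> W Z O mor_op_families[OF O f, of \<phi>] by (simp add: dif_op_def T) (simp add: mor_op_def)
    also have "\<dots> = dif C X Y m f \<cdot> \<phi> W X (n - 1 - m)
        + ksign m (f \<cdot> dif C W X (n - 1 - m) (\<phi> W X (n - 1 - m)))"
      by (rule leibniz[OF W O f families_hom[OF \<phi> W O(1)]])
    also have "n - 1 - m = n - m - 1" by simp
    also have "f \<cdot> dif C W X (n - m - 1) (\<phi> W X (n - m - 1)) = (T \<circ> dif_op) \<phi> W Z n"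
      using \<phi> W Z O dif_op_operators by (simp add: T mor_op_def operators_def) (simp add: dif_op_def)
    also have "dif C X Y m f \<cdot> \<phi> W X (n - m - 1) = mor_op X Y l (dif C X Y m f) \<phi> W Z n"
      using \<phi> W Z assms(2) by (simp add: mor_op_def algebra_simps)
    finally show ?thesis .
  next
    case False
    \<comment> \<open>If \<open>\<phi>\<close> is not a family, \<open>dif_op\<close> returns 0,
      which is one; the operator of \<open>f\<close> then composes \<open>f\<close> with 0.\<close>
    moreover have "f \<cdot> 0 = 0" if "W \<in> Obj C" using cmp_zero_right[OF that O f] .
    ultimately show ?thesis
      by (auto simp: T mor_op_def[abs_def] dif_op_def[abs_def] ksign_def dif_zero)
  qed
  then have "dif_op \<circ> T = mor_op X Y l (dif C X Y m f) + ksign m (T \<circ> dif_op)"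
    by (auto simp: fun_eq_iff ksign_def)
  then show ?thesis
    using dif_in[OF O f] O assms(2) by (simp add: represents_def)
qed

lemma represents_inject:
  assumes "represents X Y m f T" "represents X Y m g T"
  shows "f = g"
proof -
  from assms have O: "X \<in> Obj C" "Y \<in> Obj C" and f: "f \<in> Hom C X Y m" and g: "g \<in> Hom C X Y m"
    and eq: "mor_op X Y m f = mor_op X Y m g"
    by (auto simp: represents_def)
  \<comment> \<open>On the family with the identity of \<open>X\<close> in degree 0 and zero
    elsewhere, the operator of a morphism returns the morphism itself.\<close>
  define \<phi> where "\<phi> = (\<lambda>W Z (n::int). if W = X \<and> Z = X \<and> n = 0 then ident C X else 0)"
  have "\<phi> \<in> families"
    by (auto simp: families_def \<phi>_def hom_zero ident_in)
  then have "mor_op X Y m u \<phi> X Y m = u \<cdot> ident C X" for u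
    using O by (simp add: mor_op_def \<phi>_def)
  then show ?thesis
    using eq ident_right[OF O f] ident_right[OF O g] by metis
qed

lemma represents_unique:
  "\<lbrakk>represents X Y m f S; represents X Y m g T; f = g\<rbrakk> \<Longrightarrow> S = T"
  by (simp add: represents_def)

lemma represents_zero: "\<lbrakk>X \<in> Obj C; Y \<in> Obj C\<rbrakk> \<Longrightarrow> represents X Y m 0 0"
  using represents_diff[OF represents_mor_op represents_mor_op, of X Y 0 m 0] hom_zero by simp

lemma closed_central_hom: "\<lbrakk>closed_central2 C t; X \<in> Obj C\<rbrakk> \<Longrightarrow> t X \<in> Hom C X X 2"
  by (simp add: closed_central2_def)

lemma closed_central_commute:
  "\<lbrakk>closed_central2 C t; X \<in> Obj C; Y \<in> Obj C; f \<in> Hom C X Y n\<rbrakk> \<Longrightarrow> f \<cdot> t X = t Y \<cdot> f"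
  unfolding closed_central2_def by metis

text \<open>Only the curvature equation of \<open>a\<close> ties \<open>t\<close> and
  \<open>e\<close> together; otherwise they are arbitrary closed central elements. Hypotheses are
  translated into relations between operators, and the resulting identities are read back by
  faithfulness.\<close>

lemma perturbation:
  assumes O: "X \<in> Obj C" "Y \<in> Obj C"
    and t: "closed_central2 C t" and e: "closed_central2 C e"
    and f: "f \<in> Hom C X Y 0" and g: "g \<in> Hom C Y X 0"
    and h: "h \<in> Hom C X X (- 1)" and k: "k \<in> Hom C Y Y (- 1)"
    and a: "a \<in> Hom C X X 1" and A: "A \<in> Hom C X X 0" and B: "B \<in> Hom C X X 0"
    and df: "dif C X Y 0 f = t Y \<cdot> (f \<cdot> h - k \<cdot> f)"
    and dg: "dif C Y X 0 g = t X \<cdot> (g \<cdot> k - h \<cdot> g)"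
    and dh: "dif C X X (- 1) h = ident C X - g \<cdot> f - t X \<cdot> h \<cdot> h"
    and dk: "dif C Y Y (- 1) k = ident C Y - f \<cdot> g - t Y \<cdot> k \<cdot> k"
    and da: "dif C X X 1 a + a \<cdot> a = t X - e X"
    and A_inv: "A \<cdot> (ident C X + a \<cdot> h) = ident C X" "(ident C X + a \<cdot> h) \<cdot> A = ident C X"
    and B_inv: "(ident C X + h \<cdot> a) \<cdot> B = ident C X"
    and F: "F = f \<cdot> A" and G: "G = B \<cdot> g" and H: "H = h \<cdot> A"
    and S: "S = t Y \<cdot> k + f \<cdot> a \<cdot> B \<cdot> g"
  shows "F \<in> Hom C X Y 0" "G \<in> Hom C Y X 0" "H \<in> Hom C X X (- 1)" "S \<in> Hom C Y Y 1"
    and "dif C X Y 0 F + S \<cdot> F - F \<cdot> a = e Y \<cdot> F \<cdot> H"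
    and "dif C Y X 0 G + a \<cdot> G - G \<cdot> S = - (e X \<cdot> H \<cdot> G)"
    and "dif C X X (- 1) H + a \<cdot> H + H \<cdot> a = ident C X - G \<cdot> F - e X \<cdot> H \<cdot> H"
    and "dif C Y Y 1 S + S \<cdot> S = t Y - e Y \<cdot> F \<cdot> G"
proof -
  define D where "D = dif_op"
  define P Q where "P = mor_op X X 0 (ident C X)" and "Q = mor_op Y Y 0 (ident C Y)"
  define tX tY eX eY where "tX = mor_op X X 2 (t X)" and "tY = mor_op Y Y 2 (t Y)"
    and "eX = mor_op X X 2 (e X)" and "eY = mor_op Y Y 2 (e Y)"
  define rf rg rh rk ra rA rB where "rf = mor_op X Y 0 f" and "rg = mor_op Y X 0 g"
    and "rh = mor_op X X (- 1) h" and "rk = mor_op Y Y (- 1) k" and "ra = mor_op X X 1 a"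
    and "rA = mor_op X X 0 A" and "rB = mor_op X X 0 B"
  define rF rG rH rS where "rF = rf \<circ> rA" and "rG = rB \<circ> rg" and "rH = rh \<circ> rA"
    and "rS = (tY \<circ> rk) + (rf \<circ> (ra \<circ> (rB \<circ> rg)))"
  have P: "represents X X 0 (ident C X) P" and Q: "represents Y Y 0 (ident C Y) Q"
    and tX: "represents X X 2 (t X) tX" and tY: "represents Y Y 2 (t Y) tY"
    and eX: "represents X X 2 (e X) eX" and eY: "represents Y Y 2 (e Y) eY"
    and rf: "represents X Y 0 f rf" and rg: "represents Y X 0 g rg"
    and rh: "represents X X (- 1) h rh" and rk: "represents Y Y (- 1) k rk"
    and ra: "represents X X 1 a ra" and rA: "represents X X 0 A rA" and rB: "represents X X 0 B rB"
    unfolding P_def Q_def tX_def tY_def eX_def eY_def rf_def rg_def rh_def rk_def ra_def rA_def rB_def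
    by (intro represents_mor_op O f g h k a A B ident_in closed_central_hom t e)+
  note cmp = represents_cmp and unique = represents_unique
  have left: "mor_op V V 0 (ident C V) \<circ> T = T" if "represents U V n u T" for U V n u T
    using that ident_left[of U V u n] ident_in[of V]
    by (intro unique[OF cmp[OF represents_mor_op that] that]) (auto simp: represents_def)
  have right: "T \<circ> mor_op U U 0 (ident C U) = T" if "represents U V n u T" for U V n u T
    using that ident_right[of U V u n] ident_in[of U]
    by (intro unique[OF cmp[OF that represents_mor_op] that]) (auto simp: represents_def)
  have central: "T \<circ> mor_op U U 2 (s U) = mor_op V V 2 (s V) \<circ> T"
    if "represents U V n u T" "closed_central2 C s" for U V n u T s
  proof -
    have O': "U \<in> Obj C" "V \<in> Obj C" "u \<in> Hom C U V n"
      using that(1) by (auto simp: represents_def)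
    show ?thesis
      using closed_central_commute[OF that(2) O'] closed_central_hom[OF that(2)] O'
      by (intro unique[OF cmp[OF that(1) represents_mor_op] cmp[OF represents_mor_op that(1)]]) auto
  qed
  \<comment> \<open>In even degree the graded commutator has no extra sign, so being closed means
    commuting with D.\<close>
  have closed: "D \<circ> mor_op U U n u = mor_op U U n u \<circ> D"
    if "U \<in> Obj C" "u \<in> Hom C U U n" "dif C U U n u = 0" "even n" for U n u
  proof -
    have "(D \<circ> mor_op U U n u) - ksign n (mor_op U U n u \<circ> D) = 0"
      unfolding D_def using that
      by (intro unique[OF represents_dif[OF represents_mor_op] represents_zero]) auto
    then show ?thesis using that(4) by (simp add: ksign_def)
  qed
  have ops: "D \<in> operators" "P \<in> operators" "Q \<in> operators" "tX \<in> operators" "tY \<in> operators"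
    "eX \<in> operators" "eY \<in> operators" "rf \<in> operators" "rg \<in> operators" "rh \<in> operators"
    "rk \<in> operators" "ra \<in> operators" "rA \<in> operators" "rB \<in> operators"
    using P Q tX tY eX eY rf rg rh rk ra rA rB represents_operators dif_op_operators
    unfolding D_def by blast+
  have unit': "P \<circ> rA = rA" "P \<circ> rB = rB" "P \<circ> tX = tX" "P \<circ> eX = eX" "P \<circ> rh = rh" "P \<circ> ra = ra"
    "rA \<circ> P = rA" "rh \<circ> P = rh" "ra \<circ> P = ra" "rf \<circ> P = rf" "P \<circ> rg = rg" "Q \<circ> rf = rf"
    "tX \<circ> P = tX" "eX \<circ> P = eX" "tY \<circ> Q = tY"
    unfolding P_def Q_def by (rule left right, fact)+
  have "P \<circ> P = P"
    using left[OF P] by (simp add: P_def)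
  note unit = unit' this
  have tcomm: "rf \<circ> tX = tY \<circ> rf" "rg \<circ> tY = tX \<circ> rg" "rh \<circ> tX = tX \<circ> rh" "rk \<circ> tY = tY \<circ> rk"
    "ra \<circ> tX = tX \<circ> ra" "rA \<circ> tX = tX \<circ> rA"
    unfolding tX_def tY_def by (rule central[OF _ t], fact)+
  have ecomm: "rf \<circ> eX = eY \<circ> rf" "rg \<circ> eY = eX \<circ> rg" "rh \<circ> eX = eX \<circ> rh" "rk \<circ> eY = eY \<circ> rk"
    "ra \<circ> eX = eX \<circ> ra" "rA \<circ> eX = eX \<circ> rA"
    unfolding eX_def eY_def by (rule central[OF _ e], fact)+
  have Dcomm: "D \<circ> P = P \<circ> D" "D \<circ> tX = tX \<circ> D" "D \<circ> tY = tY \<circ> D" "D \<circ> eX = eX \<circ> D"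
    "D \<circ> eY = eY \<circ> D"
    unfolding P_def tX_def tY_def eX_def eY_def using O t e
    by (auto intro!: closed simp: dif_ident ident_in closed_central2_def)
  have "(D \<circ> rf) - ksign 0 (rf \<circ> D) = tY \<circ> ((rf \<circ> rh) - (rk \<circ> rf))"
    unfolding D_def
    by (rule unique[OF represents_dif[OF rf]
          cmp[OF tY represents_diff[OF cmp[OF rf rh] cmp[OF rk rf]]] df]) simp_all
  then have Df: "D \<circ> rf = (rf \<circ> D) + (tY \<circ> ((rf \<circ> rh) - (rk \<circ> rf)))"
    by (simp add: ksign_def algebra_simps)
  have "(D \<circ> rg) - ksign 0 (rg \<circ> D) = tX \<circ> ((rg \<circ> rk) - (rh \<circ> rg))"
    unfolding D_def
    by (rule unique[OF represents_dif[OF rg]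
          cmp[OF tX represents_diff[OF cmp[OF rg rk] cmp[OF rh rg]]] dg]) simp_all
  then have Dg: "D \<circ> rg = (rg \<circ> D) + (tX \<circ> ((rg \<circ> rk) - (rh \<circ> rg)))"
    by (simp add: ksign_def algebra_simps)
  \<comment> \<open>In odd degree the graded commutator is an anticommutator, which puts a minus
    sign before \<open>rh \<circ> D\<close> once solved for \<open>D \<circ> rh\<close>.\<close>
  have "(D \<circ> rh) - ksign (- 1) (rh \<circ> D) = P - (rg \<circ> rf) - (tX \<circ> (rh \<circ> rh))"
    unfolding D_def
    by (rule unique[OF represents_dif[OF rh]
          represents_diff[OF represents_diff[OF P cmp[OF rg rf]] cmp[OF tX cmp[OF rh rh refl]]] dh]) simp_all
  then have Dh: "D \<circ> rh = P - (rg \<circ> rf) - (tX \<circ> (rh \<circ> rh)) - (rh \<circ> D)"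
    by (simp add: ksign_def algebra_simps)
  have "(D \<circ> rk) - ksign (- 1) (rk \<circ> D) = Q - (rf \<circ> rg) - (tY \<circ> (rk \<circ> rk))"
    unfolding D_def
    by (rule unique[OF represents_dif[OF rk]
          represents_diff[OF represents_diff[OF Q cmp[OF rf rg]] cmp[OF tY cmp[OF rk rk refl]]] dk]) simp_all
  then have Dk: "D \<circ> rk = Q - (rf \<circ> rg) - (tY \<circ> (rk \<circ> rk)) - (rk \<circ> D)"
    by (simp add: ksign_def algebra_simps)
  have "((D \<circ> ra) - ksign 1 (ra \<circ> D)) + (ra \<circ> ra) = tX - eX"
    unfolding D_def
    by (rule unique[OF represents_add[OF represents_dif[OF ra] cmp[OF ra ra]]
          represents_diff[OF tX eX] da]) simp_all
  then have Da: "D \<circ> ra = tX - eX - (ra \<circ> ra) - (ra \<circ> D)"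
    by (simp add: ksign_def algebra_simps)
  have rA_inv: "rA \<circ> (P + (ra \<circ> rh)) = P" "(P + (ra \<circ> rh)) \<circ> rA = P"
    by (rule unique[OF cmp[OF rA represents_add[OF P cmp[OF ra rh]]] P A_inv(1)]
        unique[OF cmp[OF represents_add[OF P cmp[OF ra rh]] rA] P A_inv(2)]; simp)+
  have rB_inv: "(P + (rh \<circ> ra)) \<circ> rB = P"
    by (rule unique[OF cmp[OF represents_add[OF P cmp[OF rh ra]] rB] P B_inv]) simp_all
  note identities = operator_ring.perturbation_identities[OF operator_ring,
      where D = D and P = P and Q = Q and t = tX and t' = tY and e = eX and e' = eY and f = rf
        and g = rg and h = rh and k = rk and a = ra and A = rA and B = rB and F = rF and G = rG
        and H = rH and S = rS,
      OF ops unit tcomm ecomm Dcomm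
      Df Dg Dh Dk Da rA_inv rB_inv rF_def rG_def rH_def rS_def]
  have rF: "represents X Y 0 F rF" unfolding F rF_def by (rule cmp[OF rf rA]) simp
  have rG: "represents Y X 0 G rG" unfolding G rG_def by (rule cmp[OF rB rg]) simp
  have rH: "represents X X (- 1) H rH" unfolding H rH_def by (rule cmp[OF rh rA]) simp
  have rS: "represents Y Y 1 S rS" unfolding S rS_def
    by (rule represents_add[OF cmp[OF tY rk] cmp[OF rf cmp[OF ra cmp[OF rB rg]]]]) simp_all
  show "F \<in> Hom C X Y 0" "G \<in> Hom C Y X 0" "H \<in> Hom C X X (- 1)" "S \<in> Hom C Y Y 1"
    using rF rG rH rS by (auto dest: represents_hom)
  have eqI: "u = v" if "represents U V n u T" "represents U V n v T'" "T = T'" for U V n u v T T'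
    using represents_inject that by blast
  show "dif C X Y 0 F + S \<cdot> F - F \<cdot> a = e Y \<cdot> F \<cdot> H"
  proof (rule eqI)
    show "represents X Y 1 (dif C X Y 0 F + S \<cdot> F - F \<cdot> a)
        (((D \<circ> rF) - ksign 0 (rF \<circ> D)) + (rS \<circ> rF) - (rF \<circ> ra))"
      unfolding D_def
      by (rule represents_diff[OF represents_add[OF represents_dif[OF rF] cmp[OF rS rF]]
            cmp[OF rF ra]]) simp_all
    show "represents X Y 1 (e Y \<cdot> F \<cdot> H) (eY \<circ> (rF \<circ> rH))"
      by (rule cmp[OF eY cmp[OF rF rH refl]]) simp_all
  qed (use identities(1) in \<open>simp add: ksign_def\<close>)
  show "dif C Y X 0 G + a \<cdot> G - G \<cdot> S = - (e X \<cdot> H \<cdot> G)"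
  proof (rule eqI)
    show "represents Y X 1 (dif C Y X 0 G + a \<cdot> G - G \<cdot> S)
        (((D \<circ> rG) - ksign 0 (rG \<circ> D)) + (ra \<circ> rG) - (rG \<circ> rS))"
      unfolding D_def
      by (rule represents_diff[OF represents_add[OF represents_dif[OF rG] cmp[OF ra rG]]
            cmp[OF rG rS]]) simp_all
    show "represents Y X 1 (- (e X \<cdot> H \<cdot> G)) (- (eX \<circ> (rH \<circ> rG)))"
      by (rule represents_uminus[OF cmp[OF eX cmp[OF rH rG refl]]]) simp_all
  qed (use identities(2) in \<open>simp add: ksign_def\<close>)
  show "dif C X X (- 1) H + a \<cdot> H + H \<cdot> a = ident C X - G \<cdot> F - e X \<cdot> H \<cdot> H"
  proof (rule eqI)
    show "represents X X 0 (dif C X X (- 1) H + a \<cdot> H + H \<cdot> a)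
        (((D \<circ> rH) - ksign (- 1) (rH \<circ> D)) + (ra \<circ> rH) + (rH \<circ> ra))"
      unfolding D_def
      by (rule represents_add[OF represents_add[OF represents_dif[OF rH] cmp[OF ra rH]]
            cmp[OF rH ra]]) simp_all
    show "represents X X 0 (ident C X - G \<cdot> F - e X \<cdot> H \<cdot> H) (P - (rG \<circ> rF) - (eX \<circ> (rH \<circ> rH)))"
      by (rule represents_diff[OF represents_diff[OF P cmp[OF rG rF]] cmp[OF eX cmp[OF rH rH refl]]])
        simp_all
  qed (use identities(3) in \<open>simp add: ksign_def\<close>)
  show "dif C Y Y 1 S + S \<cdot> S = t Y - e Y \<cdot> F \<cdot> G"
  proof (rule eqI)
    show "represents Y Y 2 (dif C Y Y 1 S + S \<cdot> S) (((D \<circ> rS) - ksign 1 (rS \<circ> D)) + (rS \<circ> rS))"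
      unfolding D_def
      by (rule represents_add[OF represents_dif[OF rS] cmp[OF rS rS]]) simp_all
    show "represents Y Y 2 (t Y - e Y \<cdot> F \<cdot> G) (tY - (eY \<circ> (rF \<circ> rG)))"
      by (rule represents_diff[OF tY cmp[OF eY cmp[OF rF rG refl]]]) simp_all
  qed (use identities(4) in \<open>simp add: ksign_def\<close>)
qed

end


section \<open>Curved twisted complexes with central curvature\<close>

context dg_category
begin

text \<open>Morphisms of curved twisted complexes must intertwine the curvatures; for a central
  curvature all morphisms do.\<close>

lemma hom_ps_cTw:
  assumes "closed_central2 C z" "X \<in> Obj C" "Y \<in> Obj C"
  shows "f \<in> Hom (ps_cat (cTw C)) (X, \<alpha>, z X) (Y, \<beta>, z Y) n \<longleftrightarrow> f \<in> Hom (ps_cat C) X Y n"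
proof -
  have "z Y \<cdot> u = u \<cdot> z X" if "u \<in> Hom C X Y m" for u m
    using closed_central_commute[OF assms that] by simp
  then show ?thesis
    by (auto simp: cTw_def)
qed

lemma cmp_ps_cTw: "cmp (ps_cat (cTw C)) = cmp (ps_cat C)"
  by (simp add: ps_cat_def cTw_def)

lemma ident_ps_cTw: "ident (ps_cat (cTw C)) (X, \<alpha>, w) = ident (ps_cat C) X"
  by (simp add: cTw_def)

lemma dif_ps_cTw:
  assumes "X \<in> Obj C" "Y \<in> Obj C" "\<alpha> \<in> Hom C X X 1" "\<beta> \<in> Hom C Y Y 1" "f \<in> Hom (ps_cat C) X Y n"
  shows "dif (ps_cat (cTw C)) (X, \<alpha>, w) (Y, \<beta>, v) n f =
    dif (ps_cat C) X Y n f + ps_const \<beta> \<cdot>\<^bsub>ps_cat C\<^esub> f - ksign n (f \<cdot>\<^bsub>ps_cat C\<^esub> ps_const \<alpha>)"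
proof
  fix i
  have "ksign (n - 2 * int i) u = ksign n u" for u :: 'm
    by (rule ksign_cong) simp
  then show "dif (ps_cat (cTw C)) (X, \<alpha>, w) (Y, \<beta>, v) n f i =
    (dif (ps_cat C) X Y n f + ps_const \<beta> \<cdot>\<^bsub>ps_cat C\<^esub> f - ksign n (f \<cdot>\<^bsub>ps_cat C\<^esub> ps_const \<alpha>)) i"
    using ps_const_cmp[OF assms(1,2,2,4,5), of i] cmp_ps_const[OF assms(1,1,2,5,3), of i]
    by (simp add: cTw_def ksign_apply del: ps_cat_simps(5))
qed

end

lemma eps_mult_diff: "eps_mult (f - g) = eps_mult f - (eps_mult g :: nat \<Rightarrow> 'a::ab_group_add)"
  by (rule ext) (simp add: eps_mult_def split: nat.split)

lemma eps_mult_add: "eps_mult (f + g) = eps_mult f + (eps_mult g :: nat \<Rightarrow> 'a::ab_group_add)"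
  by (rule ext) (simp add: eps_mult_def split: nat.split)

text \<open>Multiplication by \<epsilon> is injective on series and leaves no constant term. One
  equation between series thus yields one for \<beta> and one for \<open>K\<close>.\<close>

lemma const_plus_eps_inject:
  assumes "ps_const a + eps_mult f = ps_const b + (eps_mult g :: nat \<Rightarrow> 'a::ab_group_add)"
  shows "a = b" "f = g"
proof -
  show "a = b"
    using fun_cong[OF assms, of 0] by (simp add: ps_const_def)
  show "f = g"
  proof
    show "f i = g i" for i
      using fun_cong[OF assms, of "Suc i"] by (simp add: ps_const_def)
  qed
qed

context subst_category
begin

interpretation E: filtered_dg_category "ps_cat C" "ps_filt N"
  by (rule filtered_ps_cat)

text \<open>Splitting \<open>S\<close> into \<open>\<beta>\<close> and \<open>\<epsilon>K\<close> turns the four perturbation identities into those of a strong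
  homotopy equivalence of curved twisted complexes; the last one contains both the curvature of \<open>\<beta>\<close>
  (its constant term) and the equation for \<open>K\<close>.\<close>

lemma curved_strong_homotopy_equiv:
  assumes O: "X \<in> Obj C" "Y \<in> Obj C" and \<alpha>: "(X, \<alpha>, z X) \<in> Obj (cTw C)"
    and F: "F \<in> Hom (ps_cat C) X Y 0" and G: "G \<in> Hom (ps_cat C) Y X 0"
    and H: "H \<in> Hom (ps_cat C) X X (- 1)" and S: "S \<in> Hom (ps_cat C) Y Y 1"
    and dF: "dif (ps_cat C) X Y 0 F + S \<cdot>\<^bsub>ps_cat C\<^esub> F - F \<cdot>\<^bsub>ps_cat C\<^esub> ps_const \<alpha> =
      eps Y \<cdot>\<^bsub>ps_cat C\<^esub> F \<cdot>\<^bsub>ps_cat C\<^esub> H"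
    and dG: "dif (ps_cat C) Y X 0 G + ps_const \<alpha> \<cdot>\<^bsub>ps_cat C\<^esub> G - G \<cdot>\<^bsub>ps_cat C\<^esub> S =
      - (eps X \<cdot>\<^bsub>ps_cat C\<^esub> H \<cdot>\<^bsub>ps_cat C\<^esub> G)"
    and dH: "dif (ps_cat C) X X (- 1) H + ps_const \<alpha> \<cdot>\<^bsub>ps_cat C\<^esub> H + H \<cdot>\<^bsub>ps_cat C\<^esub> ps_const \<alpha> =
      ident (ps_cat C) X - G \<cdot>\<^bsub>ps_cat C\<^esub> F - eps X \<cdot>\<^bsub>ps_cat C\<^esub> H \<cdot>\<^bsub>ps_cat C\<^esub> H"
    and dS: "dif (ps_cat C) Y Y 1 S + S \<cdot>\<^bsub>ps_cat C\<^esub> S =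
      zeps Y - eps Y \<cdot>\<^bsub>ps_cat C\<^esub> F \<cdot>\<^bsub>ps_cat C\<^esub> G"
    and S_eq: "S = ps_const \<beta> + eps_mult K"
  shows "(Y, \<beta>, z Y) \<in> Obj (cTw C)"
    and "strong_homotopy_equiv (cTw C) (X, \<alpha>, z X) (Y, \<beta>, z Y) F G H K"
proof -
  have O': "X \<in> Obj (ps_cat C)" "Y \<in> Obj (ps_cat C)" using O by simp_all
  have \<alpha>_in: "\<alpha> \<in> Hom C X X 1" using \<alpha> by (simp add: cTw_def)
  have "S 0 = \<beta>"
    by (simp add: S_eq ps_const_def)
  then have \<beta>_in: "\<beta> \<in> Hom C Y Y 1"
    using S by (metis diff_0_right mult_zero_right of_nat_0 ps_cat_simps(2))
  \<comment> \<open>Passing from \<epsilon>K to K shifts the index by one and lowers the degree by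
    2: 1 - 2(i + 1) = -1 - 2i.\<close>
  have "S (Suc i) = K i" for i
    by (simp add: S_eq ps_const_def)
  moreover have "S (Suc i) \<in> Hom C Y Y (1 - 2 * int (Suc i))" for i
    using S by (simp only: ps_cat_simps(2))
  moreover have "1 - 2 * int (Suc i) = - 1 - 2 * int i" for i
    by simp
  ultimately have K: "K \<in> Hom (ps_cat C) Y Y (- 1)"
    by (metis ps_cat_simps(2))
  note c\<beta> = ps_const_in[OF O(2,2) \<beta>_in]
  have eK: "eps_mult K \<in> Hom (ps_cat C) Y Y 1"
    using eps_mult_in[OF O(2,2) K] by simp
  have SF: "S \<cdot>\<^bsub>ps_cat C\<^esub> F = ps_const \<beta> \<cdot>\<^bsub>ps_cat C\<^esub> F + eps_mult (K \<cdot>\<^bsub>ps_cat C\<^esub> F)"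
    unfolding S_eq E.cmp_add_left[OF O'(1,2,2) c\<beta> eK F] eps_mult_cmp[OF O(1,2,2) F] ..
  have GS: "G \<cdot>\<^bsub>ps_cat C\<^esub> S = G \<cdot>\<^bsub>ps_cat C\<^esub> ps_const \<beta> + eps_mult (G \<cdot>\<^bsub>ps_cat C\<^esub> K)"
    unfolding S_eq E.cmp_add_right[OF O'(2,2,1) G c\<beta> eK] cmp_eps_mult[OF O(2,2,1) G] ..
  have FH: "eps Y \<cdot>\<^bsub>ps_cat C\<^esub> F \<cdot>\<^bsub>ps_cat C\<^esub> H = eps_mult (F \<cdot>\<^bsub>ps_cat C\<^esub> H)"
    by (rule eps_cmp[OF O E.cmp_in[OF O'(1,1,2) F H]])
  have HG: "eps X \<cdot>\<^bsub>ps_cat C\<^esub> H \<cdot>\<^bsub>ps_cat C\<^esub> G = eps_mult (H \<cdot>\<^bsub>ps_cat C\<^esub> G)"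
    by (rule eps_cmp[OF O(2,1) E.cmp_in[OF O'(2,1,1) H G]])
  have HH: "eps X \<cdot>\<^bsub>ps_cat C\<^esub> H \<cdot>\<^bsub>ps_cat C\<^esub> H = eps_mult (H \<cdot>\<^bsub>ps_cat C\<^esub> H)"
    by (rule eps_cmp[OF O(1,1) E.cmp_in[OF O'(1,1,1) H H]])
  have FG: "eps Y \<cdot>\<^bsub>ps_cat C\<^esub> F \<cdot>\<^bsub>ps_cat C\<^esub> G = eps_mult (F \<cdot>\<^bsub>ps_cat C\<^esub> G)"
    by (rule eps_cmp[OF O(2,2) E.cmp_in[OF O'(2,1,2) F G]])
  have dS_eq: "dif (ps_cat C) Y Y 1 S = ps_const (dif C Y Y 1 \<beta>) + eps_mult (dif (ps_cat C) Y Y (- 1) K)"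
    using dif_eps_mult[OF O(2,2), of "- 1" K] dif_ps_const[OF O(2,2), of 1 \<beta>]
      E.dif_add[OF O'(2,2) c\<beta> eK] by (simp add: S_eq del: ps_cat_simps(6))
  \<comment> \<open>Only the left factor is split at first; splitting the right one in each summand
    then gives a constant plus \<epsilon> times a series, the form in which \<epsilon> can be
    cancelled.\<close>
  have "S \<cdot>\<^bsub>ps_cat C\<^esub> S =
      ps_const \<beta> \<cdot>\<^bsub>ps_cat C\<^esub> S + eps_mult (K \<cdot>\<^bsub>ps_cat C\<^esub> S)"
    by (subst (1) S_eq) (simp only: E.cmp_add_left[OF O'(2,2,2) c\<beta> eK S] eps_mult_cmp[OF O(2,2,2) S])
  also have "ps_const \<beta> \<cdot>\<^bsub>ps_cat C\<^esub> S = ps_const (\<beta> \<cdot> \<beta>) + eps_mult (ps_const \<beta> \<cdot>\<^bsub>ps_cat C\<^esub> K)"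
    unfolding S_eq E.cmp_add_right[OF O'(2,2,2) c\<beta> c\<beta> eK] cmp_eps_mult[OF O(2,2,2) c\<beta>]
      ps_const_cmp_ps_const[OF O(2,2,2) \<beta>_in \<beta>_in] ..
  also have "K \<cdot>\<^bsub>ps_cat C\<^esub> S = K \<cdot>\<^bsub>ps_cat C\<^esub> ps_const \<beta> + eps_mult (K \<cdot>\<^bsub>ps_cat C\<^esub> K)"
    unfolding S_eq E.cmp_add_right[OF O'(2,2,2) K c\<beta> eK] cmp_eps_mult[OF O(2,2,2) K] ..
  \<comment> \<open>The constant term of z + \<epsilon> is the curvature wanted for \<beta>; its
    \<epsilon>-coefficient supplies the identity of \<open>Y\<close> in the equation for
    \<open>K\<close>.\<close>
  finally have "ps_const (dif C Y Y 1 \<beta> + \<beta> \<cdot> \<beta>)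
      + eps_mult (dif (ps_cat C) Y Y (- 1) K + ps_const \<beta> \<cdot>\<^bsub>ps_cat C\<^esub> K + K \<cdot>\<^bsub>ps_cat C\<^esub> ps_const \<beta>
        + eps_mult (K \<cdot>\<^bsub>ps_cat C\<^esub> K)) =
      ps_const (z Y) + eps_mult (ident (ps_cat C) Y - F \<cdot>\<^bsub>ps_cat C\<^esub> G)"
    using dS unfolding dS_eq FG z_plus_eps_def eps_mult_diff eps_mult_add ps_const_add
    by (simp only: add_ac add_diff_eq)
  note split = const_plus_eps_inject[OF this]
  show Y': "(Y, \<beta>, z Y) \<in> Obj (cTw C)"
    using split(1) O(2) \<beta>_in z_in by (simp add: cTw_def)
  note dif = dif_ps_cTw[OF O \<alpha>_in \<beta>_in F] dif_ps_cTw[OF O(2,1) \<beta>_in \<alpha>_in G]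
    dif_ps_cTw[OF O(1,1) \<alpha>_in \<alpha>_in H] dif_ps_cTw[OF O(2,2) \<beta>_in \<beta>_in K]
  show "strong_homotopy_equiv (cTw C) (X, \<alpha>, z X) (Y, \<beta>, z Y) F G H K"
    unfolding strong_homotopy_equiv_def Let_def cmp_ps_cTw ident_ps_cTw dif
      hom_ps_cTw[OF z_central O] hom_ps_cTw[OF z_central O(2,1)]
      hom_ps_cTw[OF z_central O(1,1)] hom_ps_cTw[OF z_central O(2,2)]
  proof (intro conjI \<alpha> Y' F G H K)
    show "dif (ps_cat C) X Y 0 F + ps_const \<beta> \<cdot>\<^bsub>ps_cat C\<^esub> F - ksign 0 (F \<cdot>\<^bsub>ps_cat C\<^esub> ps_const \<alpha>) =
        eps_mult (F \<cdot>\<^bsub>ps_cat C\<^esub> H - K \<cdot>\<^bsub>ps_cat C\<^esub> F)"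
      using dF unfolding SF FH eps_mult_diff by (simp add: ksign_def algebra_simps del: ps_cat_simps(5,6))
    show "dif (ps_cat C) Y X 0 G + ps_const \<alpha> \<cdot>\<^bsub>ps_cat C\<^esub> G - ksign 0 (G \<cdot>\<^bsub>ps_cat C\<^esub> ps_const \<beta>) =
        eps_mult (G \<cdot>\<^bsub>ps_cat C\<^esub> K - H \<cdot>\<^bsub>ps_cat C\<^esub> G)"
      using dG unfolding GS HG eps_mult_diff by (simp add: ksign_def algebra_simps del: ps_cat_simps(5,6))
    show "dif (ps_cat C) X X (- 1) H + ps_const \<alpha> \<cdot>\<^bsub>ps_cat C\<^esub> H
          - ksign (- 1) (H \<cdot>\<^bsub>ps_cat C\<^esub> ps_const \<alpha>) =
        ident (ps_cat C) X - G \<cdot>\<^bsub>ps_cat C\<^esub> F - eps_mult (H \<cdot>\<^bsub>ps_cat C\<^esub> H)"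
      using dH unfolding HH by (simp add: ksign_def del: ps_cat_simps(4,5,6))
    show "dif (ps_cat C) Y Y (- 1) K + ps_const \<beta> \<cdot>\<^bsub>ps_cat C\<^esub> K
          - ksign (- 1) (K \<cdot>\<^bsub>ps_cat C\<^esub> ps_const \<beta>) =
        ident (ps_cat C) Y - F \<cdot>\<^bsub>ps_cat C\<^esub> G - eps_mult (K \<cdot>\<^bsub>ps_cat C\<^esub> K)"
      using split(2) by (simp add: ksign_def algebra_simps del: ps_cat_simps(4,5,6))
  qed
qed

text \<open>The two closed central elements are now z + \<epsilon> and \<epsilon>, and smallness of
  \<alpha> brings both inverses within reach of the geometric series.\<close>

lemma perturbed_strong_homotopy_equiv:
  assumes she: "strong_homotopy_equiv C X Y f' g' h' k'"
    and f: "substitutes X Y 0 f' f" and g: "substitutes Y X 0 g' g"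
    and h: "substitutes X X (- 1) h' h" and k: "substitutes Y Y (- 1) k' k"
    and \<alpha>: "(X, \<alpha>, z X) \<in> Obj (cTw C)" and \<alpha>_filt: "\<alpha> \<in> N 1 X X 1"
    and A_def: "A = mor_inv (ps_cat C) X (ident (ps_cat C) X + ps_const \<alpha> \<cdot>\<^bsub>ps_cat C\<^esub> h)"
    and B_def: "B = mor_inv (ps_cat C) X (ident (ps_cat C) X + h \<cdot>\<^bsub>ps_cat C\<^esub> ps_const \<alpha>)"
    and S_eq: "zeps Y \<cdot>\<^bsub>ps_cat C\<^esub> k + f \<cdot>\<^bsub>ps_cat C\<^esub> ps_const \<alpha> \<cdot>\<^bsub>ps_cat C\<^esub> B \<cdot>\<^bsub>ps_cat C\<^esub> g =
      ps_const \<beta> + eps_mult K"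
  shows "\<exists>!u. is_inverse (ps_cat C) X (ident (ps_cat C) X + ps_const \<alpha> \<cdot>\<^bsub>ps_cat C\<^esub> h) u"
    and "\<exists>!v. is_inverse (ps_cat C) X (ident (ps_cat C) X + h \<cdot>\<^bsub>ps_cat C\<^esub> ps_const \<alpha>) v"
    and "(Y, \<beta>, z Y) \<in> Obj (cTw C)"
    and "strong_homotopy_equiv (cTw C) (X, \<alpha>, z X) (Y, \<beta>, z Y)
      (f \<cdot>\<^bsub>ps_cat C\<^esub> A) (B \<cdot>\<^bsub>ps_cat C\<^esub> g) (h \<cdot>\<^bsub>ps_cat C\<^esub> A) K"
proof -
  have O: "X \<in> Obj C" "Y \<in> Obj C"
    using she by (auto simp: strong_homotopy_equiv_def Let_def)
  then have O': "X \<in> Obj (ps_cat C)" "Y \<in> Obj (ps_cat C)" by simp_all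
  have \<alpha>_in: "\<alpha> \<in> Hom C X X 1" and d\<alpha>: "dif C X X 1 \<alpha> + \<alpha> \<cdot> \<alpha> = z X"
    using \<alpha> by (simp_all add: cTw_def)
  note h_in = substitutes_in[OF h]
  have c\<alpha>: "ps_const \<alpha> \<in> ps_filt N 1 X X 1"
    using \<alpha>_filt filt_zero[OF O(1,1)] by (auto simp: ps_filt_iff ps_const_def)
  have \<alpha>h: "ps_const \<alpha> \<cdot>\<^bsub>ps_cat C\<^esub> h \<in> ps_filt N 1 X X 0"
    using E.filt_cmp_hom_right[OF O'(1,1,1) c\<alpha> h_in] by simp
  have h\<alpha>: "h \<cdot>\<^bsub>ps_cat C\<^esub> ps_const \<alpha> \<in> ps_filt N 1 X X 0"
    using E.filt_cmp_hom_left[OF O'(1,1,1) h_in c\<alpha>] by simp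
  show "\<exists>!u. is_inverse (ps_cat C) X (ident (ps_cat C) X + ps_const \<alpha> \<cdot>\<^bsub>ps_cat C\<^esub> h) u"
    by (rule E.ex1_inverse[OF O'(1) \<alpha>h])
  show "\<exists>!v. is_inverse (ps_cat C) X (ident (ps_cat C) X + h \<cdot>\<^bsub>ps_cat C\<^esub> ps_const \<alpha>) v"
    by (rule E.ex1_inverse[OF O'(1) h\<alpha>])
  note A = E.mor_inv_props[OF O'(1) \<alpha>h, folded A_def]
  note B = E.mor_inv_props[OF O'(1) h\<alpha>, folded B_def]
  \<comment> \<open>The difference of z + \<epsilon> and \<epsilon> is the constant z, so the
    curvature equation of \<alpha> takes the form that \<open>perturbation\<close> asks for.\<close>
  have da: "dif (ps_cat C) X X 1 (ps_const \<alpha>) + ps_const \<alpha> \<cdot>\<^bsub>ps_cat C\<^esub> ps_const \<alpha> = zeps X - eps X"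
    unfolding dif_ps_const[OF O(1,1)] ps_const_cmp_ps_const[OF O(1,1,1) \<alpha>_in \<alpha>_in]
      ps_const_add[symmetric] d\<alpha> z_plus_eps_def by simp
  note pert = E.perturbation[OF O' closed_central_zeps closed_central_eps
      substitutes_in[OF f] substitutes_in[OF g] h_in substitutes_in[OF k]
      ps_const_in[OF O(1,1) \<alpha>_in] A(1) B(1) substitutes_strong_homotopy_equiv[OF she f g h k]
      da A(3,2) B(2) refl refl refl refl]
  show "(Y, \<beta>, z Y) \<in> Obj (cTw C)"
    by (rule curved_strong_homotopy_equiv(1)[OF O \<alpha> pert S_eq])
  show "strong_homotopy_equiv (cTw C) (X, \<alpha>, z X) (Y, \<beta>, z Y)
      (f \<cdot>\<^bsub>ps_cat C\<^esub> A) (B \<cdot>\<^bsub>ps_cat C\<^esub> g) (h \<cdot>\<^bsub>ps_cat C\<^esub> A) K"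
    by (rule curved_strong_homotopy_equiv(2)[OF O \<alpha> pert S_eq])
qed

end

theorem theorem4p6:
  fixes C :: "('o, 'm::ab_group_add, 'k::{comm_ring, comm_monoid_mult}) dgcat"
    and E :: "('o, nat \<Rightarrow> 'm, 'k) dgcat"
    and \<nn> :: "'o \<Rightarrow> 'o \<Rightarrow> int \<Rightarrow> 'm set"
    and z :: "'o \<Rightarrow> 'm"
    and X Y :: 'o
    and f' g' h' k' f g h k F G H K R :: "nat \<Rightarrow> 'm"
    and \<alpha> \<beta> :: 'm
  assumes C: "dg_category C"
    and z: "closed_central2 C z"
    and X: "X \<in> Obj C" and Y: "Y \<in> Obj C"
    and she: "strong_homotopy_equiv C X Y f' g' h' k'"
    and ideal: "two_sided_ideal C \<nn>"
    and z_in_ideal: "\<And>W. W \<in> Obj C \<Longrightarrow> z W \<in> \<nn> W W 2"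
    and complete: "complete_wrt C \<nn>"
    and twisted: "(X, \<alpha>, z X) \<in> Obj (cTw C)"
    and alpha_in_ideal: "\<alpha> \<in> \<nn> X X 1"
    and E_def: "E = ps_cat C"
    and f_def: "f = subst_eps C \<nn> z X Y 0 f'"
    and g_def: "g = subst_eps C \<nn> z Y X 0 g'"
    and h_def: "h = subst_eps C \<nn> z X X (-1) h'"
    and k_def: "k = subst_eps C \<nn> z Y Y (-1) k'"
    and F_def: "F = f \<cdot>\<^bsub>E\<^esub> mor_inv E X (ident E X + ps_const \<alpha> \<cdot>\<^bsub>E\<^esub> h)"
    and G_def: "G = mor_inv E X (ident E X + h \<cdot>\<^bsub>E\<^esub> ps_const \<alpha>) \<cdot>\<^bsub>E\<^esub> g"
    and H_def: "H = h \<cdot>\<^bsub>E\<^esub> mor_inv E X (ident E X + ps_const \<alpha> \<cdot>\<^bsub>E\<^esub> h)"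
    and R_def: "R = z_plus_eps C z Y \<cdot>\<^bsub>E\<^esub> k
                  + f \<cdot>\<^bsub>E\<^esub> ps_const \<alpha> \<cdot>\<^bsub>E\<^esub> mor_inv E X (ident E X + h \<cdot>\<^bsub>E\<^esub> ps_const \<alpha>) \<cdot>\<^bsub>E\<^esub> g"
    and beta_def: "\<beta> = R 0"
    and K_def: "eps_mult K = (\<lambda>i. if i = 0 then 0 else R i)"
  shows "(\<exists>!s. is_subst C \<nn> z X Y 0 f' s) \<and>
         (\<exists>!s. is_subst C \<nn> z Y X 0 g' s) \<and>
         (\<exists>!s. is_subst C \<nn> z X X (-1) h' s) \<and>
         (\<exists>!s. is_subst C \<nn> z Y Y (-1) k' s) \<and>
         f \<in> Hom E X Y 0 \<and> g \<in> Hom E Y X 0 \<and> h \<in> Hom E X X (-1) \<and> k \<in> Hom E Y Y (-1) \<and>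
         (\<exists>!u. is_inverse E X (ident E X + ps_const \<alpha> \<cdot>\<^bsub>E\<^esub> h) u) \<and>
         (\<exists>!v. is_inverse E X (ident E X + h \<cdot>\<^bsub>E\<^esub> ps_const \<alpha>) v) \<and>
         (Y, \<beta>, z Y) \<in> Obj (cTw C) \<and>
         strong_homotopy_equiv (cTw C) (X, \<alpha>, z X) (Y, \<beta>, z Y) F G H K"
proof -
  interpret dg_category C by (rule C)
  interpret dg_ideal C \<nn> by unfold_locales (rule ideal)
  interpret filtered_dg_category C "ideal_pow C \<nn>" by (rule filtered_ideal_pow[OF complete])
  have z_filt: "z W \<in> ideal_pow C \<nn> 1 W W 2" if "W \<in> Obj C" for W
    by (rule fold_comps_ideal_pow) (simp add: z_in_ideal[OF that])
  interpret subst_category C "ideal_pow C \<nn>" z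
    by unfold_locales (use z z_filt in simp_all)
  \<comment> \<open>Both notions of convergence agree, so existence and uniqueness carry over to the
    description in \<open>subst_eps\<close>.\<close>
  have is_subst: "is_subst C \<nn> z U V n a s \<longleftrightarrow> substitutes U V n a s"
    if "U \<in> Obj C" "V \<in> Obj C" "a \<in> Hom (ps_cat C) U V n" for U V n a s
    unfolding is_subst_def adic_sums_def substitutes_iff_coeffs[OF that] subst_term_def ..
  have ex1: "\<exists>!s. is_subst C \<nn> z U V n a s"
    and subst: "substitutes U V n a (subst_eps C \<nn> z U V n a)"
    if "U \<in> Obj C" "V \<in> Obj C" "a \<in> Hom (ps_cat C) U V n" for U V n a
  proof -
    show ex1: "\<exists>!s. is_subst C \<nn> z U V n a s"
      using ex1_substitutes[OF that] by (simp only: is_subst[OF that])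
    show "substitutes U V n a (subst_eps C \<nn> z U V n a)"
      using theI'[OF ex1] unfolding subst_eps_def is_subst[OF that] .
  qed
  have f': "f' \<in> Hom (ps_cat C) X Y 0" and g': "g' \<in> Hom (ps_cat C) Y X 0"
    and h': "h' \<in> Hom (ps_cat C) X X (- 1)" and k': "k' \<in> Hom (ps_cat C) Y Y (- 1)"
    using she[unfolded strong_homotopy_equiv_def Let_def] by blast+
  have f: "substitutes X Y 0 f' f" unfolding f_def by (rule subst[OF X Y f'])
  have g: "substitutes Y X 0 g' g" unfolding g_def by (rule subst[OF Y X g'])
  have h: "substitutes X X (- 1) h' h" unfolding h_def by (rule subst[OF X X h'])
  have k: "substitutes Y Y (- 1) k' k" unfolding k_def by (rule subst[OF Y Y k'])
  have \<alpha>_filt: "\<alpha> \<in> ideal_pow C \<nn> 1 X X 1"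
    by (rule fold_comps_ideal_pow) (simp add: alpha_in_ideal)
  \<comment> \<open>Adding the constant term back to the truncated series \<epsilon>K recovers
    R.\<close>
  have R_eq: "R = ps_const \<beta> + eps_mult K"
    unfolding K_def beta_def by (rule ext) (simp add: ps_const_def)
  note result = perturbed_strong_homotopy_equiv[OF she f g h k twisted \<alpha>_filt refl refl
      R_eq[unfolded R_def E_def]]
  show ?thesis
    unfolding F_def G_def H_def E_def
    by (intro conjI ex1 X Y f' g' h' k' substitutes_in[OF f] substitutes_in[OF g]
        substitutes_in[OF h] substitutes_in[OF k] result)
qed

end
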